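(* There is an absolute constant $c>0$ such that for every $n\geqslant2$ and every convex body $K$ in $\mathbb{R}^n$ which is in John's position, $$S(K)\leqslant c\,\frac{n^{3/2}}{\sqrt{\log n}}\,|K|\,M(K).$$
   Context: A convex body in $\mathbb{R}^n$ is a compact convex set with non-empty interior. $K$ is in John's position if the Euclidean unit ball $B_2^n$ is the ellipsoid of maximal volume inscribed in $K$. $|\cdot|$ is volume, $S(K)$ is the surface area of $K$, $\sigma$ is the rotationally invariant probability measure on $S^{n-1}$, $\|x\|_K=\min\{t\geqslant0:x\in tK\}$ is the Minkowski functional of $K$, and $M(K)=\int_{S^{n-1}}\|\xi\|_K\,d\sigma(\xi)$. *)

theory Defs
  imports "HOL-Probability.Probability"
begin

text \<open>
  The constant of the theorem does not depend on the dimension, so the dimension has to be a term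
  and not a type. As in \<^theory>\<open>HOL-Analysis.Abstract_Euclidean_Space\<close>, the space of dimension
  \<open>n\<close> consists of the sequences that vanish from index \<open>n\<close> on. Its topology is the one induced by
  the product topology, so the Borel sets below are those of the type class topology on functions.
\<close>

abbreviation Rn :: "nat \<Rightarrow> (nat \<Rightarrow> real) set"
  where "Rn n \<equiv> topspace (Euclidean_space n)"

definition enorm :: "nat \<Rightarrow> (nat \<Rightarrow> real) \<Rightarrow> real"
  where "enorm n x = L2_set x {..<n}"

definition unit_ball :: "nat \<Rightarrow> (nat \<Rightarrow> real) set"
  where "unit_ball n = {x \<in> Rn n. enorm n x \<le> 1}"

definition unit_sphere :: "nat \<Rightarrow> (nat \<Rightarrow> real) set"
  where "unit_sphere n = {x \<in> Rn n. enorm n x = 1}"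

text \<open>
  Lebesgue measure on the Borel sets: the product measure on functions with domain
  \<open>{..<n}\<close>, transported by extending these functions with zeros.
\<close>

definition zero_extend :: "nat \<Rightarrow> (nat \<Rightarrow> real) \<Rightarrow> (nat \<Rightarrow> real)"
  where "zero_extend n x = (\<lambda>i. if i < n then x i else 0)"

definition lebesgue_Rn :: "nat \<Rightarrow> (nat \<Rightarrow> real) measure"
  where "lebesgue_Rn n = distr (\<Pi>\<^sub>M i\<in>{..<n}. lborel) borel (zero_extend n)"

definition vol :: "nat \<Rightarrow> (nat \<Rightarrow> real) set \<Rightarrow> real"
  where "vol n A = measure (lebesgue_Rn n) A"

lemma measurable_zero_extend:
  "zero_extend n \<in> measurable (\<Pi>\<^sub>M i\<in>{..<n}. lborel) borel"
proof (rule measurable_coordinatewise_then_product)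
  fix i
  show "(\<lambda>x. zero_extend n x i) \<in> borel_measurable (\<Pi>\<^sub>M i\<in>{..<n}. lborel)"
    by (cases "i < n") (auto simp: zero_extend_def)
qed

definition convex_body :: "nat \<Rightarrow> (nat \<Rightarrow> real) set \<Rightarrow> bool"
  where "convex_body n K \<longleftrightarrow>
    compactin (Euclidean_space n) K \<and>
    (\<forall>x\<in>K. \<forall>y\<in>K. \<forall>u\<ge>0. \<forall>v\<ge>0. u + v = 1 \<longrightarrow> (\<lambda>i. u * x i + v * y i) \<in> K) \<and>
    (Euclidean_space n) interior_of K \<noteq> {}"

definition mat_apply :: "nat \<Rightarrow> (nat \<Rightarrow> nat \<Rightarrow> real) \<Rightarrow> (nat \<Rightarrow> real) \<Rightarrow> (nat \<Rightarrow> real)"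
  where "mat_apply n A x = (\<lambda>i. if i < n then \<Sum>j<n. A i j * x j else 0)"

definition ellipsoid :: "nat \<Rightarrow> (nat \<Rightarrow> real) set \<Rightarrow> bool"
  where "ellipsoid n E \<longleftrightarrow>
    (\<exists>a\<in>Rn n. \<exists>A. bij_betw (mat_apply n A) (Rn n) (Rn n) \<and>
      E = (\<lambda>x i. a i + mat_apply n A x i) ` unit_ball n)"

definition johns_position :: "nat \<Rightarrow> (nat \<Rightarrow> real) set \<Rightarrow> bool"
  where "johns_position n K \<longleftrightarrow>
    unit_ball n \<subseteq> K \<and>
    (\<forall>E. ellipsoid n E \<and> E \<subseteq> K \<longrightarrow> vol n E \<le> vol n (unit_ball n))"

text \<open>
  Surface area as the derivative at \<open>0\<close> of the volume of the parallel bodies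
  \<open>K + t B\<close>, with \<open>B\<close> the unit ball. The limit exists for every convex body (Steiner formula).
\<close>

definition parallel_body :: "nat \<Rightarrow> (nat \<Rightarrow> real) set \<Rightarrow> real \<Rightarrow> (nat \<Rightarrow> real) set"
  where "parallel_body n K t = {(\<lambda>i. x i + t * b i) | x b. x \<in> K \<and> b \<in> unit_ball n}"

definition surface_area :: "nat \<Rightarrow> (nat \<Rightarrow> real) set \<Rightarrow> real"
  where "surface_area n K =
    Lim (at_right 0) (\<lambda>t. (vol n (parallel_body n K t) - vol n K) / t)"

definition minkowski_functional :: "(nat \<Rightarrow> real) set \<Rightarrow> (nat \<Rightarrow> real) \<Rightarrow> real"
  where "minkowski_functional K x = (LEAST t. 0 \<le> t \<and> x \<in> (\<lambda>y i. t * y i) ` K)"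

definition orthogonal_mat :: "nat \<Rightarrow> (nat \<Rightarrow> nat \<Rightarrow> real) \<Rightarrow> bool"
  where "orthogonal_mat n A \<longleftrightarrow>
    (\<forall>i<n. \<forall>j<n. (\<Sum>k<n. A k i * A k j) = (if i = j then 1 else 0))"

text \<open>Borel probability measures on the unit sphere; the sets clause also fixes the space.\<close>

definition rotation_invariant_prob :: "nat \<Rightarrow> (nat \<Rightarrow> real) measure \<Rightarrow> bool"
  where "rotation_invariant_prob n \<mu> \<longleftrightarrow>
    sets \<mu> = sets (restrict_space borel (unit_sphere n)) \<and>
    prob_space \<mu> \<and>
    (\<forall>A. orthogonal_mat n A \<longrightarrow> distr \<mu> \<mu> (mat_apply n A) = \<mu>)"

text \<open>For \<open>n \<ge> 1\<close> there is exactly one such measure.\<close>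

definition sphere_measure :: "nat \<Rightarrow> (nat \<Rightarrow> real) measure"
  where "sphere_measure n = (THE \<mu>. rotation_invariant_prob n \<mu>)"

definition mean_norm :: "nat \<Rightarrow> (nat \<Rightarrow> real) set \<Rightarrow> real"
  where "mean_norm n K = (\<integral>\<xi>. minkowski_functional K \<xi> \<partial>sphere_measure n)"

end

theory Submission
  imports Defs
begin

text \<open>
  Both factors of the inequality come from the fact that \<open>K\<close> contains the unit ball \<open>B\<close>, the
  second one also from the maximality of the volume of \<open>B\<close>.

  Upper bound for the surface area (\<open>surface_area_le\<close>). As \<open>B \<subseteq> K\<close>, the parallel body \<open>K + t B\<close> lies
  in \<open>(1 + t) K\<close>, so its volume grows at most at the rate \<open>n vol K\<close>, whence \<open>S(K) \<le> n vol K\<close>. The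
  derivative that defines \<open>S(K)\<close> exists because the volume of \<open>K + t B\<close> is \<open>n + 1\<close> times the integral
  of one minus its gauge, and the gauge at a fixed point is a convex function of \<open>t\<close>.

  Lower bound for the mean gauge (\<open>mean_norm_lower_bound\<close>). It remains to show
  \<open>M(K) \<ge> c \<surd>(ln n) / \<surd>n\<close>. If \<open>B\<close> is flattened in \<open>k\<close> directions and stretched in the others so that the
  volume grows, the ellipsoid leaves \<open>K\<close>, and a functional of the polar body
  separates some point of it from \<open>K\<close>. Such a functional has norm at most 1 and is nearly
  orthogonal to the \<open>k\<close> directions. Choosing functionals one after the other in this way gives a
  system that is triangular in suitable orthonormal coordinates, with diagonal entries bounded below
  and small entries off the diagonal (\<open>dvoretzky_rogers_polar\<close>). The gauge dominates each of these
  functionals. For a Gaussian vector the maximum of about \<open>\<surd>n\<close> independent coordinates is of order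
  \<open>\<surd>(ln n)\<close>, the error caused by the entries off the diagonal is bounded, and the norm is of order
  \<open>\<surd>n\<close> (\<open>mean_norm_ge\<close>).

  The Gaussian vector enters because the measure \<open>\<sigma>\<close> on the sphere, which is defined as the unique
  rotation-invariant probability, is the law of the normalized Gaussian vector. Uniqueness holds because
  exponential integrals \<open>\<integral> exp \<langle>a, x\<rangle> d\<mu>(x)\<close> of such a measure are determined by \<open>\<bar>a\<bar>\<close>, and
  combinations of exponentials are dense in the continuous functions. Existence uses that
  Lebesgue measure is rotation invariant, which also yields the volumes of ellipsoids.
\<close>

section \<open>Coordinate vectors and orthogonal matrices\<close>

definition dot :: "nat \<Rightarrow> (nat \<Rightarrow> real) \<Rightarrow> (nat \<Rightarrow> real) \<Rightarrow> real"
  where "dot n x y = (\<Sum>i<n. x i * y i)"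

abbreviation (input) transpose_mat :: "(nat \<Rightarrow> nat \<Rightarrow> real) \<Rightarrow> nat \<Rightarrow> nat \<Rightarrow> real"
  where "transpose_mat A \<equiv> \<lambda>i j. A j i"

lemma in_Rn: "x \<in> Rn n \<longleftrightarrow> (\<forall>i\<ge>n. x i = 0)"
  by (simp add: topspace_Euclidean_space)

lemma Rn_eqI:
  assumes "x \<in> Rn n" "y \<in> Rn n" "\<And>i. i < n \<Longrightarrow> x i = y i"
  shows "x = y"
proof
  fix i show "x i = y i"
    using assms by (cases "i < n") (auto simp: in_Rn)
qed

lemma dot_commute: "dot n x y = dot n y x"
  by (simp add: dot_def mult.commute)

lemma dot_cong: "(\<And>i. i < n \<Longrightarrow> x i = x' i) \<Longrightarrow> (\<And>i. i < n \<Longrightarrow> y i = y' i) \<Longrightarrow> dot n x y = dot n x' y'"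
  by (simp add: dot_def)

lemma dot_add_left: "dot n (\<lambda>i. x i + y i) z = dot n x z + dot n y z"
  by (simp add: dot_def algebra_simps sum.distrib)

lemma dot_diff_left: "dot n (\<lambda>i. x i - y i) z = dot n x z - dot n y z"
  by (simp add: dot_def algebra_simps sum_subtractf)

lemma dot_scale_left: "dot n (\<lambda>i. c * x i) z = c * dot n x z"
  by (simp add: dot_def sum_distrib_left mult.assoc)

lemma dot_diff_right: "dot n z (\<lambda>i. x i - y i) = dot n z x - dot n z y"
  by (simp add: dot_def algebra_simps sum_subtractf)

lemma dot_scale_right: "dot n z (\<lambda>i. c * x i) = c * dot n z x"
  by (simp add: dot_def sum_distrib_left mult_ac)

lemma dot_nonneg: "0 \<le> dot n x x"
  by (auto simp: dot_def intro: sum_nonneg)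

lemma enorm_eq_sqrt_dot: "enorm n x = sqrt (dot n x x)"
  by (simp add: enorm_def L2_set_def dot_def power2_eq_square)

lemma enorm_sq: "(enorm n x)\<^sup>2 = dot n x x"
  by (simp add: enorm_eq_sqrt_dot dot_nonneg)

lemma enorm_nonneg: "0 \<le> enorm n x"
  by (simp add: enorm_eq_sqrt_dot dot_nonneg)

lemma enorm_le_1_iff: "enorm n x \<le> 1 \<longleftrightarrow> dot n x x \<le> 1"
  by (simp add: enorm_eq_sqrt_dot)

lemma enorm_cong: "(\<And>i. i < n \<Longrightarrow> x i = y i) \<Longrightarrow> enorm n x = enorm n y"
  by (simp add: enorm_eq_sqrt_dot dot_def)

lemma enorm_scale: "enorm n (\<lambda>i. c * x i) = \<bar>c\<bar> * enorm n x"
  by (simp add: enorm_eq_sqrt_dot dot_scale_left dot_scale_right real_sqrt_mult flip: mult.assoc)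

lemma enorm_eq_0: "x \<in> Rn n \<Longrightarrow> enorm n x = 0 \<longleftrightarrow> x = (\<lambda>_. 0)"
proof
  assume "x \<in> Rn n" "enorm n x = 0"
  then show "x = (\<lambda>_. 0)"
    by (intro Rn_eqI[of _ n])
      (auto simp: enorm_eq_sqrt_dot dot_def sum_nonneg_eq_0_iff in_Rn)
qed (simp add: enorm_eq_sqrt_dot dot_def)

lemma dot_le_enorm: "dot n x y \<le> enorm n x * enorm n y"
proof -
  have "dot n x y \<le> (\<Sum>i<n. \<bar>x i\<bar> * \<bar>y i\<bar>)"
    unfolding dot_def by (intro sum_mono) (simp add: abs_mult flip: abs_mult)
  also have "\<dots> \<le> enorm n x * enorm n y"
    unfolding enorm_def by (rule L2_set_mult_ineq)
  finally show ?thesis .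
qed

lemma enorm_triangle: "enorm n (\<lambda>i. x i + y i) \<le> enorm n x + enorm n y"
  unfolding enorm_def by (rule L2_set_triangle_ineq)

lemma abs_coordinate_le_enorm: "i < n \<Longrightarrow> \<bar>x i\<bar> \<le> enorm n x"
  unfolding enorm_eq_sqrt_dot dot_def
  by (rule real_le_rsqrt) (auto simp: power2_eq_square intro: member_le_sum[of i "{..<n}" "\<lambda>i. x i * x i"])

lemma mat_apply_in_Rn [simp]: "mat_apply n A x \<in> Rn n"
  by (simp add: in_Rn mat_apply_def)

lemma dot_mat_apply: "dot n (mat_apply n A x) y = dot n x (mat_apply n (transpose_mat A) y)"
proof -
  have "dot n (mat_apply n A x) y = (\<Sum>i<n. \<Sum>j<n. A i j * x j * y i)"
    by (simp add: dot_def mat_apply_def sum_distrib_right)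
  also have "\<dots> = (\<Sum>j<n. \<Sum>i<n. A i j * x j * y i)"
    by (rule sum.swap)
  also have "\<dots> = dot n x (mat_apply n (transpose_mat A) y)"
    by (simp add: dot_def mat_apply_def sum_distrib_left mult_ac)
  finally show ?thesis .
qed

lemma mat_apply_add: "mat_apply n A (\<lambda>i. x i + y i) = (\<lambda>i. mat_apply n A x i + mat_apply n A y i)"
  by (auto simp: mat_apply_def algebra_simps sum.distrib)

lemma mat_apply_scale: "mat_apply n A (\<lambda>i. c * x i) = (\<lambda>i. c * mat_apply n A x i)"
  by (auto simp: mat_apply_def sum_distrib_left mult_ac)

lemma mat_apply_cong: "(\<And>i. i < n \<Longrightarrow> x i = y i) \<Longrightarrow> mat_apply n A x = mat_apply n A y"
  by (auto simp: mat_apply_def)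

definition mat_mult :: "nat \<Rightarrow> (nat \<Rightarrow> nat \<Rightarrow> real) \<Rightarrow> (nat \<Rightarrow> nat \<Rightarrow> real) \<Rightarrow> nat \<Rightarrow> nat \<Rightarrow> real"
  where "mat_mult n A B = (\<lambda>i j. \<Sum>k<n. A i k * B k j)"

lemma mat_apply_mat_mult: "mat_apply n (mat_mult n A B) x = mat_apply n A (mat_apply n B x)"
proof
  fix i
  have "(\<Sum>j<n. (\<Sum>k<n. A i k * B k j) * x j) = (\<Sum>k<n. A i k * (\<Sum>j<n. B k j * x j))"
    unfolding sum_distrib_right sum_distrib_left by (subst sum.swap) (simp add: mult_ac)
  then show "mat_apply n (mat_mult n A B) x i = mat_apply n A (mat_apply n B x) i"
    by (simp add: mat_apply_def mat_mult_def)
qed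

text \<open>
  For square matrices orthonormal columns force orthonormal rows. The matrix \<open>P = A A\<^sup>T\<close> is a
  symmetric idempotent, so \<open>P i i = (\<Sum>j. (P i j)\<^sup>2) \<ge> (P i i)\<^sup>2\<close> and hence \<open>P i i \<le> 1\<close>; but the
  trace of \<open>P\<close> is the squared Frobenius norm \<open>n\<close> of \<open>A\<close>. So all inequalities are equalities.
\<close>

lemma orthogonal_mat_transp:
  assumes A: "orthogonal_mat n A"
  shows "orthogonal_mat n (transpose_mat A)"
proof -
  define P where "P i j = (\<Sum>k<n. A i k * A j k)" for i j
  have sym: "P i j = P j i" for i j
    by (simp add: P_def mult.commute)
  have idem: "(\<Sum>j<n. P i j * P j l) = P i l" for i l
  proof -
    have "(\<Sum>j<n. P i j * P j l) = (\<Sum>j<n. \<Sum>k<n. \<Sum>m<n. (A i k * A j k) * (A j m * A l m))"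
      by (simp add: P_def sum_product)
    also have "\<dots> = (\<Sum>k<n. \<Sum>m<n. \<Sum>j<n. (A i k * A j k) * (A j m * A l m))"
      by (subst sum.swap, rule sum.cong[OF refl], rule sum.swap)
    also have "\<dots> = (\<Sum>k<n. \<Sum>m<n. A i k * A l m * (\<Sum>j<n. A j k * A j m))"
      by (simp add: sum_distrib_left mult_ac)
    also have "\<dots> = (\<Sum>k<n. \<Sum>m<n. A i k * A l m * (if k = m then 1 else 0))"
      using A by (intro sum.cong refl) (auto simp: orthogonal_mat_def)
    also have "\<dots> = P i l"
      by (simp add: P_def if_distrib cong: if_cong)
    finally show ?thesis .
  qed
  have row: "P i i = (\<Sum>j<n. (P i j)\<^sup>2)" for i
    unfolding idem[of i i, symmetric] power2_eq_square by (intro sum.cong refl) (metis sym)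
  have diag: "P i i = 1" if "i < n" for i
  proof -
    have le: "P i i \<le> 1" if "i < n" for i
    proof -
      have "(P i i)\<^sup>2 \<le> P i i"
        using that by (subst (2) row) (rule member_le_sum[of i], auto)
      then show ?thesis
        using mult_strict_right_mono[of 1 "P i i" "P i i"] by (fastforce simp: power2_eq_square)
    qed
    have "(\<Sum>i<n. P i i) = (\<Sum>k<n. \<Sum>i<n. A i k * A i k)"
      unfolding P_def by (rule sum.swap)
    also have "\<dots> = (\<Sum>k<n. 1)"
      using A by (intro sum.cong refl) (auto simp: orthogonal_mat_def)
    finally have "(\<Sum>i<n. 1 - P i i) = 0"
      by (simp add: sum_subtractf)
    then have "\<forall>i\<in>{..<n}. 1 - P i i = 0"
      using le by (subst (asm) sum_nonneg_eq_0_iff) auto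
    then show ?thesis
      using that by auto
  qed
  have off: "P i j = 0" if "i < n" "j < n" "i \<noteq> j" for i j
  proof -
    have "(P i i)\<^sup>2 + (P i j)\<^sup>2 = (\<Sum>l\<in>{i, j}. (P i l)\<^sup>2)"
      using that by simp
    also have "\<dots> \<le> P i i"
      using that by (subst row) (intro sum_mono2, auto)
    finally show ?thesis
      using diag[OF that(1)] by simp
  qed
  show ?thesis
    unfolding orthogonal_mat_def using diag off by (auto simp: P_def)
qed

lemma orthogonal_mat_left_inverse:
  assumes A: "orthogonal_mat n A" and x: "x \<in> Rn n"
  shows "mat_apply n (transpose_mat A) (mat_apply n A x) = x"
proof (rule Rn_eqI[of _ n])
  fix i assume i: "i < n"
  have "mat_apply n (transpose_mat A) (mat_apply n A x) i = (\<Sum>j<n. (\<Sum>k<n. A k i * A k j) * x j)"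
    using i by (subst mat_apply_mat_mult[symmetric]) (simp add: mat_mult_def mat_apply_def)
  also have "\<dots> = (\<Sum>j<n. (if i = j then 1 else 0) * x j)"
    using A i by (intro sum.cong refl) (auto simp: orthogonal_mat_def)
  also have "\<dots> = x i"
    using i by (simp add: if_distrib[of "\<lambda>c. c * _"] cong: if_cong)
  finally show "mat_apply n (transpose_mat A) (mat_apply n A x) i = x i" .
qed (use x in auto)

lemma orthogonal_mat_right_inverse:
  assumes "orthogonal_mat n A" "x \<in> Rn n"
  shows "mat_apply n A (mat_apply n (transpose_mat A) x) = x"
  using orthogonal_mat_left_inverse[OF orthogonal_mat_transp[OF assms(1)] assms(2)] by simp

lemma orthogonal_mat_dot:
  assumes A: "orthogonal_mat n A"
  shows "dot n (mat_apply n A x) (mat_apply n A y) = dot n x y"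
proof -
  let ?y = "\<lambda>i. if i < n then y i else 0"
  have "mat_apply n A y = mat_apply n A ?y"
    by (rule mat_apply_cong) simp
  then have "dot n (mat_apply n A x) (mat_apply n A y) = dot n x ?y"
    using orthogonal_mat_left_inverse[OF A, of ?y] by (simp add: dot_mat_apply in_Rn)
  then show ?thesis
    by (simp add: dot_def)
qed

lemma orthogonal_mat_enorm: "orthogonal_mat n A \<Longrightarrow> enorm n (mat_apply n A x) = enorm n x"
  by (simp add: enorm_eq_sqrt_dot orthogonal_mat_dot)

lemma orthogonal_matI_dot:
  assumes "\<And>x y. dot n (mat_apply n A x) (mat_apply n A y) = dot n x y"
  shows "orthogonal_mat n A"
  unfolding orthogonal_mat_def
proof (intro allI impI)
  fix i j assume ij: "i < n" "j < n"
  let ?d = "\<lambda>i j. if j = i then 1 else (0::real)"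
  have col: "mat_apply n A (?d i) k = A k i" if "k < n" "i < n" for i k
    using that by (simp add: mat_apply_def if_distrib cong: if_cong)
  have "(\<Sum>k<n. A k i * A k j) = dot n (mat_apply n A (?d i)) (mat_apply n A (?d j))"
    using ij by (simp add: dot_def col)
  also have "\<dots> = (if i = j then 1 else 0)"
  proof -
    have "(\<Sum>k<n. ?d i k * ?d j k) = (\<Sum>k<n. if k = i then ?d i j else 0)"
      by (intro sum.cong) auto
    then show ?thesis
      using ij by (auto simp: assms dot_def[of n "?d i" "?d j"])
  qed
  finally show "(\<Sum>k<n. A k i * A k j) = (if i = j then 1 else 0)" .
qed

lemma orthogonal_mat_mult:
  "orthogonal_mat n A \<Longrightarrow> orthogonal_mat n B \<Longrightarrow> orthogonal_mat n (mat_mult n A B)"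
  by (rule orthogonal_matI_dot) (simp add: mat_apply_mat_mult orthogonal_mat_dot)

lemma orthogonal_mat_id: "orthogonal_mat n (\<lambda>i j. if i = j then 1 else 0)"
  by (rule orthogonal_matI_dot)
    (auto simp: mat_apply_def if_distrib[of "\<lambda>c. c * _"] intro!: dot_cong cong: if_cong)

definition reflection :: "nat \<Rightarrow> (nat \<Rightarrow> real) \<Rightarrow> nat \<Rightarrow> nat \<Rightarrow> real"
  where "reflection n v = (\<lambda>i j. (if i = j then 1 else 0) - 2 / dot n v v * v i * v j)"

lemma mat_apply_reflection:
  "mat_apply n (reflection n v) x = (\<lambda>i. if i < n then x i - 2 * dot n v x / dot n v v * v i else 0)"
proof
  fix i
  have "(\<Sum>j<n. ((if i = j then 1 else 0) - 2 / dot n v v * v i * v j) * x j) =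
      (\<Sum>j<n. (if i = j then x j else 0)) - (\<Sum>j<n. 2 / dot n v v * v i * (v j * x j))"
    unfolding sum_subtractf[symmetric] by (intro sum.cong) (auto simp: algebra_simps)
  then show "mat_apply n (reflection n v) x i
      = (if i < n then x i - 2 * dot n v x / dot n v v * v i else 0)"
    by (simp add: mat_apply_def reflection_def dot_def[of n v x] sum_distrib_left sum_divide_distrib mult_ac)
qed

lemma orthogonal_mat_reflection: "orthogonal_mat n (reflection n v)"
proof (rule orthogonal_matI_dot)
  fix x y
  define c where "c x = 2 * dot n v x / dot n v v" for x
  have c: "c x * dot n v v = 2 * dot n v x" for x
    by (cases "dot n v v = 0") (use dot_le_enorm[of n v x] dot_le_enorm[of n "\<lambda>i. - 1 * v i" x]
      in \<open>auto simp only: c_def enorm_eq_sqrt_dot dot_scale_left dot_scale_right, simp_all\<close>)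
  have "dot n (mat_apply n (reflection n v) x) (mat_apply n (reflection n v) y)
      = dot n (\<lambda>i. x i - c x * v i) (\<lambda>i. y i - c y * v i)"
    by (rule dot_cong) (auto simp: mat_apply_reflection c_def)
  also have "\<dots> = dot n x y - c y * dot n v x - c x * dot n v y + c x * c y * dot n v v"
    by (simp add: dot_diff_left dot_diff_right dot_scale_left dot_scale_right
        dot_commute[of n x v] algebra_simps)
  also have "\<dots> = dot n x y"
    using c[of y] by (simp add: c_def)
  finally show "dot n (mat_apply n (reflection n v) x) (mat_apply n (reflection n v) y) = dot n x y" .
qed

text \<open>The reflection in the hyperplane bisecting \<open>x\<close> and \<open>z\<close> exchanges these two vectors.\<close>

lemma reflection_swap:
  assumes x: "x \<in> Rn n" and z: "z \<in> Rn n" and eq: "dot n x x = dot n z z"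
  shows "mat_apply n (reflection n (\<lambda>i. x i - z i)) x = z"
proof (cases "x = z")
  case True
  then show ?thesis
    using z by (intro Rn_eqI[of _ n] mat_apply_in_Rn) (auto simp: mat_apply_reflection)
next
  case False
  let ?v = "\<lambda>i. x i - z i"
  have "?v \<in> Rn n" "?v \<noteq> (\<lambda>_. 0)"
    using x z False by (auto simp: in_Rn fun_eq_iff)
  then have pos: "dot n ?v ?v \<noteq> 0"
    using enorm_eq_0[of ?v n] by (auto simp: enorm_eq_sqrt_dot)
  have "2 * dot n ?v x = dot n ?v ?v"
    using eq by (simp add: dot_diff_left dot_diff_right dot_commute[of n z x])
  then have "2 * dot n ?v x / dot n ?v ?v = 1"
    using pos by simp
  then show ?thesis
    using z by (intro Rn_eqI[of _ n] mat_apply_in_Rn) (auto simp: mat_apply_reflection)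
qed

section \<open>Lebesgue measure in arbitrary dimension\<close>

interpretation lebesgue_product: product_sigma_finite "\<lambda>_::nat. lborel :: real measure"
  by standard

lemma sets_lebesgue_Rn [simp, measurable_cong]: "sets (lebesgue_Rn n) = sets borel"
  by (simp add: lebesgue_Rn_def)

lemma space_lebesgue_Rn [simp]: "space (lebesgue_Rn n) = UNIV"
  by (simp add: lebesgue_Rn_def)

lemma measurable_add_pointwise:
  fixes f g :: "'a \<Rightarrow> nat \<Rightarrow> real"
  assumes "f \<in> borel_measurable M" "g \<in> borel_measurable M"
  shows "(\<lambda>w i. f w i + g w i) \<in> borel_measurable M"
  by (rule measurable_coordinatewise_then_product, rule borel_measurable_add)
    (fact assms | rule measurable_product_then_coordinatewise, fact assms)+

lemma measurable_diff_pointwise: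
  fixes f g :: "'a \<Rightarrow> nat \<Rightarrow> real"
  assumes "f \<in> borel_measurable M" "g \<in> borel_measurable M"
  shows "(\<lambda>w i. f w i - g w i) \<in> borel_measurable M"
  by (rule measurable_coordinatewise_then_product, rule borel_measurable_diff)
    (fact assms | rule measurable_product_then_coordinatewise, fact assms)+

lemma measurable_mat_apply [measurable]: "mat_apply n A \<in> borel_measurable borel"
proof (rule measurable_coordinatewise_then_product)
  fix i show "(\<lambda>x. mat_apply n A x i) \<in> borel_measurable borel"
    by (cases "i < n") (auto simp: mat_apply_def)
qed

lemma measurable_dot:
  assumes "f \<in> borel_measurable M" "g \<in> borel_measurable M"
  shows "(\<lambda>w. dot n (f w) (g w)) \<in> borel_measurable M"
  unfolding dot_def by (rule borel_measurable_sum, rule borel_measurable_times)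
    (rule measurable_product_then_coordinatewise, rule assms)+

lemma measurable_enorm [measurable]: "enorm n \<in> borel_measurable borel"
  unfolding enorm_eq_sqrt_dot[abs_def] by (intro measurable_compose[OF measurable_dot borel_measurable_sqrt]) auto

lemma sets_Rn [measurable]: "Rn n \<in> sets borel"
proof -
  have "Rn n = {x. \<forall>i\<in>{n..}. x i = 0}"
    by (auto simp: in_Rn)
  also have "\<dots> \<in> sets borel"
    by measurable
  finally show ?thesis .
qed

lemma nn_integral_lebesgue_Rn:
  assumes [measurable]: "f \<in> borel_measurable borel"
  shows "(\<integral>\<^sup>+x. f x \<partial>lebesgue_Rn n) = (\<integral>\<^sup>+x. f (zero_extend n x) \<partial>(\<Pi>\<^sub>M i\<in>{..<n}. lborel))"
  unfolding lebesgue_Rn_def by (rule nn_integral_distr[OF measurable_zero_extend]) simp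

lemma AE_lebesgue_Rn: "AE x in lebesgue_Rn n. x \<in> Rn n"
  unfolding lebesgue_Rn_def
  by (subst AE_distr_iff[OF measurable_zero_extend]) (auto simp: in_Rn zero_extend_def)

lemma nn_integral_lebesgue_Rn_cong:
  assumes "\<And>x. x \<in> Rn n \<Longrightarrow> f x = g x"
  shows "(\<integral>\<^sup>+x. f x \<partial>lebesgue_Rn n) = (\<integral>\<^sup>+x. g x \<partial>lebesgue_Rn n)"
  by (rule nn_integral_cong_AE) (use AE_lebesgue_Rn[of n] assms in \<open>auto elim: AE_mp\<close>)

lemma emeasure_lebesgue_Rn_box:
  assumes "\<And>i. i < n \<Longrightarrow> a i \<le> b i"
  shows "emeasure (lebesgue_Rn n) {x. \<forall>i<n. a i \<le> x i \<and> x i \<le> b i} = ennreal (\<Prod>i<n. b i - a i)"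
proof -
  have [measurable]: "{x. \<forall>i<n. a i \<le> x i \<and> x i \<le> b i} \<in> sets borel"
    by measurable
  have "zero_extend n -` {x. \<forall>i<n. a i \<le> x i \<and> x i \<le> b i} \<inter> space (\<Pi>\<^sub>M i\<in>{..<n}. lborel)
      = (\<Pi>\<^sub>E i\<in>{..<n}. {a i..b i})"
    by (intro set_eqI) (simp add: zero_extend_def space_PiM PiE_iff Ball_def conj_commute)
  then have "emeasure (lebesgue_Rn n) {x. \<forall>i<n. a i \<le> x i \<and> x i \<le> b i}
      = (\<Prod>i<n. emeasure lborel {a i..b i})"
    unfolding lebesgue_Rn_def
    by (subst emeasure_distr[OF measurable_zero_extend])
      (simp_all add: lebesgue_product.emeasure_PiM)
  also have "\<dots> = (\<Prod>i<n. ennreal (b i - a i))"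
    using assms by (intro prod.cong) auto
  also have "\<dots> = ennreal (\<Prod>i<n. b i - a i)"
    using assms by (intro prod_ennreal) auto
  finally show ?thesis .
qed

lemma sigma_finite_lebesgue_Rn: "sigma_finite_measure (lebesgue_Rn n)"
proof
  let ?B = "\<lambda>k::nat. {x. \<forall>i<n. - real k \<le> x i \<and> x i \<le> real k}"
  have [measurable]: "?B k \<in> sets borel" for k
    by measurable
  have "\<exists>k. x \<in> ?B k" for x
  proof -
    obtain k :: nat where "(\<Sum>i<n. \<bar>x i\<bar>) \<le> real k"
      using real_arch_simple by blast
    then have "\<bar>x i\<bar> \<le> real k" if "i < n" for i
      using member_le_sum[of i "{..<n}" "\<lambda>i. \<bar>x i\<bar>"] that by auto
    then show ?thesis
      by (intro exI[of _ k] CollectI allI impI) (simp add: abs_le_iff minus_le_iff)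
  qed
  then have "\<Union> (range ?B) = UNIV"
    by blast
  moreover have "emeasure (lebesgue_Rn n) (?B k) \<noteq> \<infinity>" for k
    by (subst emeasure_lebesgue_Rn_box) auto
  ultimately show "\<exists>A. countable A \<and> A \<subseteq> sets (lebesgue_Rn n) \<and> \<Union> A = space (lebesgue_Rn n)
      \<and> (\<forall>a\<in>A. emeasure (lebesgue_Rn n) a \<noteq> \<infinity>)"
    by (intro exI[of _ "range ?B"]) (simp add: image_subset_iff)
qed

text \<open>The change of variables acts on each coordinate separately, so it can be checked on
  boxes, where it is the one-dimensional formula in every factor.\<close>

lemma nn_integral_lebesgue_Rn_affine:
  assumes [measurable]: "f \<in> borel_measurable borel" and c: "\<And>i. i < n \<Longrightarrow> c i \<noteq> 0"
  shows "(\<integral>\<^sup>+x. f x \<partial>lebesgue_Rn n)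
    = ennreal (\<Prod>i<n. \<bar>c i\<bar>) * (\<integral>\<^sup>+x. f (\<lambda>i. if i < n then t i + c i * x i else 0) \<partial>lebesgue_Rn n)"
proof -
  let ?P = "\<Pi>\<^sub>M i\<in>{..<n}. (lborel :: real measure)"
  define T where "T x = (\<lambda>i\<in>{..<n}. t i + c i * x i)" for x :: "nat \<Rightarrow> real"
  have T [measurable]: "T \<in> measurable ?P ?P"
    unfolding T_def
  proof (rule measurable_restrict)
    fix i assume "i \<in> {..<n}"
    then have "(\<lambda>x. x i) \<in> borel_measurable ?P"
      using measurable_component_singleton[of i "{..<n}" "\<lambda>_. lborel :: real measure"] by simp
    then show "(\<lambda>x. t i + c i * x i) \<in> measurable ?P lborel"
      by simp
  qed
  have 1: "emeasure lborel A = ennreal \<bar>c i\<bar> * emeasure lborel ((\<lambda>x. t i + c i * x) -` A)"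
    if "i < n" and [measurable]: "A \<in> sets borel" for i A
    by (subst lborel_real_affine[OF c[OF that(1)], of "t i"])
      (simp add: emeasure_density_const emeasure_distr)
  have eq: "density (distr ?P ?P T) (\<lambda>_. ennreal (\<Prod>i<n. \<bar>c i\<bar>)) = ?P"
  proof (rule lebesgue_product.PiM_eqI)
    fix A assume A: "\<And>i. i \<in> {..<n} \<Longrightarrow> A i \<in> sets (lborel :: real measure)"
    then have [measurable]: "Pi\<^sub>E {..<n} A \<in> sets ?P"
      by (intro sets_PiM_I_finite) auto
    have A': "(\<lambda>x. t i + c i * x) -` A i \<in> sets borel" if "i < n" for i
    proof -
      have [measurable]: "A i \<in> sets borel"
        using A[of i] that by simp
      show ?thesis
        by (rule measurable_sets_borel[of _ borel]) measurable
    qed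
    have "T -` Pi\<^sub>E {..<n} A \<inter> space ?P = (\<Pi>\<^sub>E i\<in>{..<n}. (\<lambda>x. t i + c i * x) -` A i)"
      by (intro set_eqI) (simp add: T_def space_PiM PiE_iff Ball_def conj_commute)
    then have "emeasure (density (distr ?P ?P T) (\<lambda>_. ennreal (\<Prod>i<n. \<bar>c i\<bar>))) (Pi\<^sub>E {..<n} A)
        = ennreal (\<Prod>i<n. \<bar>c i\<bar>) * (\<Prod>i<n. emeasure lborel ((\<lambda>x. t i + c i * x) -` A i))"
      using A' by (simp add: emeasure_density_const emeasure_distr,
          subst lebesgue_product.emeasure_PiM) auto
    also have "\<dots> = (\<Prod>i<n. ennreal \<bar>c i\<bar> * emeasure lborel ((\<lambda>x. t i + c i * x) -` A i))"
      by (simp add: prod.distrib prod_ennreal)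
    also have "\<dots> = (\<Prod>i<n. emeasure lborel (A i))"
      using A 1 by (intro prod.cong) auto
    finally show "emeasure (density (distr ?P ?P T) (\<lambda>_. ennreal (\<Prod>i<n. \<bar>c i\<bar>))) (Pi\<^sub>E {..<n} A)
        = (\<Prod>i<n. emeasure lborel (A i))" .
  qed simp_all
  have [measurable]: "(\<lambda>x. f (zero_extend n x)) \<in> borel_measurable ?P"
    using measurable_zero_extend by measurable
  have [measurable]: "(\<lambda>x. f (\<lambda>i. if i < n then t i + c i * x i else 0)) \<in> borel_measurable borel"
  proof (rule measurable_compose[OF _ assms(1)], rule measurable_coordinatewise_then_product)
    show "(\<lambda>x. if i < n then t i + c i * x i else 0) \<in> borel_measurable borel" for i
      by (cases "i < n") auto
  qed
  have "(\<integral>\<^sup>+x. f x \<partial>lebesgue_Rn n)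
      = (\<integral>\<^sup>+x. f (zero_extend n x) \<partial>density (distr ?P ?P T) (\<lambda>_. ennreal (\<Prod>i<n. \<bar>c i\<bar>)))"
    by (simp add: nn_integral_lebesgue_Rn eq)
  also have "\<dots> = ennreal (\<Prod>i<n. \<bar>c i\<bar>) * (\<integral>\<^sup>+x. f (zero_extend n (T x)) \<partial>?P)"
    by (simp add: nn_integral_density nn_integral_cmult nn_integral_distr)
  also have "(\<integral>\<^sup>+x. f (zero_extend n (T x)) \<partial>?P)
      = (\<integral>\<^sup>+x. f (\<lambda>i. if i < n then t i + c i * x i else 0) \<partial>lebesgue_Rn n)"
    unfolding T_def by (subst nn_integral_lebesgue_Rn, measurable)
      (auto intro!: nn_integral_cong arg_cong[of _ _ f] simp: zero_extend_def fun_eq_iff)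
  finally show ?thesis .
qed

lemma nn_integral_lebesgue_Rn_translate:
  assumes [measurable]: "f \<in> borel_measurable borel" and a: "a \<in> Rn n"
  shows "(\<integral>\<^sup>+x. f (\<lambda>i. x i + a i) \<partial>lebesgue_Rn n) = (\<integral>\<^sup>+x. f x \<partial>lebesgue_Rn n)"
proof -
  have "(\<integral>\<^sup>+x. f x \<partial>lebesgue_Rn n)
      = (\<integral>\<^sup>+x. f (\<lambda>i. if i < n then a i + 1 * x i else 0) \<partial>lebesgue_Rn n)"
    by (subst nn_integral_lebesgue_Rn_affine[of f n "\<lambda>_. 1" a]) auto
  also have "\<dots> = (\<integral>\<^sup>+x. f (\<lambda>i. x i + a i) \<partial>lebesgue_Rn n)"
    using a by (intro nn_integral_lebesgue_Rn_cong arg_cong[of _ _ f]) (auto simp: in_Rn fun_eq_iff)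
  finally show ?thesis by simp
qed

lemma unit_ball_measurable [measurable]: "unit_ball n \<in> sets borel"
  unfolding unit_ball_def by measurable

lemma emeasure_unit_ball:
  "emeasure (lebesgue_Rn n) {x. enorm n x \<le> 1} \<noteq> 0"
  "emeasure (lebesgue_Rn n) {x. enorm n x \<le> 1} \<noteq> \<infinity>"
proof -
  define r where "r = 1 / (real n + 1)"
  have r: "0 < r"
    by (simp add: r_def)
  have [measurable]: "{x. enorm n x \<le> 1} \<in> sets borel"
    by measurable
  have "0 < (\<Prod>i<n. r - (- r))"
    using r by (intro prod_pos) auto
  then have "0 < ennreal (\<Prod>i<n. r - (- r))"
    by simp
  also have "ennreal (\<Prod>i<n. r - (- r)) = emeasure (lebesgue_Rn n) {x. \<forall>i<n. - r \<le> x i \<and> x i \<le> r}"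
    using r by (subst emeasure_lebesgue_Rn_box) auto
  also have "\<dots> \<le> emeasure (lebesgue_Rn n) {x. enorm n x \<le> 1}"
  proof (rule emeasure_mono)
    show "{x. \<forall>i<n. - r \<le> x i \<and> x i \<le> r} \<subseteq> {x. enorm n x \<le> 1}"
    proof safe
      fix x assume x: "\<forall>i<n. - r \<le> x i \<and> x i \<le> r"
      have "enorm n x \<le> (\<Sum>i<n. \<bar>x i\<bar>)"
        unfolding enorm_def by (rule L2_set_le_sum_abs)
      also have "\<dots> \<le> (\<Sum>i<n. r)"
        using x by (intro sum_mono) (auto simp: abs_le_iff)
      also have "\<dots> \<le> 1"
        by (simp add: r_def)
      finally show "enorm n x \<le> 1" .
    qed
  qed simp
  finally show "emeasure (lebesgue_Rn n) {x. enorm n x \<le> 1} \<noteq> 0"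
    by auto
  have "emeasure (lebesgue_Rn n) {x. enorm n x \<le> 1}
      \<le> emeasure (lebesgue_Rn n) {x. \<forall>i<n. - 1 \<le> x i \<and> x i \<le> 1}"
  proof (rule emeasure_mono)
    have "- 1 \<le> x i \<and> x i \<le> 1" if "enorm n x \<le> 1" "i < n" for x i
      using abs_coordinate_le_enorm[OF that(2), of x] that(1) by linarith
    then show "{x. enorm n x \<le> 1} \<subseteq> {x. \<forall>i<n. - 1 \<le> x i \<and> x i \<le> 1}"
      by blast
  qed simp
  then show "emeasure (lebesgue_Rn n) {x. enorm n x \<le> 1} \<noteq> \<infinity>"
    by (auto simp: emeasure_lebesgue_Rn_box top_unique)
qed

text \<open>
  Rotation invariance comes from translation invariance, by the argument for the uniqueness of
  Haar measure. With \<open>g\<close> the indicator of the unit ball, integrate \<open>g x * f (x + A y)\<close> over both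
  variables. Translating \<open>y\<close> by \<open>A\<^sup>T x\<close> gives \<open>\<integral>g \<cdot> \<integral>f \<circ> A\<close>. Translating first \<open>x\<close> by \<open>- A y\<close>
  and then \<open>y\<close> gives \<open>\<integral>f \<cdot> \<integral>g\<close>, since \<open>g (- A y) = g y\<close>.
\<close>

lemma nn_integral_lebesgue_Rn_rotate:
  assumes f [measurable]: "f \<in> borel_measurable borel" and A: "orthogonal_mat n A"
  shows "(\<integral>\<^sup>+x. f (mat_apply n A x) \<partial>lebesgue_Rn n) = (\<integral>\<^sup>+x. f x \<partial>lebesgue_Rn n)"
proof -
  let ?L = "lebesgue_Rn n"
  let ?At = "mat_apply n (transpose_mat A)"
  interpret sigma_finite_measure ?L by (rule sigma_finite_lebesgue_Rn)
  interpret pair_sigma_finite ?L ?L ..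
  define g :: "(nat \<Rightarrow> real) \<Rightarrow> ennreal" where "g = indicator {x. enorm n x \<le> 1}"
  have g [measurable]: "g \<in> borel_measurable borel"
    unfolding g_def by measurable
  have [measurable]: "(\<lambda>w. g (\<lambda>i. fst w i - mat_apply n A (snd w) i)) \<in> borel_measurable (?L \<Otimes>\<^sub>M ?L)"
    by (rule measurable_compose[OF measurable_diff_pointwise g]) measurable
  have [measurable]: "(\<lambda>w. g (\<lambda>i. snd w i - mat_apply n A (fst w) i)) \<in> borel_measurable (?L \<Otimes>\<^sub>M ?L)"
    by (rule measurable_compose[OF measurable_diff_pointwise g]) measurable
  have [measurable]: "(\<lambda>w. f (\<lambda>i. fst w i + mat_apply n A (snd w) i)) \<in> borel_measurable (?L \<Otimes>\<^sub>M ?L)"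
    by (rule measurable_compose[OF measurable_add_pointwise f]) measurable
  have [measurable]: "(\<lambda>w. f (\<lambda>i. snd w i + mat_apply n A (fst w) i)) \<in> borel_measurable (?L \<Otimes>\<^sub>M ?L)"
    by (rule measurable_compose[OF measurable_add_pointwise f]) measurable
  have [measurable]: "(\<lambda>x. g (\<lambda>i. x i - mat_apply n A y i)) \<in> borel_measurable borel" for y
    by (rule measurable_compose[OF measurable_diff_pointwise g]) measurable
  have [measurable]: "(\<lambda>y. g (\<lambda>i. x i - mat_apply n A y i)) \<in> borel_measurable borel" for x
    by (rule measurable_compose[OF measurable_diff_pointwise g]) measurable
  have [measurable]: "(\<lambda>y. f (\<lambda>i. x i + mat_apply n A y i)) \<in> borel_measurable borel" for x
    by (rule measurable_compose[OF measurable_add_pointwise f]) measurable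
  have G: "(\<integral>\<^sup>+x. g x \<partial>?L) = emeasure ?L {x. enorm n x \<le> 1}"
    by (simp add: g_def)
  have y_first: "(\<integral>\<^sup>+y. f (\<lambda>i. x i + mat_apply n A y i) \<partial>?L) = (\<integral>\<^sup>+y. f (mat_apply n A y) \<partial>?L)"
    if "x \<in> Rn n" for x
  proof -
    have "(\<lambda>i. x i + mat_apply n A y i) = mat_apply n A (\<lambda>i. y i + ?At x i)" for y
      using orthogonal_mat_right_inverse[OF A that] by (simp add: mat_apply_add add.commute)
    then show ?thesis
      using nn_integral_lebesgue_Rn_translate[of "\<lambda>y. f (mat_apply n A y)" "?At x" n] by simp
  qed
  have x_first: "(\<integral>\<^sup>+x. g x * f (\<lambda>i. x i + mat_apply n A y i) \<partial>?L)
      = (\<integral>\<^sup>+x. g (\<lambda>i. x i - mat_apply n A y i) * f x \<partial>?L)" for y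
    using nn_integral_lebesgue_Rn_translate
      [of "\<lambda>x. g (\<lambda>i. x i - mat_apply n A y i) * f x" "mat_apply n A y" n] by simp
  have g_inner: "(\<integral>\<^sup>+y. g (\<lambda>i. x i - mat_apply n A y i) \<partial>?L) = (\<integral>\<^sup>+y. g y \<partial>?L)"
    if "x \<in> Rn n" for x
  proof -
    have "(\<integral>\<^sup>+y. g (\<lambda>i. x i - mat_apply n A y i) \<partial>?L)
        = (\<integral>\<^sup>+y. g (\<lambda>i. x i - mat_apply n A (\<lambda>i. y i + ?At x i) i) \<partial>?L)"
      using nn_integral_lebesgue_Rn_translate
        [of "\<lambda>y. g (\<lambda>i. x i - mat_apply n A y i)" "?At x" n] by simp
    also have "\<dots> = (\<integral>\<^sup>+y. g y \<partial>?L)"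
    proof (rule nn_integral_cong)
      fix y
      have "enorm n (\<lambda>i. x i - mat_apply n A (\<lambda>i. y i + ?At x i) i)
          = enorm n (\<lambda>i. (-1) * mat_apply n A y i)"
        using orthogonal_mat_right_inverse[OF A that] by (simp add: mat_apply_add)
      also have "\<dots> = enorm n y"
        by (subst enorm_scale) (simp add: orthogonal_mat_enorm[OF A])
      finally show "g (\<lambda>i. x i - mat_apply n A (\<lambda>i. y i + ?At x i) i) = g y"
        by (simp add: g_def indicator_def)
    qed
    finally show ?thesis .
  qed
  have "(\<integral>\<^sup>+x. g x \<partial>?L) * (\<integral>\<^sup>+y. f (mat_apply n A y) \<partial>?L)
      = (\<integral>\<^sup>+x. g x * (\<integral>\<^sup>+y. f (mat_apply n A y) \<partial>?L) \<partial>?L)"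
    by (simp add: nn_integral_multc)
  also have "\<dots> = (\<integral>\<^sup>+x. (\<integral>\<^sup>+y. g x * f (\<lambda>i. x i + mat_apply n A y i) \<partial>?L) \<partial>?L)"
    by (rule nn_integral_lebesgue_Rn_cong) (simp add: nn_integral_cmult y_first)
  also have "\<dots> = (\<integral>\<^sup>+y. (\<integral>\<^sup>+x. g x * f (\<lambda>i. x i + mat_apply n A y i) \<partial>?L) \<partial>?L)"
    by (rule Fubini'[symmetric]) (simp add: split_beta')
  also have "\<dots> = (\<integral>\<^sup>+y. (\<integral>\<^sup>+x. g (\<lambda>i. x i - mat_apply n A y i) * f x \<partial>?L) \<partial>?L)"
    by (simp add: x_first)
  also have "\<dots> = (\<integral>\<^sup>+x. (\<integral>\<^sup>+y. g (\<lambda>i. x i - mat_apply n A y i) * f x \<partial>?L) \<partial>?L)"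
    by (rule Fubini') (simp add: split_beta')
  also have "\<dots> = (\<integral>\<^sup>+x. (\<integral>\<^sup>+y. g y \<partial>?L) * f x \<partial>?L)"
    by (rule nn_integral_lebesgue_Rn_cong) (simp add: nn_integral_multc g_inner)
  also have "\<dots> = (\<integral>\<^sup>+x. g x \<partial>?L) * (\<integral>\<^sup>+x. f x \<partial>?L)"
    by (simp add: nn_integral_cmult)
  finally show ?thesis
    using emeasure_unit_ball[of n] by (simp add: G ennreal_mult_cancel_left)
qed

section \<open>Convex bodies containing the unit ball, and their gauges\<close>

text \<open>The convex bodies in John's position have these properties, and so do their parallel
  bodies, which need not be in John's position.\<close>

definition ball_body :: "nat \<Rightarrow> (nat \<Rightarrow> real) set \<Rightarrow> bool"
  where "ball_body n K \<longleftrightarrow> compact K \<and> K \<subseteq> Rn n \<and> unit_ball n \<subseteq> K \<and>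
    (\<forall>x\<in>K. \<forall>y\<in>K. \<forall>u\<ge>0. \<forall>v\<ge>0. u + v = 1 \<longrightarrow> (\<lambda>i. u * x i + v * y i) \<in> K)"

lemma ball_bodyD:
  assumes "ball_body n K"
  shows "compact K" "K \<subseteq> Rn n" "unit_ball n \<subseteq> K"
    "\<And>x y u v. x \<in> K \<Longrightarrow> y \<in> K \<Longrightarrow> 0 \<le> u \<Longrightarrow> 0 \<le> v \<Longrightarrow> u + v = 1
      \<Longrightarrow> (\<lambda>i. u * x i + v * y i) \<in> K"
  using assms by (auto simp: ball_body_def)

lemma ball_bodyI_convex_body:
  assumes "convex_body n K" "unit_ball n \<subseteq> K"
  shows "ball_body n K"
proof -
  have "compactin (powertop_real UNIV) K" "K \<subseteq> Rn n"
    using assms(1)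
    by (auto simp: convex_body_def Euclidean_space_def compactin_subtopology topspace_Euclidean_space)
  then show ?thesis
    using assms by (auto simp: ball_body_def convex_body_def euclidean_product_topology)
qed

lemma continuous_on_coordinate [continuous_intros]:
  "continuous_on S (\<lambda>x::nat \<Rightarrow> real. x i)"
  by (rule continuous_on_subset[OF continuous_on_product_coordinates]) simp

lemma continuous_on_dot:
  assumes "continuous_on S f" "continuous_on S g"
  shows "continuous_on S (\<lambda>x. dot n (f x) (g x))"
  unfolding dot_def
  by (rule continuous_on_sum, rule continuous_on_mult; rule continuous_on_product_then_coordinatewise, rule assms)

lemma continuous_on_enorm: "continuous_on S f \<Longrightarrow> continuous_on S (\<lambda>x. enorm n (f x))"
  unfolding enorm_eq_sqrt_dot by (intro continuous_on_real_sqrt continuous_on_dot)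

lemma compact_sets_borel: "compact (K :: (nat \<Rightarrow> real) set) \<Longrightarrow> K \<in> sets borel"
  by (intro borel_closed compact_imp_closed)

lemma ball_body_measurable: "ball_body n K \<Longrightarrow> K \<in> sets borel"
  by (rule compact_sets_borel) (rule ball_bodyD)

lemma closed_unit_ball: "closed (unit_ball n)"
proof -
  have "unit_ball n = (\<Inter>i\<in>{n..}. {x. x i = 0}) \<inter> {x. enorm n x \<le> 1}"
    by (auto simp: unit_ball_def in_Rn)
  then show ?thesis
    by (simp only:) (intro closed_INT ballI closed_Int closed_Collect_eq closed_Collect_le
        continuous_on_enorm continuous_on_const continuous_on_id continuous_on_coordinate)
qed

lemma compact_unit_ball: "compact (unit_ball n)"
proof -
  let ?C = "\<lambda>i. if i < n then {-1..1} else {0::real}"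
  have "compactin (powertop_real UNIV) (Pi\<^sub>E UNIV ?C)"
    by (subst compactin_PiE) auto
  then have "compact (Pi\<^sub>E UNIV ?C)"
    by (simp add: euclidean_product_topology)
  moreover have "unit_ball n \<subseteq> Pi\<^sub>E UNIV ?C"
  proof
    fix x assume x: "x \<in> unit_ball n"
    then have "x i \<in> ?C i" for i
      using abs_coordinate_le_enorm[of i n x] by (auto simp: unit_ball_def in_Rn abs_le_iff)
    then show "x \<in> Pi\<^sub>E UNIV ?C"
      by (simp add: PiE_iff)
  qed
  ultimately show ?thesis
    using closed_unit_ball by (metis compact_Int_closed inf.absorb_iff2)
qed

lemma zero_in_unit_ball: "(\<lambda>_. 0) \<in> unit_ball n"
  by (simp add: unit_ball_def in_Rn enorm_eq_sqrt_dot dot_def)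

lemma ball_body_zero: "ball_body n K \<Longrightarrow> (\<lambda>_. 0) \<in> K"
  using ball_bodyD(3) zero_in_unit_ball by blast

lemma ball_body_shrink:
  assumes "ball_body n K" "x \<in> K" "0 \<le> c" "c \<le> 1"
  shows "(\<lambda>i. c * x i) \<in> K"
  using ball_bodyD(4)[OF assms(1,2) ball_body_zero[OF assms(1)], of c "1 - c"] assms by simp

lemma unit_ball_convex:
  assumes "x \<in> unit_ball n" "y \<in> unit_ball n" "0 \<le> u" "0 \<le> v" "u + v = 1"
  shows "(\<lambda>i. u * x i + v * y i) \<in> unit_ball n"
proof -
  have "enorm n (\<lambda>i. u * x i + v * y i) \<le> u * enorm n x + v * enorm n y"
    using enorm_triangle[of n "\<lambda>i. u * x i" "\<lambda>i. v * y i"] assms by (simp add: enorm_scale)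
  also have "\<dots> \<le> u * 1 + v * 1"
    using assms by (intro add_mono mult_left_mono) (auto simp: unit_ball_def)
  finally show ?thesis
    using assms by (auto simp: unit_ball_def in_Rn)
qed

definition scaled :: "real \<Rightarrow> (nat \<Rightarrow> real) set \<Rightarrow> (nat \<Rightarrow> real) set"
  where "scaled s K = (\<lambda>y i. s * y i) ` K"

lemma scaledI: "y \<in> K \<Longrightarrow> (\<lambda>i. s * y i) \<in> scaled s K"
  by (auto simp: scaled_def)

lemma scaled_mono:
  assumes K: "ball_body n K" and st: "0 \<le> s" "s \<le> t"
  shows "scaled s K \<subseteq> scaled t K"
proof
  fix x assume "x \<in> scaled s K"
  then obtain y where y: "y \<in> K" "x = (\<lambda>i. s * y i)"
    by (auto simp: scaled_def)
  show "x \<in> scaled t K"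
  proof (cases "t = 0")
    case True
    then show ?thesis
      using st y scaledI[OF y(1), of 0] by simp
  next
    case False
    have "(\<lambda>i. (s / t) * y i) \<in> K"
      using ball_body_shrink[OF K y(1), of "s / t"] st False by simp
    from scaledI[OF this, of t] show ?thesis
      using y False by simp
  qed
qed

lemma scaled_enorm:
  assumes K: "ball_body n K" and x: "x \<in> Rn n"
  shows "x \<in> scaled (enorm n x) K"
proof (cases "enorm n x = 0")
  case True
  then show ?thesis
    using enorm_eq_0[OF x] ball_body_zero[OF K] scaledI[of "\<lambda>_. 0" K 0] by simp
next
  case False
  let ?y = "\<lambda>i. (1 / enorm n x) * x i"
  have "?y \<in> unit_ball n"
    using x False enorm_nonneg[of n x] unfolding unit_ball_def mem_Collect_eq enorm_scale
    by (auto simp: in_Rn)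
  then have "(\<lambda>i. enorm n x * ?y i) \<in> scaled (enorm n x) K"
    using ball_bodyD(3)[OF K] by (intro scaledI) auto
  then show ?thesis
    using False by simp
qed

lemma compact_scaled: "compact K \<Longrightarrow> compact (scaled s K)"
  unfolding scaled_def
  by (intro compact_continuous_image continuous_on_coordinatewise_then_product continuous_intros)

text \<open>The gauge is a minimum because the admissible dilation factors up to a bound form a
  compact set, the projection of the compact set of pairs \<open>(t, y)\<close> with \<open>y \<in> K\<close> and \<open>t y = x\<close>.\<close>

lemma minkowski_functional_attained:
  assumes K: "ball_body n K" and x: "x \<in> Rn n"
  shows "0 \<le> minkowski_functional K x" "x \<in> scaled (minkowski_functional K x) K"
    "\<And>s. 0 \<le> s \<Longrightarrow> x \<in> scaled s K \<Longrightarrow> minkowski_functional K x \<le> s"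
proof -
  define S where "S = {t. 0 \<le> t \<and> x \<in> scaled t K}"
  let ?T = "enorm n x"
  let ?D = "({0..?T} \<times> K) \<inter> (\<Inter>i. {p. fst p * snd p i = x i})"
  have "closed (\<Inter>i. {p :: real \<times> (nat \<Rightarrow> real). fst p * snd p i = x i})"
    by (intro closed_INT ballI closed_Collect_eq continuous_on_mult continuous_on_const
        continuous_on_fst continuous_on_id
        continuous_on_product_then_coordinatewise[OF continuous_on_snd[OF continuous_on_id]])
  then have "compact ?D"
    using ball_bodyD(1)[OF K] by (intro compact_Int_closed compact_Times) auto
  then have "compact (fst ` ?D)"
    by (intro compact_continuous_image continuous_intros)
  moreover have D: "fst ` ?D = {0..?T} \<inter> S"
  proof (rule set_eqI)
    fix t
    have "t \<in> fst ` ?D \<longleftrightarrow> t \<in> {0..?T} \<and> (\<exists>y\<in>K. \<forall>i. t * y i = x i)"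
      unfolding fst_eq_Domain Domain_iff
      by (simp only: Int_iff mem_Times_iff INT_iff mem_Collect_eq fst_conv snd_conv) blast
    also have "\<dots> \<longleftrightarrow> t \<in> {0..?T} \<inter> S"
    proof -
      have "(\<forall>i. t * y i = x i) \<longleftrightarrow> x = (\<lambda>i. t * y i)" for y
        by (simp add: fun_eq_iff eq_commute)
      then show ?thesis
        unfolding S_def scaled_def image_iff by (simp, blast)
    qed
    finally show "t \<in> fst ` ?D \<longleftrightarrow> t \<in> {0..?T} \<inter> S" .
  qed
  moreover have T: "?T \<in> {0..?T} \<inter> S"
    using scaled_enorm[OF K x] by (simp add: S_def enorm_nonneg)
  ultimately obtain m where m: "m \<in> {0..?T} \<inter> S" "\<And>t. t \<in> {0..?T} \<inter> S \<Longrightarrow> m \<le> t"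
    using compact_attains_inf[of "fst ` ?D"] by force
  have least: "m \<le> t" if "t \<in> S" for t
    using m that by (cases "t \<le> ?T") (auto simp: S_def)
  have "minkowski_functional K x = m"
    unfolding minkowski_functional_def
    using m(1) least by (intro Least_equality) (auto simp: S_def scaled_def)
  then show "0 \<le> minkowski_functional K x" "x \<in> scaled (minkowski_functional K x) K"
    "\<And>s. 0 \<le> s \<Longrightarrow> x \<in> scaled s K \<Longrightarrow> minkowski_functional K x \<le> s"
    using m(1) least by (auto simp: S_def)
qed

lemma minkowski_functional_le_iff:
  assumes K: "ball_body n K" and x: "x \<in> Rn n" and s: "0 \<le> s"
  shows "minkowski_functional K x \<le> s \<longleftrightarrow> x \<in> scaled s K"
  using minkowski_functional_attained[OF K x] scaled_mono[OF K] s by blast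

lemma minkowski_functional_le_1_iff:
  assumes K: "ball_body n K" and x: "x \<in> Rn n"
  shows "minkowski_functional K x \<le> 1 \<longleftrightarrow> x \<in> K"
  using minkowski_functional_le_iff[OF K x, of 1] by (simp add: scaled_def)

lemma minkowski_functional_le_enorm:
  assumes K: "ball_body n K" and x: "x \<in> Rn n"
  shows "minkowski_functional K x \<le> enorm n x"
  using minkowski_functional_le_iff[OF K x] scaled_enorm[OF K x] enorm_nonneg by blast

lemma minkowski_functional_ge_dot:
  assumes K: "ball_body n K" and x: "x \<in> Rn n" and y: "\<And>z. z \<in> K \<Longrightarrow> dot n y z \<le> 1"
  shows "dot n y x \<le> minkowski_functional K x"
proof -
  obtain z where z: "z \<in> K" "x = (\<lambda>i. minkowski_functional K x * z i)"
    using minkowski_functional_attained(2)[OF K x] by (auto simp: scaled_def)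
  have "dot n y x = minkowski_functional K x * dot n y z"
    by (subst z(2)) (simp add: dot_scale_right)
  also have "\<dots> \<le> minkowski_functional K x * 1"
    using minkowski_functional_attained(1)[OF K x] y[OF z(1)] by (intro mult_left_mono)
  finally show ?thesis by simp
qed

text \<open>Outside the \<open>n\<close>-dimensional space the gauge is the least element of an empty set, the same
  junk value at every point, so the gauge is Borel on all sequences.\<close>

lemma measurable_minkowski_functional:
  assumes K: "ball_body n K"
  shows "minkowski_functional K \<in> borel_measurable borel"
proof -
  define c where "c = (LEAST t::real. False)"
  have c: "minkowski_functional K x = c" if "x \<notin> Rn n" for x
  proof -
    have "\<not> (0 \<le> t \<and> x \<in> (\<lambda>y i. t * y i) ` K)" for t
      using that ball_bodyD(2)[OF K] by (force simp: in_Rn)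
    then have "(\<lambda>t. 0 \<le> t \<and> x \<in> (\<lambda>y i. t * y i) ` K) = (\<lambda>t. False)"
      by blast
    then show ?thesis
      by (simp only: minkowski_functional_def c_def)
  qed
  have sub: "scaled s K \<subseteq> Rn n" for s
    using ball_bodyD(2)[OF K] by (force simp: in_Rn scaled_def)
  have "{x. minkowski_functional K x \<le> s} \<in> sets borel" for s
  proof -
    have "{x. minkowski_functional K x \<le> s}
        = (if 0 \<le> s then scaled s K else {}) \<union> (if c \<le> s then - Rn n else {})"
    proof (rule set_eqI)
      fix x
      show "x \<in> {x. minkowski_functional K x \<le> s}
          \<longleftrightarrow> x \<in> (if 0 \<le> s then scaled s K else {}) \<union> (if c \<le> s then - Rn n else {})"
      proof (cases "x \<in> Rn n")
        case True
        then show ?thesis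
          using minkowski_functional_le_iff[OF K True, of s]
            minkowski_functional_attained(1)[OF K True] by auto
      next
        case False
        then show ?thesis
          using c[OF False] sub by auto
      qed
    qed
    moreover have "scaled s K \<in> sets borel"
      by (intro compact_sets_borel compact_scaled ball_bodyD(1)[OF K])
    ultimately show ?thesis
      using sets_Rn[of n] by auto
  qed
  then show ?thesis
    by (simp add: borel_measurable_iff_le)
qed

lemma emeasure_compact_finite:
  assumes "compact K"
  shows "emeasure (lebesgue_Rn n) K < \<infinity>"
proof -
  have "bounded ((enorm n) ` K)"
    by (intro compact_imp_bounded compact_continuous_image assms continuous_on_enorm continuous_on_id)
  then obtain R where R: "\<And>x. x \<in> K \<Longrightarrow> enorm n x \<le> R"
    using bounded_iff[of "enorm n ` K"] by (force simp: abs_le_iff)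
  have "emeasure (lebesgue_Rn n) K \<le> emeasure (lebesgue_Rn n) {x. \<forall>i<n. - \<bar>R\<bar> \<le> x i \<and> x i \<le> \<bar>R\<bar>}"
  proof (rule emeasure_mono)
    show "K \<subseteq> {x. \<forall>i<n. - \<bar>R\<bar> \<le> x i \<and> x i \<le> \<bar>R\<bar>}"
    proof (intro subsetI CollectI allI impI)
      fix x i assume "x \<in> K" "i < n"
      then show "- \<bar>R\<bar> \<le> x i \<and> x i \<le> \<bar>R\<bar>"
        using R[of x] abs_coordinate_le_enorm[of i n x] by linarith
    qed
    have "{x. \<forall>i<n. - \<bar>R\<bar> \<le> x i \<and> x i \<le> \<bar>R\<bar>} \<in> sets borel"
      by measurable
    then show "{x. \<forall>i<n. - \<bar>R\<bar> \<le> x i \<and> x i \<le> \<bar>R\<bar>} \<in> sets (lebesgue_Rn n)"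
      by simp
  qed
  also have "\<dots> < \<infinity>"
    by (subst emeasure_lebesgue_Rn_box) auto
  finally show ?thesis .
qed

lemma emeasure_scaled:
  assumes K: "ball_body n K" and s: "0 < s"
  shows "emeasure (lebesgue_Rn n) (scaled s K) = ennreal (s ^ n) * emeasure (lebesgue_Rn n) K"
proof -
  have [measurable]: "scaled s K \<in> sets borel" "K \<in> sets borel"
    by (intro compact_sets_borel compact_scaled ball_bodyD(1)[OF K])+
  have "emeasure (lebesgue_Rn n) (scaled s K) = (\<integral>\<^sup>+x. indicator (scaled s K) x \<partial>lebesgue_Rn n)"
    by simp
  also have "\<dots> = ennreal (\<Prod>i<n. \<bar>s\<bar>) * (\<integral>\<^sup>+x. indicator (scaled s K)
      (\<lambda>i. if i < n then 0 + s * x i else 0) \<partial>lebesgue_Rn n)"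
    using s by (intro nn_integral_lebesgue_Rn_affine) auto
  also have "(\<integral>\<^sup>+x. indicator (scaled s K) (\<lambda>i. if i < n then 0 + s * x i else 0) \<partial>lebesgue_Rn n)
      = (\<integral>\<^sup>+x. indicator K x \<partial>lebesgue_Rn n)"
  proof (rule nn_integral_lebesgue_Rn_cong)
    fix x assume x: "x \<in> Rn n"
    \<comment> \<open>on \<open>Rn n\<close> the cut-off at index \<open>n\<close> changes nothing\<close>
    have eq: "(\<lambda>i. if i < n then 0 + s * x i else 0) = (\<lambda>i. s * x i)"
      using x by (auto simp: in_Rn)
    have "(\<lambda>i. s * x i) \<in> scaled s K \<longleftrightarrow> x \<in> K"
    proof
      assume "(\<lambda>i. s * x i) \<in> scaled s K"
      then obtain y where y: "y \<in> K" "\<And>i. s * x i = s * y i"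
        by (auto simp: scaled_def fun_eq_iff)
      then have "x = y"
        using s by (simp add: fun_eq_iff)
      then show "x \<in> K"
        using y by simp
    qed (rule scaledI)
    then show "indicator (scaled s K) (\<lambda>i. if i < n then 0 + s * x i else 0) = (indicator K x :: ennreal)"
      unfolding eq by (simp add: indicator_def)
  qed
  finally show ?thesis
    using s by simp
qed

text \<open>Layer-cake integration over the dilates \<open>s K\<close> with \<open>0 \<le> s \<le> 1\<close>: the cone of height 1
  over a body of volume \<open>V\<close> has volume \<open>V / (n + 1)\<close>.\<close>

lemma has_integral_gauge_cone:
  assumes K: "ball_body n K"
  shows "has_bochner_integral (lebesgue_Rn n)
    (\<lambda>x. indicator K x * (1 - minkowski_functional K x)) (vol n K / (real n + 1))"
proof (rule has_bochner_integral_nn_integral)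
  let ?L = "lebesgue_Rn n" and ?g = "minkowski_functional K"
  interpret sigma_finite_measure ?L by (rule sigma_finite_lebesgue_Rn)
  interpret pair_sigma_finite ?L "lborel :: real measure" ..
  note measurable_minkowski_functional[OF K, measurable] ball_body_measurable[OF K, measurable]
  have Kg: "x \<in> K \<longleftrightarrow> ?g x \<le> 1" if "x \<in> Rn n" for x
    using minkowski_functional_le_1_iff[OF K that] by simp
  have g0: "0 \<le> ?g x" if "x \<in> Rn n" for x
    by (rule minkowski_functional_attained(1)[OF K that])
  have fin: "emeasure ?L K = ennreal (vol n K)"
    using emeasure_compact_finite[OF ball_bodyD(1)[OF K], of n]
    by (simp add: vol_def emeasure_eq_ennreal_measure top.not_eq_extremum)
  have "(\<integral>\<^sup>+x. ennreal (indicator K x * (1 - ?g x)) \<partial>?L)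
      = (\<integral>\<^sup>+x. (\<integral>\<^sup>+s. indicator {0..1} s * (if ?g x \<le> s then 1 else 0) \<partial>lborel) \<partial>?L)"
  proof (rule nn_integral_lebesgue_Rn_cong)
    fix x assume x: "x \<in> Rn n"
    have "(\<integral>\<^sup>+s. indicator {0..1} s * (if ?g x \<le> s then 1 else 0) \<partial>lborel)
        = (\<integral>\<^sup>+s. indicator {?g x..1} s \<partial>lborel)"
      using g0[OF x] by (intro nn_integral_cong) (auto simp: indicator_def)
    also have "\<dots> = ennreal (indicator K x * (1 - ?g x))"
      using Kg[OF x] by (cases "?g x \<le> 1") auto
    finally show "ennreal (indicator K x * (1 - ?g x))
      = (\<integral>\<^sup>+s. indicator {0..1} s * (if ?g x \<le> s then 1 else 0) \<partial>lborel)" by simp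
  qed
  also have "\<dots> = (\<integral>\<^sup>+s. (\<integral>\<^sup>+x. indicator {0..1} s * (if ?g x \<le> s then 1 else 0) \<partial>?L) \<partial>lborel)"
    by (rule Fubini'[symmetric]) measurable
  also have "\<dots> = (\<integral>\<^sup>+s. ennreal (s ^ n * vol n K) * indicator {0..1} s \<partial>lborel)"
  proof (rule nn_integral_cong_AE)
    show "AE s in lborel. (\<integral>\<^sup>+x. indicator {0..1} s * (if ?g x \<le> s then 1 else 0) \<partial>?L)
        = ennreal (s ^ n * vol n K) * indicator {0..1} s"
      using AE_lborel_singleton[of 0]
    proof eventually_elim
      case (elim s)
      show ?case
      proof (cases "0 < s \<and> s \<le> 1")
        case True
        have [measurable]: "scaled s K \<in> sets borel"
          by (intro compact_sets_borel compact_scaled ball_bodyD(1)[OF K])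
        have "(\<integral>\<^sup>+x. indicator {0..1} s * (if ?g x \<le> s then 1 else 0) \<partial>?L)
            = (\<integral>\<^sup>+x. indicator (scaled s K) x \<partial>?L)"
          using minkowski_functional_le_iff[OF K] True
          by (intro nn_integral_lebesgue_Rn_cong) (auto simp: indicator_def)
        then show ?thesis
          using True by (simp add: emeasure_scaled[OF K] fin ennreal_mult vol_def)
      qed (use elim in \<open>auto simp: indicator_def\<close>)
    qed
  qed
  also have "\<dots> = ennreal (1 ^ (n + 1) / (real n + 1) * vol n K - 0 ^ (n + 1) / (real n + 1) * vol n K)"
  proof (rule nn_integral_FTC_Icc)
    fix s :: real assume "s \<in> {0..1}"
    then show "0 \<le> s ^ n * vol n K"
      by (simp add: vol_def)
    show "((\<lambda>s. s ^ (n + 1) / (real n + 1) * vol n K) has_real_derivative s ^ n * vol n K) (at s)"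
      using DERIV_cmult_right[OF DERIV_cdivide[OF DERIV_pow[of "Suc n" s UNIV], of "real n + 1"], of "vol n K"]
      by (simp add: add.commute)
  qed simp_all
  finally show "(\<integral>\<^sup>+x. ennreal (indicator K x * (1 - ?g x)) \<partial>?L) = ennreal (vol n K / (real n + 1))"
    by simp
  show "AE x in ?L. 0 \<le> indicator K x * (1 - ?g x)"
    using AE_lebesgue_Rn by eventually_elim (use Kg in \<open>auto simp: indicator_def\<close>)
qed (use measurable_minkowski_functional[OF K] ball_body_measurable[OF K] in
    \<open>auto simp: vol_def\<close>)

section \<open>Surface area of a body containing the unit ball\<close>

lemma continuous_on_pair_coordinates [continuous_intros]:
  "continuous_on S (\<lambda>p::(nat \<Rightarrow> real) \<times> (nat \<Rightarrow> real). fst p i)"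
  "continuous_on S (\<lambda>p::(nat \<Rightarrow> real) \<times> (nat \<Rightarrow> real). snd p i)"
  by (rule continuous_on_product_then_coordinatewise, rule continuous_on_fst continuous_on_snd,
      rule continuous_on_id)+

lemma parallel_body_eq_image:
  "parallel_body n K t = (\<lambda>p i. fst p i + t * snd p i) ` (K \<times> unit_ball n)"
  by (force simp: parallel_body_def image_iff)

lemma parallel_bodyI:
  "x \<in> K \<Longrightarrow> b \<in> unit_ball n \<Longrightarrow> (\<lambda>i. x i + t * b i) \<in> parallel_body n K t"
  by (auto simp: parallel_body_def)

lemma subset_parallel_body: "K \<subseteq> parallel_body n K t"
  using parallel_bodyI[of _ K "\<lambda>_. 0" n t] zero_in_unit_ball by auto

lemma ball_body_parallel_body:
  assumes K: "ball_body n K" and t: "0 \<le> t"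
  shows "ball_body n (parallel_body n K t)"
  unfolding ball_body_def
proof (intro conjI ballI allI impI)
  show "compact (parallel_body n K t)"
    unfolding parallel_body_eq_image
    by (intro compact_continuous_image compact_Times compact_unit_ball ball_bodyD(1)[OF K]
        continuous_on_coordinatewise_then_product continuous_on_add continuous_on_mult
        continuous_on_const continuous_on_pair_coordinates)
  show "parallel_body n K t \<subseteq> Rn n"
    using ball_bodyD(2)[OF K] by (fastforce simp: parallel_body_def unit_ball_def in_Rn)
  show "unit_ball n \<subseteq> parallel_body n K t"
    using subset_parallel_body ball_bodyD(3)[OF K] by blast
  fix x y u v assume xy: "x \<in> parallel_body n K t" "y \<in> parallel_body n K t"
    and uv: "0 \<le> u" "0 \<le> v" "u + v = (1::real)"
  obtain x' b where x: "x' \<in> K" "b \<in> unit_ball n" "x = (\<lambda>i. x' i + t * b i)"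
    using xy by (auto simp: parallel_body_def)
  obtain y' c where y: "y' \<in> K" "c \<in> unit_ball n" "y = (\<lambda>i. y' i + t * c i)"
    using xy by (auto simp: parallel_body_def)
  have "(\<lambda>i. u * x i + v * y i) = (\<lambda>i. (u * x' i + v * y' i) + t * (u * b i + v * c i))"
    by (simp add: x y algebra_simps)
  then show "(\<lambda>i. u * x i + v * y i) \<in> parallel_body n K t"
    using parallel_bodyI[OF ball_bodyD(4)[OF K x(1) y(1) uv] unit_ball_convex[OF x(2) y(2) uv]]
    by simp
qed

lemma parallel_body_subset_scaled:
  assumes K: "ball_body n K" and t: "0 \<le> t"
  shows "parallel_body n K t \<subseteq> scaled (1 + t) K"
proof
  fix x assume "x \<in> parallel_body n K t"
  then obtain y b where y: "y \<in> K" "b \<in> unit_ball n" "x = (\<lambda>i. y i + t * b i)"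
    by (auto simp: parallel_body_def)
  have "b \<in> K"
    using y ball_bodyD(3)[OF K] by blast
  then have "(\<lambda>i. 1 / (1 + t) * y i + t / (1 + t) * b i) \<in> K"
    using t y by (intro ball_bodyD(4)[OF K]) (auto simp: add_divide_distrib[symmetric])
  from scaledI[OF this, of "1 + t"] show "x \<in> scaled (1 + t) K"
    using t y by (simp add: distrib_left)
qed

lemma gauge_parallel_body_le:
  assumes K: "ball_body n K" and t: "0 \<le> t" and x: "x \<in> Rn n"
  shows "minkowski_functional (parallel_body n K t) x \<le> minkowski_functional K x"
proof -
  have "scaled s K \<subseteq> scaled s (parallel_body n K t)" for s
    unfolding scaled_def by (intro image_mono subset_parallel_body)
  then show ?thesis
    using minkowski_functional_attained[OF K x]
      minkowski_functional_attained(3)[OF ball_body_parallel_body[OF K t] x] by blast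
qed

lemma gauge_le_gauge_parallel_body:
  assumes K: "ball_body n K" and t: "0 \<le> t" and x: "x \<in> Rn n"
  shows "minkowski_functional K x \<le> (1 + t) * minkowski_functional (parallel_body n K t) x"
proof -
  let ?p = "minkowski_functional (parallel_body n K t) x"
  note Kt = ball_body_parallel_body[OF K t]
  obtain y where y: "y \<in> parallel_body n K t" "x = (\<lambda>i. ?p * y i)"
    using minkowski_functional_attained(2)[OF Kt x] by (auto simp: scaled_def)
  obtain z where z: "z \<in> K" "y = (\<lambda>i. (1 + t) * z i)"
    using parallel_body_subset_scaled[OF K t] y by (force simp: scaled_def)
  have "x = (\<lambda>i. ((1 + t) * ?p) * z i)"
    by (subst y(2), subst z(2)) (simp add: mult_ac)
  then show ?thesis
    using minkowski_functional_attained(1)[OF Kt x] t scaledI[OF z(1), of "(1 + t) * ?p"]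
    by (intro minkowski_functional_attained(3)[OF K x]) auto
qed

text \<open>
  For fixed \<open>x\<close> the gauge of the parallel body is a convex function of the radius. Indeed
  \<open>x / a \<in> K\<close> and \<open>x / b \<in> K + t B\<close> give \<open>x / c \<in> K + \<lambda> t B\<close> when \<open>1 / c\<close> is the
  convex combination of \<open>1 / a\<close> and \<open>1 / b\<close>; the harmonic mean \<open>c\<close> is at most the
  arithmetic mean.
\<close>

lemma gauge_parallel_body_convex:
  assumes K: "ball_body n K" and t: "0 \<le> t" and x: "x \<in> Rn n" and l: "0 \<le> l" "l \<le> 1"
  shows "minkowski_functional (parallel_body n K (l * t)) x
    \<le> (1 - l) * minkowski_functional K x + l * minkowski_functional (parallel_body n K t) x"
proof -
  define a where "a = minkowski_functional K x"
  define b where "b = minkowski_functional (parallel_body n K t) x"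
  have lt: "0 \<le> l * t"
    using l t by simp
  note Kt = ball_body_parallel_body[OF K t] and Klt = ball_body_parallel_body[OF K lt]
  have ab: "0 \<le> a" "0 \<le> b" "b \<le> a" "a \<le> (1 + t) * b"
    using minkowski_functional_attained(1)[OF K x] minkowski_functional_attained(1)[OF Kt x]
      gauge_parallel_body_le[OF K t x] gauge_le_gauge_parallel_body[OF K t x]
    by (auto simp: a_def b_def)
  obtain y where y: "y \<in> K" "x = (\<lambda>i. a * y i)"
    using minkowski_functional_attained(2)[OF K x] by (auto simp: scaled_def a_def)
  obtain z where z: "z \<in> parallel_body n K t" "x = (\<lambda>i. b * z i)"
    using minkowski_functional_attained(2)[OF Kt x] by (auto simp: scaled_def b_def)
  obtain w u where w: "w \<in> K" "u \<in> unit_ball n" "z = (\<lambda>i. w i + t * u i)"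
    using z by (auto simp: parallel_body_def)
  show ?thesis
  proof (cases "b = 0")
    case True
    then have "a = 0"
      using ab by simp
    then show ?thesis
      using gauge_parallel_body_le[OF K lt x] True by (simp flip: a_def b_def)
  next
    case False
    then have pos: "0 < a" "0 < b"
      using ab by auto
    \<comment> \<open>\<open>D / (a b)\<close> is the convex combination of \<open>1 / a\<close> and \<open>1 / b\<close>\<close>
    define D where "D = (1 - l) * b + l * a"
    have D: "0 < D"
    proof (cases "l = 0")
      case False
      then show ?thesis
        using pos l by (auto simp: D_def intro!: add_nonneg_pos)
    qed (use pos in \<open>simp add: D_def\<close>)
    define c where "c = a * b / D"
    have "(\<lambda>i. ((1 - l) * y i + l * w i) + (l * t) * u i) \<in> parallel_body n K (l * t)"
      using l y w by (intro parallel_bodyI ball_bodyD(4)[OF K]) auto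
    then have "(\<lambda>i. c * (((1 - l) * y i + l * w i) + (l * t) * u i)) \<in> scaled c (parallel_body n K (l * t))"
      by (rule scaledI)
    also have "(\<lambda>i. c * (((1 - l) * y i + l * w i) + (l * t) * u i)) = x"
    proof
      fix i
      have 1: "y i = x i / a"
        using y(2) pos by (metis nonzero_mult_div_cancel_left less_irrefl)
      have "z i = x i / b"
        using z(2) pos by (metis nonzero_mult_div_cancel_left less_irrefl)
      then have 2: "w i + t * u i = x i / b"
        using w(3) by simp
      have "c * (((1 - l) * y i + l * w i) + (l * t) * u i) = c * ((1 - l) * y i + l * (w i + t * u i))"
        by (simp add: algebra_simps)
      also have "\<dots> = c * (D / (a * b)) * x i"
        unfolding 1 2 D_def using pos by (simp add: field_simps)
      also have "\<dots> = x i"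
        using pos D by (simp add: c_def)
      finally show "c * (((1 - l) * y i + l * w i) + (l * t) * u i) = x i" .
    qed
    finally have "minkowski_functional (parallel_body n K (l * t)) x \<le> c"
      using pos D by (intro minkowski_functional_attained(3)[OF Klt x]) (auto simp: c_def)
    also have "c \<le> (1 - l) * a + l * b"
    proof -
      have "((1 - l) * a + l * b) * D = a * b + l * (1 - l) * (a - b)\<^sup>2"
        by (simp add: D_def power2_eq_square algebra_simps)
      also have "\<dots> \<ge> a * b"
        using l by simp
      finally show ?thesis
        using D by (simp add: c_def pos_divide_le_eq)
    qed
    finally show ?thesis
      by (simp add: a_def b_def)
  qed
qed

lemma antimono_tendsto_at_right:
  fixes f :: "real \<Rightarrow> real"
  assumes anti: "\<And>s t. 0 < s \<Longrightarrow> s \<le> t \<Longrightarrow> f t \<le> f s" and bound: "\<And>t. 0 < t \<Longrightarrow> f t \<le> b"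
  shows "\<exists>l. (f \<longlongrightarrow> l) (at_right 0)"
proof -
  have bdd: "bdd_above (f ` {0<..})"
    using bound by (intro bdd_aboveI[of _ b]) auto
  have "(f \<longlongrightarrow> (SUP t\<in>{0<..}. f t)) (at_right 0)"
  proof (rule order_tendstoI)
    fix a assume "a < (SUP t\<in>{0<..}. f t)"
    then obtain t where t: "0 < t" "a < f t"
      using less_cSUP_iff[OF _ bdd] by auto
    have "eventually (\<lambda>s. s \<in> {0<..<t}) (at_right 0)"
      using t by (intro eventually_at_right_real)
    then show "eventually (\<lambda>s. a < f s) (at_right 0)"
    proof eventually_elim
      case (elim s)
      then show ?case
        using anti[of s t] t by simp
    qed
  next
    fix a assume a: "(SUP t\<in>{0<..}. f t) < a"
    have "eventually (\<lambda>s. s \<in> {0<..<1}) (at_right (0::real))"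
      by (intro eventually_at_right_real) simp
    then show "eventually (\<lambda>s. f s < a) (at_right 0)"
    proof eventually_elim
      case (elim s)
      then have "f s \<le> (SUP t\<in>{0<..}. f t)"
        by (intro cSUP_upper bdd) simp
      then show ?case
        using a by simp
    qed
  qed
  then show ?thesis
    by blast
qed

lemma vol_nonneg: "0 \<le> vol n A"
  by (simp add: vol_def)

lemma vol_mono:
  assumes "compact A" "compact B" "A \<subseteq> B"
  shows "vol n A \<le> vol n B"
  unfolding vol_def
  using assms emeasure_compact_finite[of B n] by (intro measure_mono_fmeasurable)
    (auto simp: fmeasurable_def compact_sets_borel)

lemma vol_scaled: "ball_body n K \<Longrightarrow> 0 < s \<Longrightarrow> vol n (scaled s K) = s ^ n * vol n K"
  unfolding vol_def by (simp add: measure_def emeasure_scaled enn2real_mult)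

text \<open>
  The volume of \<open>K + t B\<close> is \<open>n + 1\<close> times the integral over \<open>K + t B\<close> of one minus its
  gauge. Over \<open>K\<close> this integrand is concave in \<open>t\<close>, so the difference quotient of its integral is
  monotone and converges. Over the shell outside \<open>K\<close> it is at most \<open>t\<close> on a set of measure
  \<open>O(t)\<close>, so the shell contributes nothing to the derivative. The derivative is at most
  \<open>n vol K\<close>, as \<open>K + t B\<close> lies in \<open>(1 + t) K\<close>.
\<close>

theorem surface_area_le:
  assumes K: "ball_body n K"
  shows "surface_area n K \<le> real n * vol n K"
proof -
  let ?L = "lebesgue_Rn n"
  let ?K = "parallel_body n K"
  let ?p = "\<lambda>t. minkowski_functional (?K t)"
  let ?g = "minkowski_functional K"
  define D where "D t = vol n (?K t) - vol n K" for t
  define Q where "Q t = (\<integral>x. indicator K x * (?g x - ?p t x) \<partial>?L)" for t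
  define R where "R t = (\<integral>x. indicator (?K t - K) x * (1 - ?p t x) \<partial>?L)" for t
  note body = ball_body_parallel_body[OF K]
  have fm: "K \<in> fmeasurable ?L" "?K t - K \<in> fmeasurable ?L" if "0 \<le> t" for t
    using emeasure_compact_finite[OF ball_bodyD(1)[OF K], of n]
      emeasure_compact_finite[OF ball_bodyD(1)[OF body[OF that]], of n]
      ball_body_measurable[OF K] ball_body_measurable[OF body[OF that]]
    by (auto intro!: fmeasurableI fmeasurable_Diff)
  have meas [measurable]: "?g \<in> borel_measurable borel" "K \<in> sets borel"
    by (rule measurable_minkowski_functional[OF K], rule ball_body_measurable[OF K])
  have gap: "0 \<le> ?g x - ?p t x" "?g x - ?p t x \<le> t" if "x \<in> K" "0 \<le> t" for x t
  proof -
    have x: "x \<in> Rn n"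
      using that ball_bodyD(2)[OF K] by blast
    have "?g x \<le> 1"
      using minkowski_functional_le_1_iff[OF K x] that by simp
    then have p: "?p t x \<le> 1"
      using gauge_parallel_body_le[OF K that(2) x] by simp
    then have "t * ?p t x \<le> t * 1"
      using that by (intro mult_left_mono)
    then show "0 \<le> ?g x - ?p t x" "?g x - ?p t x \<le> t"
      using gauge_parallel_body_le[OF K that(2) x] gauge_le_gauge_parallel_body[OF K that(2) x]
      by (auto simp: algebra_simps)
  qed
  have shell: "0 \<le> 1 - ?p t x" "1 - ?p t x \<le> t" if "x \<in> ?K t - K" "0 \<le> t" for x t
  proof -
    have x: "x \<in> Rn n"
      using that ball_bodyD(2)[OF body[OF that(2)]] by blast
    have p: "?p t x \<le> 1"
      using minkowski_functional_le_1_iff[OF body[OF that(2)] x] that by simp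
    have "1 < ?g x"
      using minkowski_functional_le_1_iff[OF K x] that by simp
    moreover have "t * ?p t x \<le> t * 1"
      using that p by (intro mult_left_mono)
    ultimately show "0 \<le> 1 - ?p t x" "1 - ?p t x \<le> t"
      using p gauge_le_gauge_parallel_body[OF K that(2) x] by (auto simp: algebra_simps)
  qed
  have intQ: "integrable ?L (\<lambda>x. indicator K x * (?g x - ?p t x))" if "0 \<le> t" for t
  proof (rule Bochner_Integration.integrable_bound[of _ "\<lambda>x. t * indicator K x"])
    show "integrable ?L (\<lambda>x. t * indicator K x)"
      using fm(1)[OF that] by (intro integrable_mult_right integrable_real_indicator) (auto simp: fmeasurable_def)
    note measurable_minkowski_functional[OF body[OF that], measurable]
    show "(\<lambda>x. indicator K x * (?g x - ?p t x)) \<in> borel_measurable ?L"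
      by measurable
    show "AE x in ?L. norm (indicator K x * (?g x - ?p t x)) \<le> norm (t * indicator K x)"
      using gap that by (intro AE_I2) (auto simp: indicator_def)
  qed
  have intR: "integrable ?L (\<lambda>x. indicator (?K t - K) x * (1 - ?p t x))" if "0 \<le> t" for t
  proof (rule Bochner_Integration.integrable_bound[of _ "\<lambda>x. t * indicator (?K t - K) x"])
    show "integrable ?L (\<lambda>x. t * indicator (?K t - K) x)"
      using fm(2)[OF that] by (intro integrable_mult_right integrable_real_indicator) (auto simp: fmeasurable_def)
    note measurable_minkowski_functional[OF body[OF that], measurable]
      ball_body_measurable[OF body[OF that], measurable]
    show "(\<lambda>x. indicator (?K t - K) x * (1 - ?p t x)) \<in> borel_measurable ?L"
      by measurable
    show "AE x in ?L. norm (indicator (?K t - K) x * (1 - ?p t x)) \<le> norm (t * indicator (?K t - K) x)"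
      using shell that by (intro AE_I2) (auto simp: indicator_def)
  qed
  have D_eq: "D t = (real n + 1) * (Q t + R t)" if "0 \<le> t" for t
  proof -
    have "vol n (?K t) / (real n + 1) - vol n K / (real n + 1)
        = (\<integral>x. indicator (?K t) x * (1 - ?p t x) - indicator K x * (1 - ?g x) \<partial>?L)"
      by (rule has_bochner_integral_integral_eq[symmetric])
        (intro has_bochner_integral_diff has_integral_gauge_cone K body that)
    also have "\<dots> = (\<integral>x. indicator K x * (?g x - ?p t x) + indicator (?K t - K) x * (1 - ?p t x) \<partial>?L)"
      using subset_parallel_body[of K n t]
      by (intro Bochner_Integration.integral_cong) (auto simp: indicator_def)
    also have "\<dots> = Q t + R t"
      unfolding Q_def R_def by (intro Bochner_Integration.integral_add intQ intR that)
    finally have "D t / (real n + 1) = Q t + R t"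
      by (simp add: D_def diff_divide_distrib)
    then show ?thesis
      by (simp add: divide_eq_eq mult.commute)
  qed
  have D_upper: "D t \<le> ((1 + t) ^ n - 1) * vol n K" if "0 \<le> t" for t
  proof -
    have "vol n (?K t) \<le> vol n (scaled (1 + t) K)"
      by (intro vol_mono compact_scaled ball_bodyD(1)[OF K] ball_bodyD(1)[OF body[OF that]]
          parallel_body_subset_scaled K that)
    also have "\<dots> = (1 + t) ^ n * vol n K"
      using that by (intro vol_scaled[OF K]) simp
    finally show ?thesis
      by (simp add: D_def algebra_simps)
  qed
  have R: "0 \<le> R t" "R t \<le> t * D t" if "0 \<le> t" for t
  proof -
    show "0 \<le> R t"
      unfolding R_def using shell that by (intro Bochner_Integration.integral_nonneg) (auto simp: indicator_def)
    have "R t \<le> (\<integral>x. t * indicator (?K t - K) x \<partial>?L)"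
      unfolding R_def using shell that fm(2)[OF that]
      by (intro Bochner_Integration.integral_mono intR integrable_mult_right integrable_real_indicator)
        (auto simp: indicator_def fmeasurable_def)
    also have "\<dots> = t * measure ?L (?K t - K)"
      by simp
    also have "measure ?L (?K t - K) = D t"
      unfolding D_def vol_def using subset_parallel_body[of K n t]
        emeasure_compact_finite[OF ball_bodyD(1)[OF body[OF that]], of n]
      by (intro measure_Diff) (auto simp: ball_body_measurable[OF body[OF that]])
    finally show "R t \<le> t * D t" .
  qed
  have "Q (l * t) \<ge> l * Q t" if "0 \<le> t" "0 \<le> l" "l \<le> 1" for l t
  proof -
    have "l * Q t = (\<integral>x. l * (indicator K x * (?g x - ?p t x)) \<partial>?L)"
      by (simp add: Q_def)
    also have "\<dots> \<le> Q (l * t)"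
      unfolding Q_def
    proof (intro Bochner_Integration.integral_mono intQ integrable_mult_right that mult_nonneg_nonneg)
      fix x
      show "l * (indicator K x * (?g x - ?p t x)) \<le> indicator K x * (?g x - ?p (l * t) x)"
        using gauge_parallel_body_convex[OF K that(1) _ that(2,3), of x] ball_bodyD(2)[OF K]
        by (cases "x \<in> K") (auto simp: algebra_simps)
    qed
    finally show ?thesis .
  qed
  note Q_scale = this
  have "\<exists>l. ((\<lambda>t. Q t / t) \<longlongrightarrow> l) (at_right 0)"
  proof (rule antimono_tendsto_at_right)
    fix s t :: real assume st: "0 < s" "s \<le> t"
    then show "Q t / t \<le> Q s / s"
      using Q_scale[of t "s / t"] by (simp add: field_simps)
  next
    fix t :: real assume t: "0 < t"
    have "Q t \<le> (\<integral>x. t * indicator K x \<partial>?L)"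
      unfolding Q_def using gap t fm(1)[of t]
      by (intro Bochner_Integration.integral_mono intQ integrable_mult_right integrable_real_indicator)
        (auto simp: indicator_def fmeasurable_def)
    then show "Q t / t \<le> vol n K"
      using t by (simp add: vol_def field_simps)
  qed
  then obtain l where l: "((\<lambda>t. Q t / t) \<longlongrightarrow> l) (at_right 0)"
    by blast
  have pos: "eventually (\<lambda>t. 0 < t) (at_right (0::real))"
    by (simp add: eventually_at_right_less)
  have "((\<lambda>t. ((1 + t) ^ n - 1) * vol n K) \<longlongrightarrow> ((1 + 0) ^ n - 1) * vol n K) (at_right 0)"
    by (intro tendsto_intros)
  then have to0: "((\<lambda>t. ((1 + t) ^ n - 1) * vol n K) \<longlongrightarrow> 0) (at_right 0)"
    by simp
  have R_lim: "((\<lambda>t. R t / t) \<longlongrightarrow> 0) (at_right 0)"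
  proof (rule tendsto_sandwich[OF _ _ tendsto_const to0])
    show "eventually (\<lambda>t. 0 \<le> R t / t) (at_right 0)"
      using pos by eventually_elim (simp add: R)
    show "eventually (\<lambda>t. R t / t \<le> ((1 + t) ^ n - 1) * vol n K) (at_right 0)"
      using pos
    proof eventually_elim
      case (elim t)
      then have "R t / t \<le> D t"
        using R(2)[of t] by (simp add: field_simps)
      then show ?case
        using D_upper[of t] elim by simp
    qed
  qed
  have "((\<lambda>t. (real n + 1) * (Q t / t + R t / t)) \<longlongrightarrow> (real n + 1) * (l + 0)) (at_right 0)"
    by (intro tendsto_intros l R_lim)
  moreover have "eventually (\<lambda>t. (real n + 1) * (Q t / t + R t / t) = D t / t) (at_right 0)"
    using pos by eventually_elim (simp add: D_eq distrib_left add_divide_distrib)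
  ultimately have lim: "((\<lambda>t. D t / t) \<longlongrightarrow> (real n + 1) * l) (at_right 0)"
    by (simp add: tendsto_cong)
  have "surface_area n K = (real n + 1) * l"
    unfolding surface_area_def using lim by (intro tendsto_Lim) (auto simp: D_def)
  moreover have "(real n + 1) * l \<le> real n * vol n K"
  proof (rule tendsto_le[OF _ _ lim])
    have "((\<lambda>t. (1 + t) ^ n) has_real_derivative real n) (at_right 0)"
      by (auto intro!: derivative_eq_intros)
    then have "((\<lambda>t. ((1 + t) ^ n - 1) / t) \<longlongrightarrow> real n) (at_right 0)"
      by (simp add: has_field_derivative_iff)
    then show "((\<lambda>t. ((1 + t) ^ n - 1) / t * vol n K) \<longlongrightarrow> real n * vol n K) (at_right 0)"
      by (intro tendsto_intros)
    show "eventually (\<lambda>t. D t / t \<le> ((1 + t) ^ n - 1) / t * vol n K) (at_right 0)"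
      using pos by eventually_elim (use D_upper in \<open>simp add: divide_right_mono\<close>)
  qed simp
  ultimately show ?thesis
    by simp
qed

section \<open>The rotation-invariant probability measure on the sphere is unique\<close>

lemma compact_unit_sphere: "compact (unit_sphere n)"
proof -
  have "unit_sphere n = unit_ball n \<inter> {x. enorm n x = 1}"
    by (auto simp: unit_ball_def unit_sphere_def)
  moreover have "closed {x. enorm n x = 1}"
    by (intro closed_Collect_eq continuous_on_enorm continuous_on_const continuous_on_id)
  ultimately show ?thesis
    by (simp add: compact_Int_closed compact_unit_ball)
qed

lemma orthogonal_mat_unit_sphere:
  "orthogonal_mat n A \<Longrightarrow> x \<in> unit_sphere n \<Longrightarrow> mat_apply n A x \<in> unit_sphere n"
  by (simp add: unit_sphere_def orthogonal_mat_enorm)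

context
  fixes n :: nat and \<mu> :: "(nat \<Rightarrow> real) measure"
  assumes inv: "rotation_invariant_prob n \<mu>"
begin

lemma rotation_invariant_prob_space: "prob_space \<mu>"
  using inv by (simp add: rotation_invariant_prob_def)

lemma space_rotation_invariant_prob: "space \<mu> = unit_sphere n"
  using inv sets_eq_imp_space_eq[of \<mu> "restrict_space borel (unit_sphere n)"]
  by (simp add: rotation_invariant_prob_def space_restrict_space)

lemma measurable_rotation_invariant_prob:
  assumes "f \<in> measurable borel N"
  shows "f \<in> measurable \<mu> N"
proof -
  have "f \<in> measurable (restrict_space borel (unit_sphere n)) N"
    using assms by (rule measurable_restrict_space1)
  moreover have "sets \<mu> = sets (restrict_space borel (unit_sphere n))"
    using inv by (simp add: rotation_invariant_prob_def)
  ultimately show ?thesis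
    using measurable_cong_sets[of \<mu> _ N N] by blast
qed

lemma measurable_rotation_sphere:
  assumes "orthogonal_mat n A"
  shows "mat_apply n A \<in> measurable \<mu> \<mu>"
proof -
  have "sets \<mu> = sets (restrict_space borel (unit_sphere n))"
    using inv by (simp add: rotation_invariant_prob_def)
  moreover have "mat_apply n A \<in> measurable \<mu> (restrict_space borel (unit_sphere n))"
    using assms space_rotation_invariant_prob orthogonal_mat_unit_sphere
      measurable_rotation_invariant_prob[OF measurable_mat_apply]
    by (intro measurable_restrict_space2) auto
  ultimately show ?thesis
    using measurable_cong_sets[of \<mu> \<mu> \<mu>] by blast
qed

lemma nn_integral_rotation_sphere:
  assumes f: "f \<in> borel_measurable borel" and A: "orthogonal_mat n A"
  shows "(\<integral>\<^sup>+x. f (mat_apply n A x) \<partial>\<mu>) = (\<integral>\<^sup>+x. f x \<partial>\<mu>)"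
proof -
  have "(\<integral>\<^sup>+x. f x \<partial>\<mu>) = (\<integral>\<^sup>+x. f x \<partial>distr \<mu> \<mu> (mat_apply n A))"
    using inv A by (simp add: rotation_invariant_prob_def)
  also have "\<dots> = (\<integral>\<^sup>+x. f (mat_apply n A x) \<partial>\<mu>)"
    using measurable_rotation_invariant_prob[OF f] by (intro nn_integral_distr measurable_rotation_sphere A) simp
  finally show ?thesis ..
qed

lemma nn_integral_exp_dot_eq_if_enorm_eq:
  assumes "a \<in> Rn n" "b \<in> Rn n" "enorm n a = enorm n b"
  shows "(\<integral>\<^sup>+x. ennreal (exp (dot n a x)) \<partial>\<mu>) = (\<integral>\<^sup>+x. ennreal (exp (dot n b x)) \<partial>\<mu>)"
proof -
  define A where "A = reflection n (\<lambda>i. a i - b i)"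
  have A: "orthogonal_mat n A" "mat_apply n A a = b"
    using assms by (auto simp: A_def orthogonal_mat_reflection reflection_swap simp flip: enorm_sq)
  have "(\<lambda>x. dot n b x) \<in> borel_measurable borel"
    by (rule measurable_dot) simp_all
  then have "(\<lambda>x. ennreal (exp (dot n b x))) \<in> borel_measurable borel"
    by measurable
  note rot = nn_integral_rotation_sphere[OF this A(1)]
  have "dot n b (mat_apply n A x) = dot n a x" for x
    unfolding A(2)[symmetric] by (rule orthogonal_mat_dot[OF A(1)])
  then show ?thesis
    using rot by simp
qed

lemma integrable_on_sphere:
  fixes f :: "(nat \<Rightarrow> real) \<Rightarrow> real"
  assumes "continuous_on UNIV f"
  shows "integrable \<mu> f"
proof -
  interpret prob_space \<mu> by (rule rotation_invariant_prob_space)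
  have "bounded (f ` unit_sphere n)"
    using assms by (intro compact_imp_bounded compact_continuous_image compact_unit_sphere)
      (auto intro: continuous_on_subset)
  then obtain C where "\<And>x. x \<in> unit_sphere n \<Longrightarrow> norm (f x) \<le> C"
    by (auto simp: bounded_iff)
  then show ?thesis
    using assms
    by (intro integrable_const_bound[of _ C] measurable_rotation_invariant_prob)
      (auto simp: space_rotation_invariant_prob borel_measurable_continuous_onI)
qed

end

text \<open>
  The exponential integral of a rotation-invariant measure at \<open>a\<close> depends on \<open>\<bar>a\<bar>\<close> only, so it does
  not change if it is averaged over all directions of \<open>a\<close> by a second such measure. By symmetry
  of the double integral the two measures have the same exponential integrals.
\<close>

lemma nn_integral_exp_dot_unique:
  assumes \<mu>: "rotation_invariant_prob n \<mu>" and \<nu>: "rotation_invariant_prob n \<nu>" and a: "a \<in> Rn n"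
  shows "(\<integral>\<^sup>+x. ennreal (exp (dot n a x)) \<partial>\<mu>) = (\<integral>\<^sup>+x. ennreal (exp (dot n a x)) \<partial>\<nu>)"
proof -
  interpret m: prob_space \<mu> by (rule rotation_invariant_prob_space[OF \<mu>])
  interpret v: prob_space \<nu> by (rule rotation_invariant_prob_space[OF \<nu>])
  interpret pair_sigma_finite \<mu> \<nu> ..
  define s where "s = enorm n a"
  have avg: "(\<integral>\<^sup>+x. ennreal (exp (dot n a x)) \<partial>\<kappa>)
      = (\<integral>\<^sup>+y. (\<integral>\<^sup>+x. ennreal (exp (s * dot n y x)) \<partial>\<kappa>) \<partial>\<tau>)"
    if \<kappa>: "rotation_invariant_prob n \<kappa>" and \<tau>: "rotation_invariant_prob n \<tau>" for \<kappa> \<tau>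
  proof -
    interpret t: prob_space \<tau> by (rule rotation_invariant_prob_space[OF \<tau>])
    have "(\<integral>\<^sup>+y. (\<integral>\<^sup>+x. ennreal (exp (s * dot n y x)) \<partial>\<kappa>) \<partial>\<tau>)
        = (\<integral>\<^sup>+y. (\<integral>\<^sup>+x. ennreal (exp (dot n a x)) \<partial>\<kappa>) \<partial>\<tau>)"
    proof (rule nn_integral_cong)
      fix y assume "y \<in> space \<tau>"
      then have y: "y \<in> Rn n" "enorm n y = 1"
        by (simp_all add: space_rotation_invariant_prob[OF \<tau>] unit_sphere_def)
      have "(\<lambda>i. s * y i) \<in> Rn n" "enorm n (\<lambda>i. s * y i) = enorm n a"
        using y enorm_nonneg[of n a] by (auto simp: in_Rn enorm_scale s_def)
      from nn_integral_exp_dot_eq_if_enorm_eq[OF \<kappa> this(1) a this(2)]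
      show "(\<integral>\<^sup>+x. ennreal (exp (s * dot n y x)) \<partial>\<kappa>) = (\<integral>\<^sup>+x. ennreal (exp (dot n a x)) \<partial>\<kappa>)"
        by (simp add: dot_scale_left)
    qed
    then show ?thesis
      by (simp add: t.emeasure_space_1)
  qed
  have m1: "fst \<in> borel_measurable (\<mu> \<Otimes>\<^sub>M \<nu>)" "snd \<in> borel_measurable (\<mu> \<Otimes>\<^sub>M \<nu>)"
    using measurable_compose[OF measurable_fst measurable_rotation_invariant_prob[OF \<mu>], of "\<lambda>x. x" borel \<nu>]
      measurable_compose[OF measurable_snd measurable_rotation_invariant_prob[OF \<nu>], of "\<lambda>x. x" borel \<mu>]
    by auto
  have "(\<lambda>w. ennreal (exp (s * dot n (snd w) (fst w)))) \<in> borel_measurable (\<mu> \<Otimes>\<^sub>M \<nu>)"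
    using measurable_dot[OF m1(2) m1(1), of n] by measurable
  then have "(\<integral>\<^sup>+y. (\<integral>\<^sup>+x. ennreal (exp (s * dot n y x)) \<partial>\<mu>) \<partial>\<nu>)
      = (\<integral>\<^sup>+x. (\<integral>\<^sup>+y. ennreal (exp (s * dot n y x)) \<partial>\<nu>) \<partial>\<mu>)"
    by (intro Fubini') (simp add: split_beta')
  then show ?thesis
    unfolding avg[OF \<mu> \<nu>] avg[OF \<nu> \<mu>] by (simp add: dot_commute)
qed

text \<open>These functions form an algebra that separates the points of the sphere, as products of
  exponentials are exponentials. So Stone--Weierstrass applies to them.\<close>

inductive_set exp_sums :: "nat \<Rightarrow> ((nat \<Rightarrow> real) \<Rightarrow> real) set" for n
  where exp: "(\<lambda>x. c * exp (dot n a x)) \<in> exp_sums n"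
  | add: "f \<in> exp_sums n \<Longrightarrow> g \<in> exp_sums n \<Longrightarrow> (\<lambda>x. f x + g x) \<in> exp_sums n"

lemma exp_sums_mult:
  assumes "f \<in> exp_sums n" "g \<in> exp_sums n"
  shows "(\<lambda>x. f x * g x) \<in> exp_sums n"
  using assms(1)
proof (induction f rule: exp_sums.induct)
  case (exp c a)
  from assms(2) show ?case
  proof (induction g rule: exp_sums.induct)
    case (exp d b)
    have "(\<lambda>x. c * exp (dot n a x) * (d * exp (dot n b x)))
        = (\<lambda>x. (c * d) * exp (dot n (\<lambda>i. a i + b i) x))"
      by (simp add: dot_add_left exp_add mult_ac)
    then show ?case
      using exp_sums.exp[of "c * d" n "\<lambda>i. a i + b i"] by (simp only:)
  next
    case (add f g)
    show ?case
      using exp_sums.add[OF add.IH] by (simp only: distrib_left)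
  qed
next
  case (add f1 f2)
  show ?case
    using exp_sums.add[OF add.IH] by (simp only: distrib_right)
qed

lemma continuous_on_exp_sums:
  assumes "f \<in> exp_sums n"
  shows "continuous_on S f"
  using assms
proof induction
  case (exp c a)
  show ?case
    by (intro continuous_on_mult continuous_on_exp continuous_on_dot continuous_on_const continuous_on_id)
qed (intro continuous_on_add)

lemma function_ring_on_exp_sums: "function_ring_on (exp_sums n) (unit_sphere n)"
proof
  show "compact (unit_sphere n)" by (rule compact_unit_sphere)
  show "(\<lambda>_. c) \<in> exp_sums n" for c
    using exp_sums.exp[of c n "\<lambda>_. 0"] by (simp add: dot_def)
  fix x y :: "nat \<Rightarrow> real" assume xy: "x \<in> unit_sphere n" "y \<in> unit_sphere n" "x \<noteq> y"
  then obtain i where i: "i < n" "x i \<noteq> y i"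
    using Rn_eqI[of x n y] by (auto simp: unit_sphere_def)
  let ?a = "\<lambda>j. if j = i then 1 else 0"
  have "dot n ?a z = z i" for z
    using i by (simp add: dot_def if_distrib[of "\<lambda>c. c * _"] cong: if_cong)
  then show "\<exists>f\<in>exp_sums n. f x \<noteq> f y"
    using exp_sums.exp[of 1 n ?a] i by (intro bexI[of _ "\<lambda>x. 1 * exp (dot n ?a x)"]) auto
qed (fact continuous_on_exp_sums exp_sums.add exp_sums_mult)+

lemma integral_exp_sums_unique:
  assumes \<mu>: "rotation_invariant_prob n \<mu>" and \<nu>: "rotation_invariant_prob n \<nu>" and f: "f \<in> exp_sums n"
  shows "(\<integral>x. f x \<partial>\<mu>) = (\<integral>x. f x \<partial>\<nu>)"
  using f
proof induction
  case (exp c a)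
  \<comment> \<open>only the first \<open>n\<close> entries of \<open>a\<close> enter, so \<open>a\<close> may be taken in \<open>Rn n\<close>\<close>
  let ?a = "zero_extend n a"
  have eq: "dot n a = dot n ?a"
    by (auto simp: dot_def zero_extend_def)
  have "(\<integral>x. exp (dot n ?a x) \<partial>\<kappa>) = enn2real (\<integral>\<^sup>+x. ennreal (exp (dot n ?a x)) \<partial>\<kappa>)"
    if "rotation_invariant_prob n \<kappa>" for \<kappa>
    using continuous_on_exp_sums[OF exp_sums.exp[of 1 n ?a]]
    by (intro integral_eq_nn_integral measurable_rotation_invariant_prob[OF that]
        borel_measurable_continuous_onI) auto
  moreover have "?a \<in> Rn n"
    by (simp add: in_Rn zero_extend_def)
  ultimately show ?case
    using nn_integral_exp_dot_unique[OF \<mu> \<nu>] \<mu> \<nu> by (simp add: eq)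
next
  case (add f g)
  then show ?case
    by (subst (1 2) Bochner_Integration.integral_add)
      (auto intro: integrable_on_sphere[OF \<mu>] integrable_on_sphere[OF \<nu>] continuous_on_exp_sums)
qed

text \<open>Uniform approximation on the sphere by sums of exponentials transfers the equality of
  the integrals to all continuous functions.\<close>

lemma integral_continuous_unique:
  assumes \<mu>: "rotation_invariant_prob n \<mu>" and \<nu>: "rotation_invariant_prob n \<nu>"
    and f: "continuous_on UNIV f"
  shows "(\<integral>x. f x \<partial>\<mu>) = (\<integral>x. f x \<partial>\<nu> :: real)"
proof -
  interpret m: prob_space \<mu> by (rule rotation_invariant_prob_space[OF \<mu>])
  interpret v: prob_space \<nu> by (rule rotation_invariant_prob_space[OF \<nu>])
  have "\<bar>(\<integral>x. f x \<partial>\<mu>) - (\<integral>x. f x \<partial>\<nu>)\<bar> \<le> 0 + e" if e: "0 < e" for e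
  proof -
    have "continuous_on (unit_sphere n) f"
      using f by (rule continuous_on_subset) simp
    then obtain g where g: "g \<in> exp_sums n" "\<And>x. x \<in> unit_sphere n \<Longrightarrow> \<bar>f x - g x\<bar> < e / 2"
      using function_ring_on.Stone_Weierstrass_basic[OF function_ring_on_exp_sums, of n f "e / 2"] e
      by auto
    have close: "\<bar>(\<integral>x. f x \<partial>\<kappa>) - (\<integral>x. g x \<partial>\<kappa>)\<bar> \<le> e / 2"
      if \<kappa>: "rotation_invariant_prob n \<kappa>" for \<kappa>
    proof -
      interpret k: prob_space \<kappa> by (rule rotation_invariant_prob_space[OF \<kappa>])
      note int = integrable_on_sphere[OF \<kappa> f] integrable_on_sphere[OF \<kappa> continuous_on_exp_sums[OF g(1)]]
      have "\<bar>(\<integral>x. f x \<partial>\<kappa>) - (\<integral>x. g x \<partial>\<kappa>)\<bar> = \<bar>(\<integral>x. f x - g x \<partial>\<kappa>)\<bar>"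
        using int by simp
      also have "\<dots> \<le> (\<integral>x. \<bar>f x - g x\<bar> \<partial>\<kappa>)"
        using integral_norm_bound[of \<kappa> "\<lambda>x. f x - g x"] by simp
      also have "\<dots> \<le> (\<integral>x. e / 2 \<partial>\<kappa>)"
        using int g(2) by (intro Bochner_Integration.integral_mono)
          (auto simp: space_rotation_invariant_prob[OF \<kappa>] intro: less_imp_le)
      finally show ?thesis
        by (simp add: k.prob_space)
    qed
    show ?thesis
      using close[OF \<mu>] close[OF \<nu>] integral_exp_sums_unique[OF \<mu> \<nu> g(1)] by linarith
  qed
  then have "\<bar>(\<integral>x. f x \<partial>\<mu>) - (\<integral>x. f x \<partial>\<nu>)\<bar> \<le> 0"
    by (rule field_le_epsilon)
  then show ?thesis
    by simp
qed

lemma tendsto_indicator_closed: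
  fixes C :: "'a::metric_space set"
  assumes C: "closed C" "C \<noteq> {}"
  shows "(\<lambda>k. max 0 (1 - real k * infdist x C)) \<longlonglongrightarrow> indicator C x"
proof (cases "x \<in> C")
  case True
  then show ?thesis
    by simp
next
  case False
  then have d: "0 < infdist x C"
    using C in_closed_iff_infdist_zero[of C x] infdist_nonneg[of x C] by fastforce
  obtain N :: nat where N: "1 / infdist x C < real N"
    using reals_Archimedean2 by blast
  have "eventually (\<lambda>k. max 0 (1 - real k * infdist x C) = 0) sequentially"
    using eventually_ge_at_top[of N]
  proof eventually_elim
    case (elim k)
    then have "1 / infdist x C < real k"
      using N by linarith
    then show ?case
      using d by (simp add: field_simps)
  qed
  then show ?thesis
    using False by (simp add: tendsto_eventually)
qed

lemma measure_closed_unique: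
  assumes \<mu>: "rotation_invariant_prob n \<mu>" and \<nu>: "rotation_invariant_prob n \<nu>"
    and C: "closed C" "C \<noteq> {}"
  shows "(\<integral>x. indicator C x \<partial>\<mu>) = (\<integral>x. indicator C x \<partial>\<nu> :: real)"
proof -
  let ?f = "\<lambda>k x. max 0 (1 - real k * infdist x C)"
  have cont: "continuous_on UNIV (?f k)" for k
    by (intro continuous_intros)
  have lim: "(\<lambda>k. (\<integral>x. ?f k x \<partial>\<kappa>)) \<longlonglongrightarrow> (\<integral>x. indicator C x \<partial>\<kappa>)"
    if \<kappa>: "rotation_invariant_prob n \<kappa>" for \<kappa>
  proof (rule integral_dominated_convergence[where w = "\<lambda>_. 1"])
    show "integrable \<kappa> (\<lambda>_. 1::real)"
      by (rule integrable_on_sphere[OF \<kappa>]) simp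
    show "?f k \<in> borel_measurable \<kappa>" for k
      by (intro measurable_rotation_invariant_prob[OF \<kappa>] borel_measurable_continuous_onI cont)
    show "(indicator C :: _ \<Rightarrow> real) \<in> borel_measurable \<kappa>"
      using C by (intro measurable_rotation_invariant_prob[OF \<kappa>]) (auto intro: borel_closed)
    show "AE x in \<kappa>. (\<lambda>k. ?f k x) \<longlonglongrightarrow> indicator C x"
      by (intro AE_I2 tendsto_indicator_closed C)
    show "AE x in \<kappa>. norm (?f k x) \<le> 1" for k
      by (intro AE_I2) (simp add: infdist_nonneg)
  qed
  show ?thesis
    using lim[OF \<mu>] lim[OF \<nu>] integral_continuous_unique[OF \<mu> \<nu> cont] LIMSEQ_unique by simp
qed

text \<open>Closed sets are stable under intersection and generate the Borel sets, and their
  indicators are limits of continuous functions.\<close>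

theorem rotation_invariant_prob_unique:
  assumes \<mu>: "rotation_invariant_prob n \<mu>" and \<nu>: "rotation_invariant_prob n \<nu>"
  shows "\<mu> = \<nu>"
proof -
  let ?d = "\<lambda>\<kappa>. distr \<kappa> borel (\<lambda>x::nat \<Rightarrow> real. x)"
  have meas: "(\<lambda>x. x) \<in> measurable \<kappa> borel" if "rotation_invariant_prob n \<kappa>" for \<kappa>
    by (rule measurable_rotation_invariant_prob[OF that]) simp
  have closed: "emeasure (?d \<kappa>) C = ennreal (\<integral>x. indicator C x \<partial>\<kappa>)"
    if \<kappa>: "rotation_invariant_prob n \<kappa>" and C: "closed C" for \<kappa> C
  proof -
    interpret prob_space \<kappa> by (rule rotation_invariant_prob_space[OF \<kappa>])
    show ?thesis
      using C meas[OF \<kappa>] by (simp add: emeasure_distr emeasure_eq_measure borel_closed Int_commute)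
  qed
  have "?d \<mu> = ?d \<nu>"
  proof (rule measure_eqI_generator_eq[where E = "Collect closed" and \<Omega> = UNIV and A = "\<lambda>_. UNIV"])
    show "emeasure (?d \<mu>) C = emeasure (?d \<nu>) C" if "C \<in> Collect closed" for C
      using that closed[OF \<mu>] closed[OF \<nu>] measure_closed_unique[OF \<mu> \<nu>] by (cases "C = {}") auto
    have "sets borel = sigma_sets UNIV (Collect (closed :: (nat \<Rightarrow> real) set \<Rightarrow> bool))"
      by (simp add: borel_eq_closed)
    then show "sets (?d \<mu>) = sigma_sets UNIV (Collect closed)" "sets (?d \<nu>) = sigma_sets UNIV (Collect closed)"
      by simp_all
    interpret prob_space \<mu> by (rule rotation_invariant_prob_space[OF \<mu>])
    show "emeasure (?d \<mu>) UNIV \<noteq> \<infinity>"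
      using meas[OF \<mu>] by (simp add: emeasure_distr)
  qed (auto simp: Int_stable_def)
  show ?thesis
  proof (rule measure_eqI)
    show "sets \<mu> = sets \<nu>"
      using \<mu> \<nu> by (simp add: rotation_invariant_prob_def)
    fix A assume "A \<in> sets \<mu>"
    then obtain B where B: "B \<in> sets borel" "A = B \<inter> unit_sphere n"
      using \<mu> by (auto simp: rotation_invariant_prob_def sets_restrict_space)
    have "emeasure (?d \<kappa>) B = emeasure \<kappa> A" if "rotation_invariant_prob n \<kappa>" for \<kappa>
      using B meas[OF that] space_rotation_invariant_prob[OF that] by (simp add: emeasure_distr)
    then show "emeasure \<mu> A = emeasure \<nu> A"
      using \<mu> \<nu> \<open>?d \<mu> = ?d \<nu>\<close> by metis
  qed
qed

section \<open>The normalized Gaussian vector\<close>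

interpretation gauss: product_sigma_finite "\<lambda>_::nat. std_normal_distribution"
  unfolding product_sigma_finite_def
  by (intro allI prob_space_imp_sigma_finite prob_space_normal_density) simp

abbreviation gauss_PiM :: "nat \<Rightarrow> (nat \<Rightarrow> real) measure"
  where "gauss_PiM n \<equiv> \<Pi>\<^sub>M i\<in>{..<n}. std_normal_distribution"

definition gauss_Rn :: "nat \<Rightarrow> (nat \<Rightarrow> real) measure"
  where "gauss_Rn n = distr (gauss_PiM n) borel (zero_extend n)"

definition gauss_density :: "nat \<Rightarrow> (nat \<Rightarrow> real) \<Rightarrow> real"
  where "gauss_density n x = (1 / sqrt (2 * pi)) ^ n * exp (- dot n x x / 2)"

lemma sets_gauss_PiM: "sets (gauss_PiM n) = sets (\<Pi>\<^sub>M i\<in>{..<n}. lborel)"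
  by (intro sets_PiM_cong) auto

lemma measurable_zero_extend_gauss: "zero_extend n \<in> measurable (gauss_PiM n) borel"
  using measurable_zero_extend measurable_cong_sets[OF sets_gauss_PiM refl, of n borel] by blast

lemma sets_gauss_Rn [simp, measurable_cong]: "sets (gauss_Rn n) = sets borel"
  by (simp add: gauss_Rn_def)

lemma space_gauss_Rn [simp]: "space (gauss_Rn n) = UNIV"
  by (simp add: gauss_Rn_def)

lemma prob_space_gauss_Rn: "prob_space (gauss_Rn n)"
proof -
  interpret prob_space "gauss_PiM n"
    by (intro prob_space_PiM prob_space_normal_density) simp
  show ?thesis
    unfolding gauss_Rn_def by (rule prob_space_distr[OF measurable_zero_extend_gauss])
qed

lemma gauss_PiM_eq_density:
  "gauss_PiM n = density (\<Pi>\<^sub>M i\<in>{..<n}. lborel) (\<lambda>x. \<Prod>i<n. ennreal (std_normal_density (x i)))"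
proof (rule gauss.PiM_eqI[symmetric])
  let ?P = "\<Pi>\<^sub>M i\<in>{..<n}. (lborel :: real measure)"
  let ?w = "\<lambda>x. \<Prod>i<n. ennreal (std_normal_density (x i))"
  have comp: "(\<lambda>x. x i) \<in> borel_measurable ?P" if "i < n" for i
    using measurable_component_singleton[of i "{..<n}" "\<lambda>_. lborel :: real measure"] that by simp
  have w: "?w \<in> borel_measurable ?P"
    using comp by (intro borel_measurable_prod_ennreal measurable_compose[OF _ measurable_ennreal]
        measurable_compose[OF comp borel_measurable_normal_density]) auto
  show "sets (density ?P ?w) = sets (gauss_PiM n)"
    by (simp add: sets_gauss_PiM)
  fix A assume A: "\<And>i. i \<in> {..<n} \<Longrightarrow> A i \<in> sets std_normal_distribution"
  have "emeasure (density ?P ?w) (Pi\<^sub>E {..<n} A) = (\<integral>\<^sup>+x. ?w x * indicator (Pi\<^sub>E {..<n} A) x \<partial>?P)"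
    using A w by (intro emeasure_density sets_PiM_I_finite) auto
  also have "\<dots> = (\<integral>\<^sup>+x. (\<Prod>i<n. ennreal (std_normal_density (x i)) * indicator (A i) (x i)) \<partial>?P)"
  proof (rule nn_integral_cong)
    fix x assume "x \<in> space ?P"
    then have "x \<in> extensional {..<n}"
      by (simp add: space_PiM PiE_iff)
    then have "indicator (Pi\<^sub>E {..<n} A) x = (\<Prod>i<n. indicator (A i) (x i) :: ennreal)"
      by (cases "x \<in> Pi\<^sub>E {..<n} A") (auto simp: PiE_iff indicator_def intro!: prod.neutral[symmetric] prod_zero[symmetric])
    then show "?w x * indicator (Pi\<^sub>E {..<n} A) x
        = (\<Prod>i<n. ennreal (std_normal_density (x i)) * indicator (A i) (x i))"
      by (simp add: prod.distrib)
  qed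
  also have "\<dots> = (\<Prod>i<n. (\<integral>\<^sup>+x. ennreal (std_normal_density x) * indicator (A i) x \<partial>lborel))"
    using A by (intro lebesgue_product.product_nn_integral_prod) auto
  also have "\<dots> = (\<Prod>i<n. emeasure std_normal_distribution (A i))"
    using A by (intro prod.cong) (auto simp: emeasure_density)
  finally show "emeasure (density ?P ?w) (Pi\<^sub>E {..<n} A)
      = (\<Prod>i<n. emeasure std_normal_distribution (A i))" .
qed simp

lemma gauss_density_measurable [measurable]: "gauss_density n \<in> borel_measurable borel"
proof -
  have "(\<lambda>x. dot n x x) \<in> borel_measurable borel"
    by (rule measurable_dot) simp_all
  then show ?thesis
    unfolding gauss_density_def[abs_def] by measurable
qed

lemma nn_integral_gauss_Rn:
  assumes f [measurable]: "f \<in> borel_measurable borel"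
  shows "(\<integral>\<^sup>+x. f x \<partial>gauss_Rn n) = (\<integral>\<^sup>+x. ennreal (gauss_density n x) * f x \<partial>lebesgue_Rn n)"
proof -
  let ?P = "\<Pi>\<^sub>M i\<in>{..<n}. (lborel :: real measure)"
  let ?w = "\<lambda>x. \<Prod>i<n. ennreal (std_normal_density (x i))"
  have w: "?w x = ennreal (gauss_density n (zero_extend n x))" for x
  proof -
    have "?w x = ennreal (\<Prod>i<n. std_normal_density (x i))"
      by (intro prod_ennreal) simp
    also have "(\<Prod>i<n. std_normal_density (x i)) = (1 / sqrt (2 * pi)) ^ n * exp (\<Sum>i<n. - (x i)\<^sup>2 / 2)"
      unfolding std_normal_density_def prod.distrib by (simp add: exp_sum)
    also have "(\<Sum>i<n. - (x i)\<^sup>2 / 2) = - dot n (zero_extend n x) (zero_extend n x) / 2"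
      by (simp add: dot_def zero_extend_def power2_eq_square sum_negf sum_divide_distrib)
    finally show ?thesis
      by (simp add: gauss_density_def)
  qed
  have meas: "(\<lambda>x. g (zero_extend n x)) \<in> borel_measurable ?P" if "g \<in> borel_measurable borel"
    for g :: "_ \<Rightarrow> ennreal"
    using measurable_compose[OF measurable_zero_extend that] .
  have gd: "(\<lambda>x. ennreal (gauss_density n x)) \<in> borel_measurable borel"
    by measurable
  have "(\<integral>\<^sup>+x. f x \<partial>gauss_Rn n) = (\<integral>\<^sup>+x. f (zero_extend n x) \<partial>gauss_PiM n)"
    unfolding gauss_Rn_def by (rule nn_integral_distr[OF measurable_zero_extend_gauss]) simp
  also have "\<dots> = (\<integral>\<^sup>+x. ennreal (gauss_density n (zero_extend n x)) * f (zero_extend n x) \<partial>?P)"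
    unfolding gauss_PiM_eq_density w by (rule nn_integral_density[OF meas[OF gd] meas[OF f]])
  also have "\<dots> = (\<integral>\<^sup>+x. ennreal (gauss_density n x) * f x \<partial>lebesgue_Rn n)"
    by (rule nn_integral_lebesgue_Rn[symmetric]) measurable
  finally show ?thesis .
qed

lemma AE_gauss_Rn_nonzero:
  assumes "1 \<le> n"
  shows "AE x in gauss_Rn n. enorm n x \<noteq> 0"
proof -
  let ?Z = "{x. enorm n x = 0}"
  have Z [measurable]: "?Z \<in> sets borel"
    by measurable
  have B: "{x. \<forall>i<n. 0 \<le> x i \<and> x i \<le> (0::real)} \<in> sets borel"
    by measurable
  have "emeasure (lebesgue_Rn n) ?Z \<le> emeasure (lebesgue_Rn n) {x. \<forall>i<n. 0 \<le> x i \<and> x i \<le> 0}"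
  proof (rule emeasure_mono)
    have "x i = 0" if "enorm n x = 0" "i < n" for x i
      using abs_coordinate_le_enorm[OF that(2), of x] that(1) by simp
    then show "?Z \<subseteq> {x. \<forall>i<n. 0 \<le> x i \<and> x i \<le> 0}"
      by (intro subsetI CollectI allI impI) (drule CollectD, force)
  qed (use B in simp)
  also have "\<dots> = 0"
    using assms by (subst emeasure_lebesgue_Rn_box) (auto simp: power_0_left)
  finally have "?Z \<in> null_sets (lebesgue_Rn n)"
    using Z by (simp add: null_sets_def)
  then have "AE x in lebesgue_Rn n. x \<notin> ?Z"
    by (rule AE_not_in)
  then have "AE x in lebesgue_Rn n. ennreal (gauss_density n x) * indicator ?Z x = 0"
    by eventually_elim simp
  then have "(\<integral>\<^sup>+x. ennreal (gauss_density n x) * indicator ?Z x \<partial>lebesgue_Rn n) = (\<integral>\<^sup>+x. 0 \<partial>lebesgue_Rn n)"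
    by (rule nn_integral_cong_AE)
  then have "(\<integral>\<^sup>+x. indicator ?Z x \<partial>gauss_Rn n) = 0"
    by (subst nn_integral_gauss_Rn) simp_all
  then have "?Z \<in> null_sets (gauss_Rn n)"
    using Z by (simp add: null_sets_def)
  from AE_not_in[OF this] show ?thesis
    by simp
qed

text \<open>The density depends on the norm only, and Lebesgue measure is rotation invariant.\<close>

lemma distr_gauss_Rn_rotate:
  assumes A: "orthogonal_mat n A"
  shows "distr (gauss_Rn n) borel (mat_apply n A) = gauss_Rn n"
proof (rule measure_eqI)
  fix B assume "B \<in> sets (distr (gauss_Rn n) borel (mat_apply n A))"
  then have B [measurable]: "B \<in> sets borel"
    by simp
  have eq: "gauss_density n (mat_apply n A x) = gauss_density n x" for x
    by (simp add: gauss_density_def orthogonal_mat_dot[OF A])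
  have M: "mat_apply n A \<in> measurable (gauss_Rn n) borel"
    using measurable_mat_apply[of n A] measurable_cong_sets[OF sets_gauss_Rn refl, of n borel] by blast
  have "emeasure (distr (gauss_Rn n) borel (mat_apply n A)) B
      = (\<integral>\<^sup>+x. indicator B (mat_apply n A x) \<partial>gauss_Rn n)"
    using nn_integral_distr[OF M, of "indicator B"] by simp
  also have "\<dots> = (\<integral>\<^sup>+x. ennreal (gauss_density n (mat_apply n A x)) * indicator B (mat_apply n A x) \<partial>lebesgue_Rn n)"
    by (simp add: nn_integral_gauss_Rn eq)
  also have "\<dots> = (\<integral>\<^sup>+x. ennreal (gauss_density n x) * indicator B x \<partial>lebesgue_Rn n)"
    by (rule nn_integral_lebesgue_Rn_rotate[OF _ A]) measurable
  also have "\<dots> = emeasure (gauss_Rn n) B"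
    by (simp add: nn_integral_gauss_Rn[symmetric])
  finally show "emeasure (distr (gauss_Rn n) borel (mat_apply n A)) B = emeasure (gauss_Rn n) B" .
qed simp

text \<open>The vectors of norm zero, which form a Gaussian null set, are sent to the first basis vector,
  so that all values lie on the sphere.\<close>

definition normalize_vec :: "nat \<Rightarrow> (nat \<Rightarrow> real) \<Rightarrow> (nat \<Rightarrow> real)"
  where "normalize_vec n x = (\<lambda>i. if enorm n x = 0 then (if i = 0 then 1 else 0)
    else if i < n then x i / enorm n x else 0)"

lemma normalize_vec_in_sphere:
  assumes "1 \<le> n"
  shows "normalize_vec n x \<in> unit_sphere n"
proof (cases "enorm n x = 0")
  case True
  have "dot n (normalize_vec n x) (normalize_vec n x) = (\<Sum>i<n. if i = 0 then 1 else 0)"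
    unfolding dot_def using True by (intro sum.cong) (auto simp: normalize_vec_def)
  also have "\<dots> = 1"
    using assms by (subst sum.delta) auto
  finally show ?thesis
    using assms True by (simp add: unit_sphere_def enorm_eq_sqrt_dot) (simp add: in_Rn normalize_vec_def)
next
  case False
  have "enorm n (normalize_vec n x) = enorm n (\<lambda>i. (1 / enorm n x) * x i)"
    using False by (intro enorm_cong) (simp add: normalize_vec_def)
  also have "\<dots> = 1"
    using False enorm_nonneg[of n x] by (subst enorm_scale) simp
  finally show ?thesis
    using False by (auto simp: unit_sphere_def in_Rn normalize_vec_def)
qed

lemma measurable_normalize_vec: "normalize_vec n \<in> borel_measurable borel"
proof (rule measurable_coordinatewise_then_product)
  fix i
  show "(\<lambda>x. normalize_vec n x i) \<in> borel_measurable borel"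
    by (cases "i < n") (auto simp: normalize_vec_def)
qed

lemma mat_apply_normalize_vec:
  assumes A: "orthogonal_mat n A" and x: "enorm n x \<noteq> 0"
  shows "mat_apply n A (normalize_vec n x) = normalize_vec n (mat_apply n A x)"
proof (rule Rn_eqI[of _ n])
  fix i assume "i < n"
  have "mat_apply n A (normalize_vec n x) = mat_apply n A (\<lambda>i. (1 / enorm n x) * x i)"
    using x by (intro mat_apply_cong) (simp add: normalize_vec_def)
  then show "mat_apply n A (normalize_vec n x) i = normalize_vec n (mat_apply n A x) i"
    using x \<open>i < n\<close> unfolding mat_apply_scale
    by (simp add: normalize_vec_def orthogonal_mat_enorm[OF A])
qed (use x mat_apply_in_Rn in \<open>simp_all add: in_Rn normalize_vec_def orthogonal_mat_enorm[OF A]\<close>)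

definition gauss_sphere :: "nat \<Rightarrow> (nat \<Rightarrow> real) measure"
  where "gauss_sphere n = distr (gauss_Rn n) (restrict_space borel (unit_sphere n)) (normalize_vec n)"

lemma measurable_normalize_vec_sphere:
  assumes "1 \<le> n"
  shows "normalize_vec n \<in> measurable (gauss_Rn n) (restrict_space borel (unit_sphere n))"
proof -
  have "normalize_vec n \<in> measurable (gauss_Rn n) borel"
    using measurable_normalize_vec[of n] measurable_cong_sets[OF sets_gauss_Rn refl, of n borel] by blast
  then show ?thesis
    using normalize_vec_in_sphere[OF assms] by (intro measurable_restrict_space2) auto
qed

text \<open>Normalization commutes with rotations, off the null set of vectors of norm zero.\<close>

lemma rotation_invariant_gauss_sphere:
  assumes n: "1 \<le> n"
  shows "rotation_invariant_prob n (gauss_sphere n)"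
  unfolding rotation_invariant_prob_def
proof (intro conjI allI impI)
  let ?S = "restrict_space borel (unit_sphere n)"
  show sets: "sets (gauss_sphere n) = sets ?S"
    by (simp add: gauss_sphere_def)
  interpret prob_space "gauss_Rn n" by (rule prob_space_gauss_Rn)
  note N = measurable_normalize_vec_sphere[OF n]
  show "prob_space (gauss_sphere n)"
    unfolding gauss_sphere_def by (rule prob_space_distr[OF N])
  fix A assume A: "orthogonal_mat n A"
  have MS: "mat_apply n A \<in> measurable ?S ?S"
    using orthogonal_mat_unit_sphere[OF A]
    by (intro measurable_restrict_space2 measurable_restrict_space1 measurable_mat_apply)
      (auto simp: space_restrict_space)
  have MG: "mat_apply n A \<in> measurable (gauss_Rn n) borel"
    using measurable_mat_apply[of n A] measurable_cong_sets[OF sets_gauss_Rn refl, of n borel] by blast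
  have NB: "normalize_vec n \<in> measurable borel ?S"
    using N measurable_cong_sets[OF sets_gauss_Rn refl, of n ?S] by blast
  have "distr (gauss_sphere n) (gauss_sphere n) (mat_apply n A) = distr (gauss_sphere n) ?S (mat_apply n A)"
    by (rule distr_cong) (simp_all add: sets)
  also have "\<dots> = distr (gauss_Rn n) ?S (\<lambda>x. mat_apply n A (normalize_vec n x))"
    unfolding gauss_sphere_def by (simp add: distr_distr[OF MS N] comp_def)
  also have "\<dots> = distr (gauss_Rn n) ?S (\<lambda>x. normalize_vec n (mat_apply n A x))"
    using AE_gauss_Rn_nonzero[OF n] measurable_compose[OF N MS] measurable_compose[OF MG NB]
    by (intro distr_cong_AE refl) (auto elim!: AE_mp simp: mat_apply_normalize_vec[OF A])
  also have "\<dots> = distr (distr (gauss_Rn n) borel (mat_apply n A)) ?S (normalize_vec n)"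
    by (simp add: distr_distr[OF NB MG] comp_def)
  also have "\<dots> = gauss_sphere n"
    by (simp add: distr_gauss_Rn_rotate[OF A] gauss_sphere_def)
  finally show "distr (gauss_sphere n) (gauss_sphere n) (mat_apply n A) = gauss_sphere n" .
qed

theorem sphere_measure_eq_gauss_sphere:
  assumes "1 \<le> n"
  shows "sphere_measure n = gauss_sphere n"
  unfolding sphere_measure_def
  using rotation_invariant_gauss_sphere[OF assms] rotation_invariant_prob_unique
  by (intro the_equality) auto

section \<open>A triangular system in the polar of a body in John's position\<close>

definition polar :: "nat \<Rightarrow> (nat \<Rightarrow> real) set \<Rightarrow> (nat \<Rightarrow> real) set"
  where "polar n K = {y \<in> Rn n. \<forall>z\<in>K. dot n y z \<le> 1}"

text \<open>The separating functional is the direction from the nearest point \<open>z\<^sub>0\<close> of \<open>K\<close> to \<open>x\<close>.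
  Since \<open>K\<close> contains the unit ball, it is positive at \<open>z\<^sub>0\<close> and can be normalized there.\<close>

lemma polar_separation:
  assumes K: "ball_body n K" and x: "x \<in> Rn n" "x \<notin> K"
  shows "\<exists>y\<in>polar n K. 1 < dot n y x"
proof -
  have "continuous_on K (\<lambda>z. enorm n (\<lambda>i. x i - z i))"
    by (intro continuous_on_enorm continuous_on_coordinatewise_then_product continuous_on_diff
        continuous_on_const continuous_on_coordinate)
  then obtain z0 where z0: "z0 \<in> K"
    and min: "\<And>z. z \<in> K \<Longrightarrow> enorm n (\<lambda>i. x i - z0 i) \<le> enorm n (\<lambda>i. x i - z i)"
    using continuous_attains_inf[OF ball_bodyD(1)[OF K]] ball_body_zero[OF K] by blast
  define v where "v = (\<lambda>i. x i - z0 i)"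
  have vR: "v \<in> Rn n"
    using x z0 ball_bodyD(2)[OF K] by (auto simp: v_def in_Rn)
  have "v \<noteq> (\<lambda>_. 0)"
  proof
    assume "v = (\<lambda>_. 0)"
    then have "x i - z0 i = 0" for i
      unfolding v_def by (rule fun_cong)
    then have "x = z0"
      by (intro ext) simp
    then show False
      using x z0 by simp
  qed
  then have vpos: "0 < enorm n v"
    using enorm_eq_0[OF vR] enorm_nonneg[of n v] by simp
  have var: "dot n v z \<le> dot n v z0" if z: "z \<in> K" for z
  proof (rule ccontr)
    define h where "h = (\<lambda>i. z i - z0 i)"
    define a where "a = dot n v h"
    define b where "b = dot n h h"
    assume "\<not> dot n v z \<le> dot n v z0"
    then have a: "0 < a"
      by (simp add: a_def h_def dot_diff_right)
    have b: "0 \<le> b"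
      by (simp add: b_def dot_nonneg)
    \<comment> \<open>moving from \<open>z\<^sub>0\<close> towards \<open>z\<close> by the fraction \<open>l\<close> changes the squared distance to \<open>x\<close>
      by \<open>- 2 l a + l\<^sup>2 b\<close>, which is negative for small \<open>l\<close>\<close>
    define l where "l = min 1 (a / (b + 1))"
    have l: "0 < l" "l \<le> 1" "l * (b + 1) \<le> a"
    proof -
      have "l * (b + 1) \<le> a / (b + 1) * (b + 1)"
        unfolding l_def using b by (intro mult_right_mono) auto
      then show "l * (b + 1) \<le> a"
        using b by simp
    qed (use a b in \<open>auto simp: l_def\<close>)
    have "(\<lambda>i. (1 - l) * z0 i + l * z i) \<in> K"
      using l by (intro ball_bodyD(4)[OF K z0 z]) auto
    from min[OF this] have "enorm n v \<le> enorm n (\<lambda>i. v i - l * h i)"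
      by (simp add: v_def h_def algebra_simps)
    then have "dot n v v \<le> dot n (\<lambda>i. v i - l * h i) (\<lambda>i. v i - l * h i)"
      by (simp add: enorm_eq_sqrt_dot)
    also have "\<dots> = dot n v v - 2 * l * a + l * (l * b)"
      by (simp add: dot_diff_left dot_diff_right dot_scale_left dot_scale_right a_def b_def
          dot_commute[of n h v] algebra_simps)
    finally have "l * (2 * a) \<le> l * (l * b)"
      by simp
    then have "2 * a \<le> l * b"
      using l by simp
    also have "\<dots> \<le> l * (b + 1)"
      using l by (simp add: algebra_simps)
    finally show False
      using l a by linarith
  qed
  define c where "c = dot n v z0"
  have c: "enorm n v \<le> c"
  proof -
    let ?u = "\<lambda>i. (1 / enorm n v) * v i"
    have "enorm n ?u = 1"
      using vpos by (subst enorm_scale) simp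
    then have "?u \<in> unit_ball n"
      using vR by (auto simp: unit_ball_def in_Rn)
    then have "dot n v ?u \<le> c"
      using var ball_bodyD(3)[OF K] by (auto simp: c_def)
    moreover have "dot n v ?u = enorm n v"
      using vpos by (subst dot_scale_right, subst enorm_sq[symmetric]) (simp add: power2_eq_square)
    ultimately show ?thesis by simp
  qed
  then have cpos: "0 < c"
    using vpos by simp
  let ?y = "\<lambda>i. (1 / c) * v i"
  have "dot n ?y z \<le> 1" if "z \<in> K" for z
    using var[OF that] cpos by (subst dot_scale_left) (simp add: c_def)
  then have "?y \<in> polar n K"
    using vR by (auto simp: polar_def in_Rn)
  moreover have "dot n v x = c + (enorm n v)\<^sup>2"
    by (simp add: enorm_sq c_def) (simp add: v_def dot_diff_left dot_diff_right)
  then have "1 < dot n ?y x"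
    using cpos vpos by (subst dot_scale_left) (simp add: field_simps)
  ultimately show ?thesis
    by blast
qed

lemma polar_dot_le_1:
  assumes K: "ball_body n K" and y: "y \<in> polar n K"
  shows "dot n y y \<le> 1"
proof (cases "enorm n y = 0")
  case True
  then show ?thesis
    by (simp add: enorm_sq[symmetric])
next
  case False
  let ?u = "\<lambda>i. (1 / enorm n y) * y i"
  have "enorm n ?u = 1"
    using False enorm_nonneg[of n y] by (subst enorm_scale) simp
  then have "?u \<in> unit_ball n"
    using y by (auto simp: unit_ball_def in_Rn polar_def)
  then have "dot n y ?u \<le> 1"
    using y ball_bodyD(3)[OF K] by (auto simp: polar_def)
  moreover have "dot n y ?u = enorm n y"
    using False by (subst dot_scale_right, subst enorm_sq[symmetric]) (simp add: power2_eq_square)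
  ultimately show ?thesis
    by (simp add: enorm_le_1_iff)
qed

definition diag_mat :: "(nat \<Rightarrow> real) \<Rightarrow> nat \<Rightarrow> nat \<Rightarrow> real"
  where "diag_mat d = (\<lambda>i j. if i = j then d i else 0)"

lemma mat_apply_diag_mat: "mat_apply n (diag_mat d) x = (\<lambda>i. if i < n then d i * x i else 0)"
  by (auto simp: mat_apply_def diag_mat_def if_distrib[of "\<lambda>c. c * _"] cong: if_cong)

lemma continuous_on_mat_apply: "continuous_on S (mat_apply n A)"
proof (rule continuous_on_coordinatewise_then_product)
  fix i
  show "continuous_on S (\<lambda>x. mat_apply n A x i)"
    by (cases "i < n") (auto simp: mat_apply_def intro!: continuous_on_sum continuous_on_mult continuous_on_coordinate)
qed

lemma vol_unit_ball_pos: "0 < vol n (unit_ball n)"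
proof -
  have "AE x in lebesgue_Rn n. x \<in> unit_ball n \<longleftrightarrow> x \<in> {x. enorm n x \<le> 1}"
    using AE_lebesgue_Rn by eventually_elim (simp add: unit_ball_def)
  then have "emeasure (lebesgue_Rn n) (unit_ball n) = emeasure (lebesgue_Rn n) {x. enorm n x \<le> 1}"
    by (intro emeasure_eq_AE) measurable
  then show ?thesis
    using emeasure_unit_ball[of n] zero_less_measure_iff
    by (simp add: vol_def measure_def enn2real_positive_iff less_top zero_less_iff_neq_zero)
qed

lemma ellipsoid_rotated_diagonal:
  assumes Q: "orthogonal_mat n Q" and d: "\<And>i. i < n \<Longrightarrow> 0 < d i"
  defines "T \<equiv> \<lambda>x. mat_apply n (transpose_mat Q) (mat_apply n (diag_mat d) x)"
  shows "ellipsoid n (T ` unit_ball n)"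
    and "vol n (T ` unit_ball n) = (\<Prod>i<n. d i) * vol n (unit_ball n)"
proof -
  let ?A = "mat_mult n (transpose_mat Q) (diag_mat d)"
  let ?L = "lebesgue_Rn n"
  have T: "T x = mat_apply n ?A x" for x
    by (simp add: T_def mat_apply_mat_mult)
  define T' where "T' x = mat_apply n (diag_mat (\<lambda>i. 1 / d i)) (mat_apply n Q x)" for x
  have inv1: "T' (T x) = x" if "x \<in> Rn n" for x
  proof (rule Rn_eqI[of _ n])
    fix i assume "i < n"
    have "mat_apply n Q (T x) = mat_apply n (diag_mat d) x"
      unfolding T_def by (rule orthogonal_mat_right_inverse[OF Q]) simp
    then show "T' (T x) i = x i"
      using d[of i] \<open>i < n\<close> by (simp add: T'_def mat_apply_diag_mat)
  qed (use that in \<open>simp_all add: T'_def\<close>)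
  have inv2: "T (T' x) = x" if "x \<in> Rn n" for x
  proof -
    have "mat_apply n (diag_mat d) (mat_apply n (diag_mat (\<lambda>i. 1 / d i)) z) = z" if "z \<in> Rn n" for z
    proof (rule Rn_eqI[of _ n])
      fix i assume "i < n"
      then show "mat_apply n (diag_mat d) (mat_apply n (diag_mat (\<lambda>i. 1 / d i)) z) i = z i"
        using d[of i] by (simp add: mat_apply_diag_mat)
    qed (use that in simp_all)
    then show ?thesis
      by (simp add: T_def T'_def orthogonal_mat_left_inverse[OF Q that])
  qed
  have "bij_betw T (Rn n) (Rn n)"
    by (rule bij_betw_byWitness[where f' = T']) (auto simp: inv1 inv2, simp_all add: T_def T'_def)
  then have "bij_betw (mat_apply n ?A) (Rn n) (Rn n)"
    by (simp add: T[abs_def])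
  moreover have "T ` unit_ball n = (\<lambda>x i. 0 + mat_apply n ?A x i) ` unit_ball n"
    by (simp add: T)
  moreover have "(\<lambda>_. 0) \<in> Rn n"
    by (simp add: in_Rn)
  ultimately show "ellipsoid n (T ` unit_ball n)"
    unfolding ellipsoid_def by (intro bexI[of _ "\<lambda>_. 0"] exI[of _ ?A] conjI)
  have "compact (T ` unit_ball n)"
    unfolding T[abs_def] by (intro compact_continuous_image continuous_on_mat_apply compact_unit_ball)
  then have meas [measurable]: "T ` unit_ball n \<in> sets borel"
    by (rule compact_sets_borel)
  have "emeasure ?L (T ` unit_ball n) = (\<integral>\<^sup>+x. indicator (T ` unit_ball n) x \<partial>?L)"
    by simp
  also have "\<dots> = (\<integral>\<^sup>+x. indicator (T ` unit_ball n) (mat_apply n (transpose_mat Q) x) \<partial>?L)"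
    by (rule nn_integral_lebesgue_Rn_rotate[OF _ orthogonal_mat_transp[OF Q], symmetric]) measurable
  also have "\<dots> = ennreal (\<Prod>i<n. \<bar>d i\<bar>) * (\<integral>\<^sup>+x. indicator (T ` unit_ball n)
      (mat_apply n (transpose_mat Q) (\<lambda>i. if i < n then 0 + d i * x i else 0)) \<partial>?L)"
    using d[THEN less_imp_neq, THEN not_sym]
    by (intro nn_integral_lebesgue_Rn_affine measurable_compose[OF measurable_mat_apply]) auto
  also have "(\<integral>\<^sup>+x. indicator (T ` unit_ball n)
      (mat_apply n (transpose_mat Q) (\<lambda>i. if i < n then 0 + d i * x i else 0)) \<partial>?L)
      = (\<integral>\<^sup>+x. indicator (unit_ball n) x \<partial>?L)"
  proof (rule nn_integral_lebesgue_Rn_cong)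
    fix x assume x: "x \<in> Rn n"
    have "T x \<in> T ` unit_ball n \<longleftrightarrow> x \<in> unit_ball n"
    proof
      assume "T x \<in> T ` unit_ball n"
      then obtain z where z: "z \<in> unit_ball n" "T x = T z"
        by blast
      then have "z \<in> Rn n"
        by (simp add: unit_ball_def)
      then have "x = z"
        by (rule inv1[OF x, unfolded z(2), symmetric, THEN trans, OF inv1])
      then show "x \<in> unit_ball n"
        using z by simp
    qed simp
    moreover have "mat_apply n (transpose_mat Q) (\<lambda>i. if i < n then 0 + d i * x i else 0) = T x"
      by (simp add: T_def mat_apply_diag_mat cong: if_cong)
    ultimately show "indicator (T ` unit_ball n) (mat_apply n (transpose_mat Q)
        (\<lambda>i. if i < n then 0 + d i * x i else 0)) = (indicator (unit_ball n) x :: ennreal)"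
      by (simp add: indicator_def)
  qed
  finally have "emeasure ?L (T ` unit_ball n) = ennreal (\<Prod>i<n. \<bar>d i\<bar>) * emeasure ?L (unit_ball n)"
    by simp
  moreover have "(\<Prod>i<n. \<bar>d i\<bar>) = (\<Prod>i<n. d i)"
    using d by (intro prod.cong) (auto simp: abs_of_pos)
  moreover have "0 \<le> (\<Prod>i<n. d i)"
    using d by (intro prod_nonneg) (auto simp: less_imp_le)
  ultimately show "vol n (T ` unit_ball n) = (\<Prod>i<n. d i) * vol n (unit_ball n)"
    by (simp add: vol_def measure_def enn2real_mult)
qed

text \<open>
  Shrink the ball by the factor \<open>e\<close> in the \<open>k\<close> directions that \<open>Q\<close> maps to the first \<open>k\<close> axes,
  and stretch the other directions enough to gain volume. By the maximality of the ball the
  ellipsoid leaves \<open>K\<close>, so some functional of the polar exceeds 1 on it. The inequality is the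
  resulting lower bound for the squared norm of the functional in the stretched metric. The polar lies
  in the unit ball, so this functional is nearly orthogonal to the \<open>k\<close> directions.
\<close>

lemma polar_functional_off_subspace:
  assumes K: "ball_body n K" and J: "johns_position n K"
    and Q: "orthogonal_mat n Q" and k: "2 * k < n"
  shows "\<exists>y\<in>polar n K. 1 < exp (- 2) * (\<Sum>i<k. (mat_apply n Q y i)\<^sup>2)
    + exp (4 * (real k + 1) / real n) * (\<Sum>i\<in>{k..<n}. (mat_apply n Q y i)\<^sup>2)"
proof -
  \<comment> \<open>\<open>b\<^sup>n\<^sup>-\<^sup>k > e\<^sup>k\<close> since \<open>2 (n - k) > n\<close>; the summand 1 makes it strict also for \<open>k = 0\<close>\<close>
  define b where "b = exp (2 * (real k + 1) / real n)"
  define d where "d i = (if i < k then exp (- 1) else b)" for i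
  define T where "T x = mat_apply n (transpose_mat Q) (mat_apply n (diag_mat d) x)" for x
  have d: "0 < d i" for i
    by (simp add: d_def b_def)
  note ell = ellipsoid_rotated_diagonal[OF Q, of d, OF d, folded T_def]
  have split: "{..<n} = {..<k} \<union> {k..<n}" "{..<k} \<inter> {k..<n} = {}"
    using k by auto
  have "(\<Prod>i<n. d i) = (\<Prod>i<k. d i) * (\<Prod>i\<in>{k..<n}. d i)"
    unfolding split(1) by (rule prod.union_disjoint) auto
  also have "\<dots> = exp (- 1) ^ k * b ^ (n - k)"
    by (simp add: d_def)
  also have "\<dots> = exp (- real k + real (n - k) * (2 * (real k + 1) / real n))"
    unfolding b_def by (simp add: exp_of_nat_mult[symmetric] exp_add[symmetric])
  also have "\<dots> > 1"
  proof -
    have "real n * (real k + 1) < (2 * real (n - k)) * (real k + 1)"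
      using k by (intro mult_strict_right_mono) auto
    then have "real k + 1 < real (n - k) * (2 * (real k + 1) / real n)"
      using k by (simp add: field_simps)
    then have "0 < - real k + real (n - k) * (2 * (real k + 1) / real n)"
      by linarith
    then show ?thesis
      by (simp only: one_less_exp_iff)
  qed
  finally have "1 * vol n (unit_ball n) < (\<Prod>i<n. d i) * vol n (unit_ball n)"
    by (intro mult_strict_right_mono vol_unit_ball_pos)
  then have "vol n (unit_ball n) < vol n (T ` unit_ball n)"
    by (simp add: ell(2))
  then have "\<not> T ` unit_ball n \<subseteq> K"
    using J ell(1) by (auto simp: johns_position_def not_le[symmetric])
  then obtain u where u: "u \<in> unit_ball n" "T u \<notin> K"
    by blast
  obtain y where y: "y \<in> polar n K" "1 < dot n y (T u)"
    using polar_separation[OF K _ u(2)] by (auto simp: T_def)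
  let ?w = "mat_apply n Q y"
  let ?dw = "\<lambda>i. d i * ?w i"
  have "dot n y (T u) = dot n ?w (mat_apply n (diag_mat d) u)"
    unfolding T_def by (subst dot_mat_apply[of n Q y]) simp
  also have "\<dots> = dot n ?dw u"
    by (simp add: dot_def mat_apply_diag_mat mult_ac)
  also have "\<dots> \<le> enorm n ?dw * enorm n u"
    by (rule dot_le_enorm)
  also have "\<dots> \<le> enorm n ?dw * 1"
    using u by (intro mult_left_mono enorm_nonneg) (auto simp: unit_ball_def)
  finally have "1 < enorm n ?dw"
    using y by simp
  then have "1 < dot n ?dw ?dw"
    by (simp add: enorm_eq_sqrt_dot)
  also have "dot n ?dw ?dw = (\<Sum>i<k. (d i * ?w i)\<^sup>2) + (\<Sum>i\<in>{k..<n}. (d i * ?w i)\<^sup>2)"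
    unfolding dot_def split(1) power2_eq_square by (rule sum.union_disjoint) auto
  also have "(\<Sum>i<k. (d i * ?w i)\<^sup>2) = exp (- 2) * (\<Sum>i<k. (?w i)\<^sup>2)"
    unfolding sum_distrib_left
    by (intro sum.cong) (auto simp: d_def power_mult_distrib power2_eq_square[of "exp _"] exp_add[symmetric])
  also have "(\<Sum>i\<in>{k..<n}. (d i * ?w i)\<^sup>2) = exp (4 * (real k + 1) / real n) * (\<Sum>i\<in>{k..<n}. (?w i)\<^sup>2)"
  proof -
    have "b\<^sup>2 = exp (4 * (real k + 1) / real n)"
      by (simp add: b_def power2_eq_square exp_add[symmetric] add_divide_distrib[symmetric])
    then show ?thesis
      unfolding sum_distrib_left by (intro sum.cong) (auto simp: d_def power_mult_distrib)
  qed
  finally show ?thesis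
    using y by blast
qed

text \<open>Here \<open>S\<close> and \<open>R\<close> stand for the squared norms of a functional inside the span of the \<open>k\<close>
  directions and orthogonal to it. If \<open>m\<close> is small compared with \<open>n\<close>, the stretching factor is
  \<open>1 + O(m / n)\<close>, while \<open>S\<close> is damped by a constant factor; so \<open>S\<close> has to be \<open>O(m / n)\<close>. The alternative
  \<open>m = 1\<close> serves the small dimensions.\<close>

lemma near_orthogonality_bounds:
  fixes S R :: real
  assumes n: "2 \<le> n" and k: "k < m" and m: "m = 1 \<or> 22 * m \<le> n"
    and S0: "0 \<le> S" "k = 0 \<Longrightarrow> S = 0" and R0: "0 \<le> R" and SR: "S + R \<le> 1"
    and ineq: "1 < exp (- 2) * S + exp (4 * (real k + 1) / real n) * R"
  shows "S \<le> 11 * real m / real n" "1 / 9 \<le> R"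
proof -
  have e1: "exp (1::real) \<le> 3"
    by (rule exp_le)
  have e2: "exp (2::real) = (exp 1)\<^sup>2"
    by (simp add: power2_eq_square exp_add[symmetric])
  have e2_le: "exp (2::real) \<le> 9"
    unfolding e2 using power_mono[OF e1, of 2] by simp
  have "(2::real)\<^sup>2 \<le> (exp 1)\<^sup>2"
    using exp_ge_add_one_self[of 1] by (intro power_mono) auto
  then have em2: "exp (- 2) \<le> (1 / 4 :: real)"
    unfolding exp_minus e2[symmetric] by (simp add: field_simps)
  have "S \<le> 11 * real m / real n \<and> 1 / 9 \<le> R"
  proof (cases "m = 1")
    case True
    then have "k = 0" "S = 0"
      using k S0 by auto
    have "4 / real n \<le> 2"
      using n by (simp add: field_simps)
    then have "exp (4 / real n) \<le> exp 2"
      by (simp only: exp_le_cancel_iff)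
    also note e2_le
    finally have "exp (4 / real n) * R \<le> 9 * R"
      using R0 by (intro mult_right_mono) auto
    then have "1 < 9 * R"
      using ineq \<open>k = 0\<close> \<open>S = 0\<close> by simp
    then show ?thesis
      using \<open>S = 0\<close> by simp
  next
    case False
    then have mn: "22 * real m \<le> real n" "0 < real n"
      using m n by auto
    define x where "x = 4 * real m / real n"
    have x: "0 \<le> x" "x \<le> 4 / 22"
      using mn by (auto simp: x_def field_simps)
    define B where "B = exp (4 * (real k + 1) / real n)"
    have "4 * (real k + 1) / real n \<le> x"
      using k mn unfolding x_def by (intro divide_right_mono) auto
    then have "B \<le> exp x"
      by (simp add: B_def)
    also have "\<dots> \<le> 1 + x + x\<^sup>2"
      using x by (intro exp_bound) auto
    also have "x\<^sup>2 \<le> x * 1"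
      using x unfolding power2_eq_square by (intro mult_left_mono) auto
    finally have B: "B \<le> 1 + 2 * x"
      by simp
    have B1: "1 \<le> B"
      by (simp add: B_def)
    have ineq': "1 < exp (- 2) * S + B * R"
      using ineq unfolding B_def .
    have "B * R \<le> B * (1 - S)"
      using SR B1 by (intro mult_left_mono) auto
    then have "B * R \<le> B - B * S"
      by (simp add: right_diff_distrib)
    moreover have S4: "exp (- 2) * S \<le> 1 / 4 * S"
      using em2 S0 by (intro mult_right_mono) auto
    moreover have "1 * S \<le> B * S"
      using B1 S0 by (intro mult_right_mono) auto
    ultimately have "3 / 4 * S \<le> 2 * x"
      using ineq' B B1 S0 mult_right_mono[of 1 B S] mult_right_mono[of "3 / 4" "B - 1 / 4" S]
      by (simp add: left_diff_distrib)
    then have S: "S \<le> 11 * (real m / real n)"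
    proof -
      have "x = 4 * (real m / real n)" "0 \<le> real m / real n"
        by (simp_all add: x_def)
      then show ?thesis
        using \<open>3 / 4 * S \<le> 2 * x\<close> by linarith
    qed
    moreover have "11 * (real m / real n) \<le> 1 / 2"
      using mn by (simp add: field_simps)
    moreover have "B * R \<le> 2 * R"
      using B x R0 by (intro mult_right_mono) auto
    ultimately have "1 < 1 / 8 + 2 * R"
      using ineq' S4 by linarith
    then show ?thesis
      using S by simp
  qed
  then show "S \<le> 11 * real m / real n" "1 / 9 \<le> R"
    by auto
qed

text \<open>A reflection in a vector supported on the coordinates from \<open>k\<close> on clears all
  coordinates of \<open>w\<close> after the \<open>k\<close>-th and does not move vectors supported on the first \<open>k\<close> ones.\<close>

lemma reflection_clear_tail:
  assumes w: "w \<in> Rn n" and k: "k < n"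
  defines "\<rho> \<equiv> sqrt (\<Sum>i\<in>{k..<n}. (w i)\<^sup>2)"
  shows "\<exists>H. orthogonal_mat n H \<and> (\<forall>x\<in>Rn n. (\<forall>i\<ge>k. x i = 0) \<longrightarrow> mat_apply n H x = x)
    \<and> mat_apply n H w = (\<lambda>i. if i < k then w i else if i = k then \<rho> else 0)"
proof -
  define w0 where "w0 = (\<lambda>i. if i < k then w i else 0)"
  define w1 where "w1 = (\<lambda>i. if i < k then 0 else w i)"
  define z where "z = (\<lambda>i. if i = k then \<rho> else 0)"
  define H where "H = reflection n (\<lambda>i. w1 i - z i)"
  have R: "w0 \<in> Rn n" "w1 \<in> Rn n" "z \<in> Rn n"
    using w k by (auto simp: in_Rn w0_def w1_def z_def)
  have "dot n w1 w1 = (\<Sum>i\<in>{k..<n}. (w i)\<^sup>2)"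
    unfolding dot_def by (rule sum.mono_neutral_cong_right) (auto simp: w1_def power2_eq_square)
  also have "\<dots> = \<rho>\<^sup>2"
    unfolding \<rho>_def by (simp add: sum_nonneg)
  also have "\<dots> = dot n z z"
    using k by (simp add: dot_def z_def power2_eq_square if_distrib[of "\<lambda>c. c * _"] cong: if_cong)
  finally have Hw1: "mat_apply n H w1 = z"
    unfolding H_def by (rule reflection_swap[OF R(2,3)])
  have keep: "mat_apply n H x = x" if x: "x \<in> Rn n" "\<forall>i\<ge>k. x i = 0" for x
  proof -
    have "(w1 i - z i) * x i = 0" for i
      using x(2) by (cases "i < k") (auto simp: w1_def z_def)
    then have "dot n (\<lambda>i. w1 i - z i) x = 0"
      unfolding dot_def by (intro sum.neutral ballI)
    then show ?thesis
      using x(1) by (intro Rn_eqI[of _ n]) (simp_all add: H_def, simp add: mat_apply_reflection)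
  qed
  have "w = (\<lambda>i. w0 i + w1 i)"
    by (auto simp: w0_def w1_def)
  then have "mat_apply n H w = (\<lambda>i. mat_apply n H w0 i + mat_apply n H w1 i)"
    by (metis mat_apply_add)
  also have "mat_apply n H w0 = w0"
    by (rule keep) (use R in \<open>auto simp: w0_def\<close>)
  also have "(\<lambda>i. w0 i + mat_apply n H w1 i) = (\<lambda>i. if i < k then w i else if i = k then \<rho> else 0)"
    by (auto simp: Hw1 w0_def z_def)
  finally show ?thesis
    using keep orthogonal_mat_reflection[of n] unfolding H_def by blast
qed

text \<open>
  A variant of the Dvoretzky--Rogers lemma, with functionals from the polar in place of contact
  points. The next functional is nearly orthogonal to the first \<open>k\<close> coordinates, and a reflection
  that keeps the earlier functionals turns the rest of it into a multiple of the \<open>k\<close>-th basis vector.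
\<close>

lemma dvoretzky_rogers_polar:
  assumes K: "ball_body n K" and J: "johns_position n K"
    and n: "2 \<le> n" and m: "m = 1 \<or> 22 * m \<le> n"
  shows "\<exists>Q y. orthogonal_mat n Q \<and> (\<forall>i<m. y i \<in> polar n K \<and>
    (\<forall>j>i. mat_apply n Q (y i) j = 0) \<and> 1 / 3 \<le> mat_apply n Q (y i) i \<and>
    (\<Sum>j<i. (mat_apply n Q (y i) j)\<^sup>2) \<le> 11 * real m / real n)"
proof -
  let ?P = "\<lambda>k Q y. orthogonal_mat n Q \<and> (\<forall>i<k. y i \<in> polar n K \<and>
    (\<forall>j>i. mat_apply n Q (y i) j = 0) \<and> 1 / 3 \<le> mat_apply n Q (y i) i \<and>
    (\<Sum>j<i. (mat_apply n Q (y i) j)\<^sup>2) \<le> 11 * real m / real n)"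
  have "\<exists>Q y. ?P k Q y" if "k \<le> m" for k
    using that
  proof (induction k)
    case 0
    show ?case
      using orthogonal_mat_id[of n] by auto
  next
    case (Suc k)
    then obtain Q y where Q: "orthogonal_mat n Q" and y: "\<And>i. i < k \<Longrightarrow> y i \<in> polar n K"
      "\<And>i j. i < k \<Longrightarrow> i < j \<Longrightarrow> mat_apply n Q (y i) j = 0"
      "\<And>i. i < k \<Longrightarrow> 1 / 3 \<le> mat_apply n Q (y i) i"
      "\<And>i. i < k \<Longrightarrow> (\<Sum>j<i. (mat_apply n Q (y i) j)\<^sup>2) \<le> 11 * real m / real n"
      by (auto dest!: Suc_leD)
    have k: "k < m" "2 * k < n"
      using Suc.prems m n by auto
    obtain u where u: "u \<in> polar n K" "1 < exp (- 2) * (\<Sum>i<k. (mat_apply n Q u i)\<^sup>2)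
      + exp (4 * (real k + 1) / real n) * (\<Sum>i\<in>{k..<n}. (mat_apply n Q u i)\<^sup>2)"
      using polar_functional_off_subspace[OF K J Q k(2)] by blast
    define w where "w = mat_apply n Q u"
    define S where "S = (\<Sum>i<k. (w i)\<^sup>2)"
    define R where "R = (\<Sum>i\<in>{k..<n}. (w i)\<^sup>2)"
    have "S + R = dot n w w"
    proof -
      have "{..<n} = {..<k} \<union> {k..<n}"
        using k by auto
      then show ?thesis
        unfolding dot_def S_def R_def power2_eq_square
        by (simp only: sum.union_disjoint[symmetric] finite_lessThan finite_atLeastLessThan
            ivl_disj_int_one)
    qed
    also have "\<dots> \<le> 1"
      unfolding w_def orthogonal_mat_dot[OF Q] by (rule polar_dot_le_1[OF K u(1)])
    finally have SR: "S \<le> 11 * real m / real n" "1 / 9 \<le> R"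
      using u(2) by (intro near_orthogonality_bounds[OF n k(1) m];
          auto simp: S_def R_def w_def intro!: sum_nonneg)+
    obtain H where H: "orthogonal_mat n H"
      "\<And>x. x \<in> Rn n \<Longrightarrow> \<forall>i\<ge>k. x i = 0 \<Longrightarrow> mat_apply n H x = x"
      "mat_apply n H w = (\<lambda>i. if i < k then w i else if i = k then sqrt R else 0)"
      using reflection_clear_tail[of w n k] k unfolding R_def w_def by auto
    let ?Q = "mat_mult n H Q"
    let ?y = "y(k := u)"
    have old: "mat_apply n ?Q (y i) = mat_apply n Q (y i)" if "i < k" for i
      using y(2)[OF that] that by (simp add: mat_apply_mat_mult) (intro H(2), auto)
    have new: "mat_apply n ?Q u = (\<lambda>i. if i < k then w i else if i = k then sqrt R else 0)"
      by (simp add: mat_apply_mat_mult H(3) flip: w_def)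
    have "sqrt ((1 / 3)\<^sup>2) \<le> sqrt R"
      using SR(2) by (intro real_sqrt_le_mono) (simp add: power2_eq_square)
    then have diag: "1 / 3 \<le> sqrt R"
      by simp
    have "?P (Suc k) ?Q ?y"
    proof (intro conjI allI impI)
      show "orthogonal_mat n ?Q"
        by (rule orthogonal_mat_mult[OF H(1) Q])
      fix i assume i: "i < Suc k"
      show "?y i \<in> polar n K"
        using i y(1) u by (auto simp: less_Suc_eq)
      show "1 / 3 \<le> mat_apply n ?Q (?y i) i"
        using i y(3) diag by (auto simp: less_Suc_eq old new)
      show "(\<Sum>j<i. (mat_apply n ?Q (?y i) j)\<^sup>2) \<le> 11 * real m / real n"
        using i y(4) SR(1) by (auto simp: less_Suc_eq old new S_def)
      show "mat_apply n ?Q (?y i) j = 0" if "i < j" for j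
        using i y(2) that by (auto simp: less_Suc_eq old new)
    qed
    then show ?case
      by blast
  qed
  then show ?thesis
    by blast
qed

section \<open>Gaussian estimates\<close>

text \<open>On \<open>[t, t + 1]\<close> the density is at least its value at \<open>t + 1\<close>, and \<open>\<surd>(2 \<pi>) \<le> 3\<close>.\<close>

lemma emeasure_std_normal_below:
  assumes "0 \<le> t"
  shows "emeasure std_normal_distribution {..<t} \<le> ennreal (1 - exp (- (t + 1)\<^sup>2 / 2) / 3)"
proof -
  interpret N: prob_space std_normal_distribution
    by (rule prob_space_normal_density) simp
  let ?p = "exp (- (t + 1)\<^sup>2 / 2) / 3"
  have "sqrt (2 * pi) \<le> sqrt (3\<^sup>2)"
    using pi_less_4 by (intro real_sqrt_le_mono) simp
  then have s: "sqrt (2 * pi) \<le> 3"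
    by simp
  have dens: "?p \<le> std_normal_density x" if "x \<in> {t..t+1}" for x
  proof -
    have "x\<^sup>2 \<le> (t + 1)\<^sup>2"
      using that assms by (intro power_mono) auto
    then have "exp (- (t + 1)\<^sup>2 / 2) \<le> exp (- x\<^sup>2 / 2)"
      by simp
    moreover have "1 / 3 \<le> 1 / sqrt (2 * pi)"
      using s by (intro divide_left_mono) (auto intro: mult_pos_pos)
    ultimately have "1 / 3 * exp (- (t + 1)\<^sup>2 / 2) \<le> 1 / sqrt (2 * pi) * exp (- x\<^sup>2 / 2)"
      by (intro mult_mono) auto
    then show ?thesis
      by (simp add: std_normal_density_def)
  qed
  have "ennreal ?p = (\<integral>\<^sup>+x. ennreal ?p * indicator {t..t+1} x \<partial>lborel)"
    by (simp add: nn_integral_cmult)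
  also have "\<dots> \<le> (\<integral>\<^sup>+x. ennreal (std_normal_density x) * indicator {t..t+1} x \<partial>lborel)"
    using dens by (intro nn_integral_mono) (auto simp: indicator_def intro: ennreal_leI)
  also have "\<dots> = emeasure std_normal_distribution {t..t+1}"
    by (simp add: emeasure_density)
  also have "\<dots> = ennreal (N.prob {t..t+1})"
    by (rule N.emeasure_eq_measure)
  finally have p: "?p \<le> N.prob {t..t+1}"
    by (simp add: ennreal_le_iff)
  have "N.prob {..<t} + N.prob {t..t+1} = N.prob ({..<t} \<union> {t..t+1})"
    by (intro N.finite_measure_Union[symmetric]) auto
  also have "\<dots> \<le> 1"
    by (rule N.prob_le_1)
  finally have "N.prob {..<t} \<le> 1 - ?p"
    using p by simp
  then show ?thesis
    unfolding N.emeasure_eq_measure by (rule ennreal_leI)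
qed

lemma gauss_Rn_all_below:
  assumes m: "m \<le> n" and t: "0 \<le> t"
  shows "measure (gauss_Rn n) {x. \<forall>i<m. x i < t} \<le> (1 - exp (- (t + 1)\<^sup>2 / 2) / 3) ^ m"
proof -
  let ?q = "1 - exp (- (t + 1)\<^sup>2 / 2) / 3 :: real"
  let ?A = "\<lambda>i. if i < m then {..<t} else UNIV"
  interpret N: prob_space std_normal_distribution
    by (rule prob_space_normal_density) simp
  have "exp (- (t + 1)\<^sup>2 / 2) \<le> 1"
    by simp
  then have q: "0 \<le> ?q"
    by linarith
  have S: "{x. \<forall>i<m. x i < t} \<in> sets borel"
    by measurable
  have sub: "zero_extend n -` {x. \<forall>i<m. x i < t} \<inter> space (gauss_PiM n) = (\<Pi>\<^sub>E i\<in>{..<n}. ?A i)"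
  proof (rule set_eqI)
    fix x
    have "(\<forall>i<m. zero_extend n x i < t) \<longleftrightarrow> (\<forall>i<n. x i \<in> ?A i)"
      using m by (auto simp: zero_extend_def)
    then show "x \<in> zero_extend n -` {x. \<forall>i<m. x i < t} \<inter> space (gauss_PiM n)
        \<longleftrightarrow> x \<in> (\<Pi>\<^sub>E i\<in>{..<n}. ?A i)"
      by (auto simp: space_PiM PiE_iff)
  qed
  have "emeasure (gauss_Rn n) {x. \<forall>i<m. x i < t} = emeasure (gauss_PiM n) (\<Pi>\<^sub>E i\<in>{..<n}. ?A i)"
    unfolding gauss_Rn_def by (subst emeasure_distr[OF measurable_zero_extend_gauss S]) (simp only: sub)
  also have "\<dots> = (\<Prod>i<n. emeasure std_normal_distribution (?A i))"
    by (rule gauss.emeasure_PiM) auto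
  also have "\<dots> = (\<Prod>i\<in>{..<m}. emeasure std_normal_distribution {..<t})"
  proof (rule prod.mono_neutral_cong_right)
    show "\<forall>i\<in>{..<n} - {..<m}. emeasure std_normal_distribution (?A i) = 1"
      using N.emeasure_space_1 by simp
  qed (use m in auto)
  also have "\<dots> \<le> (\<Prod>i\<in>{..<m}. ennreal ?q)"
    by (intro prod_mono_ennreal emeasure_std_normal_below t)
  also have "\<dots> = ennreal (?q ^ m)"
    using q by (simp add: ennreal_power)
  finally have "emeasure (gauss_Rn n) {x. \<forall>i<m. x i < t} \<le> ennreal (?q ^ m)" .
  then show ?thesis
    unfolding measure_def using q by (intro enn2real_leI) auto
qed

lemma nn_integral_gauss_Rn_square:
  assumes i: "i < n"
  shows "(\<integral>\<^sup>+x. ennreal ((x i)\<^sup>2) \<partial>gauss_Rn n) = 1"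
proof -
  interpret N: prob_space std_normal_distribution
    by (rule prob_space_normal_density) simp
  let ?f = "\<lambda>j u::real. if j = i then ennreal (u\<^sup>2) else 1"
  have "(\<lambda>x::nat \<Rightarrow> real. ennreal ((x i)\<^sup>2)) \<in> borel_measurable borel"
    by measurable
  then have "(\<integral>\<^sup>+x. ennreal ((x i)\<^sup>2) \<partial>gauss_Rn n)
      = (\<integral>\<^sup>+x. ennreal ((zero_extend n x i)\<^sup>2) \<partial>gauss_PiM n)"
    unfolding gauss_Rn_def by (intro nn_integral_distr measurable_zero_extend_gauss) simp
  also have "\<dots> = (\<integral>\<^sup>+x. (\<Prod>j<n. ?f j (x j)) \<partial>gauss_PiM n)"
    using i by (simp add: zero_extend_def prod.delta)
  also have "\<dots> = (\<Prod>j<n. (\<integral>\<^sup>+u. ?f j u \<partial>std_normal_distribution))"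
    by (rule gauss.product_nn_integral_prod) auto
  also have "\<dots> = (\<Prod>j<n. if j = i then (\<integral>\<^sup>+u. ennreal (u\<^sup>2) \<partial>std_normal_distribution) else 1)"
    using N.emeasure_space_1 by (intro prod.cong) auto
  also have "\<dots> = (\<integral>\<^sup>+u. ennreal (u\<^sup>2) \<partial>std_normal_distribution)"
    using i by (simp add: prod.delta)
  also have "\<dots> = ennreal (\<integral>u. u\<^sup>2 \<partial>std_normal_distribution)"
    using std_normal_distribution_even_moments(2)[of 1] by (intro nn_integral_eq_integral) auto
  also have "\<dots> = 1"
    using std_normal_distribution_even_moments(1)[of 1] by simp
  finally show ?thesis .
qed

text \<open>Markov's inequality, as the expectation of the sum of squares is \<open>m\<close>.\<close>

lemma gauss_Rn_square_sum_tail: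
  assumes m: "1 \<le> m" "m \<le> n"
  shows "measure (gauss_Rn n) {x. 100 * real m < (\<Sum>i<m. (x i)\<^sup>2)} \<le> 1 / 100"
proof -
  let ?u = "\<lambda>x::nat \<Rightarrow> real. ennreal (\<Sum>i<m. (x i)\<^sup>2)"
  let ?c = "ennreal (1 / (100 * real m))"
  have u: "?u \<in> borel_measurable (gauss_Rn n)"
    by measurable
  have "emeasure (gauss_Rn n) {x. 100 * real m < (\<Sum>i<m. (x i)\<^sup>2)}
      \<le> emeasure (gauss_Rn n) {x\<in>UNIV. 1 \<le> ?c * ?u x}"
  proof (rule emeasure_mono)
    show "{x. 100 * real m < (\<Sum>i<m. (x i)\<^sup>2)} \<subseteq> {x\<in>UNIV. 1 \<le> ?c * ?u x}"
      using m by (auto simp: ennreal_mult'[symmetric] sum_nonneg field_simps simp flip: ennreal_1)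
    have "{x\<in>space (gauss_Rn n). 1 \<le> ?c * ?u x} \<in> sets (gauss_Rn n)"
      using u by measurable
    then show "{x\<in>UNIV. 1 \<le> ?c * ?u x} \<in> sets (gauss_Rn n)"
      by simp
  qed
  also have "\<dots> \<le> ?c * (\<integral>\<^sup>+x. ?u x * indicator UNIV x \<partial>gauss_Rn n)"
    using u by (intro nn_integral_Markov_inequality) auto
  also have "(\<integral>\<^sup>+x. ?u x * indicator UNIV x \<partial>gauss_Rn n) = (\<integral>\<^sup>+x. (\<Sum>i<m. ennreal ((x i)\<^sup>2)) \<partial>gauss_Rn n)"
    by (simp add: sum_ennreal)
  also have "\<dots> = (\<Sum>i<m. (\<integral>\<^sup>+x. ennreal ((x i)\<^sup>2) \<partial>gauss_Rn n))"
    by (rule nn_integral_sum) measurable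
  also have "\<dots> = ennreal (real m)"
    using m by (simp add: nn_integral_gauss_Rn_square ennreal_of_nat_eq_real_of_nat)
  also have "?c * ennreal (real m) = ennreal (1 / 100)"
    using m by (simp add: ennreal_mult'[symmetric])
  finally show ?thesis
    unfolding measure_def by (intro enn2real_leI) auto
qed

lemma gauss_Rn_good_event:
  assumes m: "1 \<le> m" "m \<le> n" and t: "0 \<le> t"
  defines "E \<equiv> {x. (\<exists>i<m. t \<le> x i) \<and> (\<Sum>i<m. (x i)\<^sup>2) \<le> 100 * real m \<and> (\<Sum>i<n. (x i)\<^sup>2) \<le> 100 * real n}"
  shows "1 - (1 - exp (- (t + 1)\<^sup>2 / 2) / 3) ^ m - 1 / 50 \<le> measure (gauss_Rn n) E"
    and "E \<in> sets borel"
proof -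
  interpret prob_space "gauss_Rn n" by (rule prob_space_gauss_Rn)
  let ?A = "{x. \<forall>i<m. x i < t}"
  let ?B = "{x. 100 * real m < (\<Sum>i<m. (x i)\<^sup>2)}"
  let ?C = "{x. 100 * real n < (\<Sum>i<n. (x i)\<^sup>2)}"
  have meas: "?A \<in> events" "?B \<in> events" "?C \<in> events"
    by (simp_all only: sets_gauss_Rn) measurable
  have eq: "E = UNIV - (?A \<union> ?B \<union> ?C)"
    by (auto simp: E_def not_le not_less)
  show "E \<in> sets borel"
    unfolding eq using meas by auto
  have "prob (?A \<union> ?B \<union> ?C) \<le> prob ?A + prob ?B + prob ?C"
    using measure_Un_le[of "?A \<union> ?B" "gauss_Rn n" ?C] measure_Un_le[of ?A "gauss_Rn n" ?B] meas by auto
  also have "\<dots> \<le> (1 - exp (- (t + 1)\<^sup>2 / 2) / 3) ^ m + 1 / 100 + 1 / 100"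
    using m t by (intro add_mono gauss_Rn_all_below gauss_Rn_square_sum_tail) auto
  finally have "prob (?A \<union> ?B \<union> ?C) \<le> (1 - exp (- (t + 1)\<^sup>2 / 2) / 3) ^ m + 1 / 50"
    by simp
  moreover have "prob E = 1 - prob (?A \<union> ?B \<union> ?C)"
    unfolding eq using prob_compl[of "?A \<union> ?B \<union> ?C"] meas by simp
  ultimately show "1 - (1 - exp (- (t + 1)\<^sup>2 / 2) / 3) ^ m - 1 / 50 \<le> measure (gauss_Rn n) E"
    by simp
qed

section \<open>The mean of the gauge over the sphere\<close>

lemma ennreal_mean_norm:
  assumes K: "ball_body n K" and n: "1 \<le> n"
  shows "ennreal (mean_norm n K) = (\<integral>\<^sup>+\<xi>. ennreal (minkowski_functional K \<xi>) \<partial>gauss_sphere n)"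
proof -
  note inv = rotation_invariant_gauss_sphere[OF n]
  interpret prob_space "gauss_sphere n"
    by (rule rotation_invariant_prob_space[OF inv])
  have sp: "0 \<le> minkowski_functional K \<xi>" "minkowski_functional K \<xi> \<le> 1"
    if "\<xi> \<in> space (gauss_sphere n)" for \<xi>
    using that minkowski_functional_attained(1)[OF K, of \<xi>] minkowski_functional_le_enorm[OF K, of \<xi>]
    by (auto simp: space_rotation_invariant_prob[OF inv] unit_sphere_def)
  have "integrable (gauss_sphere n) (minkowski_functional K)"
    using sp by (intro integrable_const_bound[of _ 1]
        measurable_rotation_invariant_prob[OF inv] measurable_minkowski_functional[OF K]) auto
  then show ?thesis
    unfolding mean_norm_def sphere_measure_eq_gauss_sphere[OF n]
    using sp by (intro nn_integral_eq_integral[symmetric]) auto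
qed

lemma triangular_functional_lower_bound:
  fixes w x :: "nat \<Rightarrow> real"
  assumes i: "i < n" "i \<le> m" and upper: "\<And>j. i < j \<Longrightarrow> w j = 0" and diag: "1 / 3 \<le> w i"
    and lower: "(\<Sum>j<i. (w j)\<^sup>2) \<le> \<eta>\<^sup>2" and \<eta>: "0 \<le> \<eta>"
    and xi: "t \<le> x i" "0 \<le> t" and xm: "(\<Sum>j<m. (x j)\<^sup>2) \<le> 100 * real m"
  shows "t / 3 - 10 * \<eta> * sqrt (real m) \<le> dot n w x"
proof -
  have "dot n w x = (\<Sum>j<Suc i. w j * x j)"
    unfolding dot_def using i upper by (intro sum.mono_neutral_right) auto
  then have split: "dot n w x = dot i w x + w i * x i"
    by (simp add: dot_def)
  have "enorm i w \<le> \<eta>"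
    unfolding enorm_eq_sqrt_dot using lower \<eta>
    by (intro real_le_lsqrt) (auto simp: dot_def power2_eq_square)
  moreover have "enorm i x \<le> 10 * sqrt (real m)"
  proof -
    have "dot i x x \<le> (\<Sum>j<m. (x j)\<^sup>2)"
      unfolding dot_def power2_eq_square using i by (intro sum_mono2) auto
    then have "sqrt (dot i x x) \<le> sqrt (100 * real m)"
      using xm by (intro real_sqrt_le_mono) simp
    then show ?thesis
      by (simp add: enorm_eq_sqrt_dot real_sqrt_mult)
  qed
  ultimately have "enorm i w * enorm i x \<le> \<eta> * (10 * sqrt (real m))"
    using \<eta> by (intro mult_mono enorm_nonneg) auto
  moreover have "- dot i w x \<le> enorm i w * enorm i x"
    using dot_le_enorm[of i "\<lambda>j. - 1 * w j" x] unfolding dot_scale_left enorm_scale by simp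
  moreover have "1 / 3 * t \<le> w i * x i"
    using diag xi by (intro mult_mono) auto
  ultimately show ?thesis
    unfolding split by (simp add: mult_ac)
qed

text \<open>
  Consider the event that a Gaussian vector has norm at most \<open>10 \<surd>n\<close>, that its first \<open>m\<close> coordinates have
  norm at most \<open>10 \<surd>m\<close>, and that one of them, the \<open>i\<close>-th say, is at least \<open>t\<close>. There the
  \<open>i\<close>-th functional is at least \<open>t / 3 - 10 \<eta> \<surd>m\<close>, so \<open>B\<close> bounds from below its value at the normalized
  vector, and the gauge dominates it. The rotation \<open>Q\<close> does not change the mean over the sphere.
\<close>

lemma mean_norm_ge:
  assumes K: "ball_body n K" and Q: "orthogonal_mat n Q" and m: "1 \<le> m" "m \<le> n"
    and y: "\<And>i. i < m \<Longrightarrow> y i \<in> polar n K"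
    and upper: "\<And>i j. i < m \<Longrightarrow> i < j \<Longrightarrow> mat_apply n Q (y i) j = 0"
    and diag: "\<And>i. i < m \<Longrightarrow> 1 / 3 \<le> mat_apply n Q (y i) i"
    and lower: "\<And>i. i < m \<Longrightarrow> (\<Sum>j<i. (mat_apply n Q (y i) j)\<^sup>2) \<le> \<eta>\<^sup>2"
    and \<eta>: "0 \<le> \<eta>" and t: "0 < t"
  defines "B \<equiv> (t / 3 - 10 * \<eta> * sqrt (real m)) / (10 * sqrt (real n))"
  assumes B: "0 \<le> B"
  shows "B * (1 - (1 - exp (- (t + 1)\<^sup>2 / 2) / 3) ^ m - 1 / 50) \<le> mean_norm n K"
proof -
  have n: "1 \<le> n"
    using m by simp
  interpret prob_space "gauss_Rn n" by (rule prob_space_gauss_Rn)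
  let ?g = "minkowski_functional K"
  let ?Qt = "mat_apply n (transpose_mat Q)"
  define E where "E = {x. (\<exists>i<m. t \<le> x i) \<and> (\<Sum>i<m. (x i)\<^sup>2) \<le> 100 * real m
    \<and> (\<Sum>i<n. (x i)\<^sup>2) \<le> 100 * real n}"
  note E = gauss_Rn_good_event[OF m less_imp_le[OF t], folded E_def]
  note inv = rotation_invariant_gauss_sphere[OF n]
  have g: "(\<lambda>x. ennreal (?g x)) \<in> borel_measurable borel"
    using measurable_minkowski_functional[OF K] by measurable
  have bound: "B \<le> ?g (?Qt (normalize_vec n x))" if x: "x \<in> E" for x
  proof -
    obtain i where i: "i < m" "t \<le> x i"
      using x by (auto simp: E_def)
    let ?w = "mat_apply n Q (y i)"
    have pos: "0 < enorm n x"
      using abs_coordinate_le_enorm[of i n x] i t m by linarith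
    have "enorm n x \<le> sqrt (100 * real n)"
      using x by (simp add: E_def enorm_eq_sqrt_dot dot_def power2_eq_square)
    then have le: "enorm n x \<le> 10 * sqrt (real n)"
      by (simp add: real_sqrt_mult)
    have num: "t / 3 - 10 * \<eta> * sqrt (real m) \<le> dot n ?w x"
      using i m x t upper[OF i(1)] diag[OF i(1)] lower[OF i(1)]
      by (intro triangular_functional_lower_bound \<eta>) (auto simp: E_def)
    have num0: "0 \<le> t / 3 - 10 * \<eta> * sqrt (real m)"
      using B m by (auto simp: B_def zero_le_divide_iff)
    have "B \<le> (t / 3 - 10 * \<eta> * sqrt (real m)) / enorm n x"
      unfolding B_def using num0 pos le m by (intro divide_left_mono) auto
    also have "\<dots> \<le> dot n ?w x / enorm n x"
      using num pos by (intro divide_right_mono) auto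
    also have "\<dots> = dot n ?w (\<lambda>j. (1 / enorm n x) * x j)"
      by (simp only: dot_scale_right) simp
    also have "\<dots> = dot n ?w (normalize_vec n x)"
      using pos by (intro dot_cong) (auto simp: normalize_vec_def)
    also have "\<dots> = dot n (y i) (?Qt (normalize_vec n x))"
      by (rule dot_mat_apply)
    also have "\<dots> \<le> ?g (?Qt (normalize_vec n x))"
      using y[OF i(1)] by (intro minkowski_functional_ge_dot[OF K]) (auto simp: polar_def)
    finally show ?thesis .
  qed
  have "ennreal (B * prob E) = (\<integral>\<^sup>+x. ennreal B * indicator E x \<partial>gauss_Rn n)"
    using E(2) B by (simp add: nn_integral_cmult emeasure_eq_measure ennreal_mult)
  also have "\<dots> \<le> (\<integral>\<^sup>+x. ennreal (?g (?Qt (normalize_vec n x))) \<partial>gauss_Rn n)"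
    using bound by (intro nn_integral_mono) (auto simp: indicator_def intro: ennreal_leI)
  also have "\<dots> = (\<integral>\<^sup>+\<xi>. ennreal (?g (?Qt \<xi>)) \<partial>gauss_sphere n)"
    unfolding gauss_sphere_def
    by (rule nn_integral_distr[OF measurable_normalize_vec_sphere[OF n], symmetric])
      (use measurable_compose[OF measurable_mat_apply g] in \<open>simp add: measurable_restrict_space1\<close>)
  also have "\<dots> = (\<integral>\<^sup>+\<xi>. ennreal (?g \<xi>) \<partial>gauss_sphere n)"
    by (rule nn_integral_rotation_sphere[OF inv g orthogonal_mat_transp[OF Q]])
  also have "\<dots> = ennreal (mean_norm n K)"
    by (rule ennreal_mean_norm[OF K n, symmetric])
  finally have "ennreal (B * prob E) \<le> ennreal (mean_norm n K)" .
  moreover have "0 \<le> mean_norm n K"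
  proof -
    have "0 \<le> ?g \<xi>" if "\<xi> \<in> space (gauss_sphere n)" for \<xi>
      using that minkowski_functional_attained(1)[OF K, of \<xi>]
      by (auto simp: space_rotation_invariant_prob[OF inv] unit_sphere_def)
    then show ?thesis
      unfolding mean_norm_def sphere_measure_eq_gauss_sphere[OF n]
      by (rule Bochner_Integration.integral_nonneg)
  qed
  ultimately have "B * prob E \<le> mean_norm n K"
    by (simp add: ennreal_le_iff)
  moreover have "B * (1 - (1 - exp (- (t + 1)\<^sup>2 / 2) / 3) ^ m - 1 / 50) \<le> B * prob E"
    using E(1) B by (intro mult_left_mono)
  ultimately show ?thesis
    by linarith
qed

text \<open>One functional suffices for a bound of order \<open>1 / \<surd>n\<close>, which settles bounded dimensions.\<close>

lemma mean_norm_ge_inverse_sqrt: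
  assumes K: "ball_body n K" and J: "johns_position n K" and n: "2 \<le> n"
  shows "1 / (1800 * sqrt (real n)) \<le> mean_norm n K"
proof -
  obtain Q y where Q: "orthogonal_mat n Q" and y: "\<And>i. i < 1 \<Longrightarrow> y i \<in> polar n K"
    "\<And>i j. i < 1 \<Longrightarrow> i < j \<Longrightarrow> mat_apply n Q (y i) j = 0"
    "\<And>i. i < 1 \<Longrightarrow> 1 / 3 \<le> mat_apply n Q (y i) i"
    using dvoretzky_rogers_polar[OF K J n, of 1] by auto
  have "exp (2::real) = (exp 1)\<^sup>2"
    by (simp add: power2_eq_square exp_add[symmetric])
  also have "\<dots> \<le> 3\<^sup>2"
    using exp_le by (intro power_mono) auto
  finally have "1 / 9 \<le> exp (- 2 :: real)"
    by (simp add: exp_minus field_simps)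
  then have p: "1 / 60 \<le> 1 - (1 - exp (- (1 + 1)\<^sup>2 / 2) / 3) ^ 1 - 1 / (50::real)"
    by simp
  let ?B = "(1 / 3 - 10 * 0 * sqrt (real 1)) / (10 * sqrt (real n))"
  have "1 / (1800 * sqrt (real n)) = ?B * (1 / 60)"
    by simp
  also have "\<dots> \<le> ?B * (1 - (1 - exp (- (1 + 1)\<^sup>2 / 2) / 3) ^ 1 - 1 / 50)"
    using p by (intro mult_left_mono) auto
  also have "\<dots> \<le> mean_norm n K"
    using n y by (intro mean_norm_ge[OF K Q, where y = y]) auto
  finally show ?thesis .
qed

text \<open>
  With \<open>m \<approx> \<surd>n\<close> functionals the threshold is \<open>t + 1 = \<surd>(ln n / 2)\<close>: then a single
  coordinate exceeds \<open>t\<close> with probability at least \<open>n powr (- 1 / 4) / 3\<close>, so that one of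
  \<open>m\<close> coordinates does so with probability at least \<open>1 / 2\<close>. The perturbation
  \<open>10 \<eta> \<surd>m\<close> with \<open>\<eta>\<^sup>2 = 11 m / n\<close> stays bounded, and it is negligible if \<open>ln n\<close> is large.
\<close>

lemma mean_norm_ge_large:
  assumes K: "ball_body n K" and J: "johns_position n K" and n: "90000 \<le> ln (real n)"
  shows "sqrt (ln (real n)) / (250 * sqrt (real n)) \<le> mean_norm n K"
proof -
  define s where "s = sqrt (ln (real n))"
  have s2: "s\<^sup>2 = ln (real n)"
    using n by (simp add: s_def)
  have "sqrt (300\<^sup>2) \<le> s"
    unfolding s_def using n by (intro real_sqrt_le_mono) simp
  then have s: "300 \<le> s"
    by simp
  have n0: "0 < real n"
    using n by (cases "n = 0") auto
  have "1 + ln (real n) \<le> exp (ln (real n))"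
    by (rule exp_ge_add_one_self)
  then have n_large: "90000 \<le> real n"
    using n n0 by simp
  then have n2: "2 \<le> n"
    by linarith
  define r where "r = sqrt (real n)"
  have "sqrt (300\<^sup>2) \<le> r"
    unfolding r_def using n_large by (intro real_sqrt_le_mono) simp
  then have r: "300 \<le> r"
    by simp
  have r2: "r * r = real n"
    by (simp add: r_def)
  define m where "m = nat \<lfloor>r\<rfloor>"
  have m: "r - 1 \<le> real m" "real m \<le> r"
    using r by (auto simp: m_def)
  have m1: "1 \<le> m"
    using m r by linarith
  have "22 * real m \<le> r * r"
    using m r by (intro mult_mono) auto
  then have m22: "22 * m \<le> n"
    unfolding r2 by linarith
  obtain Q y where Q: "orthogonal_mat n Q" and y: "\<And>i. i < m \<Longrightarrow> y i \<in> polar n K"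
    "\<And>i j. i < m \<Longrightarrow> i < j \<Longrightarrow> mat_apply n Q (y i) j = 0"
    "\<And>i. i < m \<Longrightarrow> 1 / 3 \<le> mat_apply n Q (y i) i"
    "\<And>i. i < m \<Longrightarrow> (\<Sum>j<i. (mat_apply n Q (y i) j)\<^sup>2) \<le> 11 * real m / real n"
    using dvoretzky_rogers_polar[OF K J n2, of m] m22 by auto
  define \<eta> where "\<eta> = sqrt (11 * real m / real n)"
  have \<eta>2: "\<eta>\<^sup>2 = 11 * real m / real n"
    by (simp add: \<eta>_def)
  have "\<eta> * sqrt (real m) = sqrt (11 * (real m / r)\<^sup>2)"
    unfolding \<eta>_def real_sqrt_mult[symmetric] r2[symmetric] by (simp add: power2_eq_square)
  also have "\<dots> \<le> sqrt ((34 / 10)\<^sup>2)"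
  proof (rule real_sqrt_le_mono)
    have "(real m / r)\<^sup>2 \<le> 1\<^sup>2"
      using m r by (intro power_mono) auto
    then show "11 * (real m / r)\<^sup>2 \<le> (34 / 10)\<^sup>2"
      by (simp add: power2_eq_square)
  qed
  finally have pert: "10 * \<eta> * sqrt (real m) \<le> 34"
    by simp
  define t where "t = sqrt (ln (real n) / 2) - 1"
  have "(7 / 10 * s)\<^sup>2 \<le> ln (real n) / 2"
    using s2 n by (simp add: power_mult_distrib power2_eq_square)
  then have "7 / 10 * s \<le> sqrt (ln (real n) / 2)"
    by (rule real_le_rsqrt)
  then have t: "7 / 10 * s - 1 \<le> t"
    by (simp add: t_def)
  have t1: "(t + 1)\<^sup>2 / 2 = ln (real n) / 4"
    using n by (simp add: t_def)
  define p where "p = exp (- (t + 1)\<^sup>2 / 2) / 3"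
  define e where "e = exp (ln (real n) / 4)"
  have p_eq: "p = 1 / (3 * e)"
    using t1 by (simp add: p_def e_def exp_minus field_simps)
  have "1 + ln (real n) / 4 \<le> e"
    unfolding e_def by (rule exp_ge_add_one_self)
  then have e: "6 \<le> e"
    using n by linarith
  have "e * e = exp (ln (real n) / 2)"
    by (simp add: e_def exp_add[symmetric])
  also have "\<dots> = r"
    unfolding r_def using n0 by (simp add: ln_sqrt[symmetric])
  finally have e2: "e * e = r" .
  have "(1 - p) ^ m \<le> exp (- p) ^ m"
  proof (rule power_mono)
    show "1 - p \<le> exp (- p)"
      using exp_ge_add_one_self[of "- p"] by simp
    show "0 \<le> 1 - p"
      using e by (simp add: p_eq field_simps)
  qed
  also have "\<dots> = exp (- (real m * p))"
    by (simp add: exp_of_nat_mult[symmetric])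
  also have "\<dots> \<le> exp (- 1)"
  proof -
    have "r / 2 \<le> real m"
      using m r by linarith
    then have "e * e \<le> 2 * real m"
      using e2 by simp
    moreover have "6 * e \<le> e * e"
      using e by (intro mult_right_mono) auto
    ultimately have "3 * e \<le> real m"
      by linarith
    then have "1 \<le> real m * p"
      using e by (simp add: p_eq field_simps)
    then show ?thesis
      by simp
  qed
  also have "\<dots> \<le> 1 / 2"
    using exp_ge_add_one_self[of 1] by (simp add: exp_minus field_simps)
  finally have prob: "2 / 5 \<le> 1 - (1 - p) ^ m - 1 / 50"
    by simp
  let ?B = "(t / 3 - 10 * \<eta> * sqrt (real m)) / (10 * r)"
  have B: "s / 10 / (10 * r) \<le> ?B"
    using t s pert r by (intro divide_right_mono) auto
  have B0: "0 \<le> ?B"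
    using s r by (intro order_trans[OF _ B]) auto
  have "s / (250 * r) = s / 10 / (10 * r) * (2 / 5)"
    by simp
  also have "\<dots> \<le> ?B * (1 - (1 - p) ^ m - 1 / 50)"
    using B B0 prob by (intro mult_mono) auto
  also have "\<dots> \<le> mean_norm n K"
    unfolding p_def r_def using m1 m22 y \<eta>2 t s B0
    by (intro mean_norm_ge[OF K Q, where y = y]) (auto simp: \<eta>_def r_def)
  finally show ?thesis
    by (simp add: s_def r_def)
qed

text \<open>The constant is \<open>1800 \<cdot> 300\<close>: if \<open>ln n < 300\<^sup>2\<close>, the bound \<open>1 / (1800 \<surd>n)\<close> loses
  at most a factor \<open>300\<close> against \<open>\<surd>(ln n)\<close>.\<close>

theorem mean_norm_lower_bound:
  assumes K: "ball_body n K" and J: "johns_position n K" and n: "2 \<le> n"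
  shows "sqrt (ln (real n)) / (540000 * sqrt (real n)) \<le> mean_norm n K"
proof (cases "90000 \<le> ln (real n)")
  case True
  have "sqrt (ln (real n)) / (540000 * sqrt (real n)) \<le> sqrt (ln (real n)) / (250 * sqrt (real n))"
    using n by (intro divide_left_mono) auto
  also have "\<dots> \<le> mean_norm n K"
    by (rule mean_norm_ge_large[OF K J True])
  finally show ?thesis .
next
  case False
  then have "sqrt (ln (real n)) \<le> sqrt (300\<^sup>2)"
    by (intro real_sqrt_le_mono) simp
  then have "sqrt (ln (real n)) / (540000 * sqrt (real n)) \<le> 300 / (540000 * sqrt (real n))"
    by (intro divide_right_mono) auto
  also have "\<dots> = 1 / (1800 * sqrt (real n))"
    by simp
  also have "\<dots> \<le> mean_norm n K"
    by (rule mean_norm_ge_inverse_sqrt[OF K J n])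
  finally show ?thesis .
qed

section \<open>The surface area inequality\<close>

theorem theorem6p4:
  shows "\<exists>c>0. \<forall>n\<ge>2. \<forall>K. convex_body n K \<and> johns_position n K \<longrightarrow>
    surface_area n K \<le>
      c * (real n powr (3/2) / sqrt (ln (real n))) * vol n K * mean_norm n K"
proof (intro exI[of _ 540000] conjI allI impI)
  fix n :: nat and K assume n: "2 \<le> n" and K: "convex_body n K \<and> johns_position n K"
  have B: "ball_body n K"
    using K by (intro ball_bodyI_convex_body) (auto simp: johns_position_def)
  let ?l = "sqrt (ln (real n))"
  have l: "0 < ?l"
    using n by simp
  have "real n powr (3/2) = real n powr (1 + 1/2)"
    by simp
  also have "\<dots> = real n * sqrt (real n)"
    using n by (subst powr_add) (simp add: powr_half_sqrt)
  finally have pw: "real n powr (3/2) = real n * sqrt (real n)" .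
  let ?c = "540000 * (real n * sqrt (real n) / ?l)"
  have "surface_area n K \<le> real n * vol n K"
    by (rule surface_area_le[OF B])
  also have "real n * vol n K = ?c * vol n K * (?l / (540000 * sqrt (real n)))"
    using n l by simp
  also have "\<dots> \<le> ?c * vol n K * mean_norm n K"
    using mean_norm_lower_bound[OF B _ n] K l
    by (intro mult_left_mono mult_nonneg_nonneg vol_nonneg divide_nonneg_nonneg) auto
  finally show "surface_area n K
      \<le> 540000 * (real n powr (3/2) / ?l) * vol n K * mean_norm n K"
    unfolding pw .
qed simp

end
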